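(* Let $\boldsymbol{F}^{(L)},\boldsymbol{F}^{(R)}\in\mathcal{S}(\mathcal{T}^{p,r}_{k},[0,1]^2)$ be an analysis-suitable $G^1$ two-patch parameterization, with associated functions $\alpha^{(L)},\alpha^{(R)},\beta$, and let $\beta^{(L)},\beta^{(R)}\in\mathcal{P}^1([0,1])$ be the pair satisfying $\beta=\alpha^{(L)}\beta^{(R)}-\alpha^{(R)}\beta^{(L)}$ that minimizes $\|\beta^{(L)}\|^2_{L_2([0,1])}+\|\beta^{(R)}\|^2_{L_2([0,1])}$ (so $\beta^{(L)}=\beta^{(R)}=0$ if $\beta=0$). Define isogeometric functions as follows. (1) For $i=2,\dots,p+k(p-r)$, $j=0,\dots,p+k(p-r)$, let $\phi^{(L)}_{i,j}$ be given by $g^{(L)}=N^{p,r}_{i,j}$, $g^{(R)}=0$, and $\phi^{(R)}_{i,j}$ by $g^{(L)}=0$, $g^{(R)}=N^{p,r}_{i,j}$. (2) Let $\tilde n=\dim\mathcal{S}(\widetilde{\mathcal{T}^p_k},[0,1])$ and choose functions $\tilde N_i,\tilde g_{1,i}$, $i=0,\dots,\tilde n-1$, by: - if $\beta=0$ or $z_\beta=0$: the $\tilde N_i$ are the B-splines of $\mathcal{S}(\widetilde{\mathcal{T}^p_k},[0,1])$ and $\tilde g_{1,i}=0$ for all $i$; - if $\beta\ne0$ and $z_\beta=1$, with $\tau_\ell$ the inner knot that is a root of $\beta$: $\tilde N_0,\dots,\tilde N_{\tilde n-2}$ are the B-splines of $\mathcal{S}(\mathcal{T}^{p,r+1}_k,[0,1])$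 with $\tilde g_{1,i}=0$, and $\tilde N_{\tilde n-1}$ is one of the B-splines of $\mathcal{S}(\mathcal{T}^{p,r+1}_{k,\ell},[0,1])$ with $\tilde N_{\tilde n-1}(\tau_\ell)\neq0$, with $\tilde g_{1,\tilde n-1}=-\frac{\beta^{(L)}(\tau_\ell)}{\alpha^{(L)}(\tau_\ell)}\tilde N_{\tilde n-1}'$; - if $\beta\ne0$ and $z_\beta=2$, with $\tau_\ell\neq\tau_{\ell'}$ the inner knots that are roots of $\beta$: $\tilde N_0,\dots,\tilde N_{\tilde n-3}$ are the B-splines of $\mathcal{S}(\mathcal{T}^{p,r+1}_k,[0,1])$ with $\tilde g_{1,i}=0$; $\tilde N_{\tilde n-2}$ is one of the B-splines of $\mathcal{S}(\mathcal{T}^{p,r+1}_{k,\ell},[0,1])$ with $\tilde N_{\tilde n-2}(\tau_\ell)\ne0$, with $\tilde g_{1,\tilde n-2}=-\frac{\beta^{(L)}(\tau_\ell)}{\alpha^{(L)}(\tau_\ell)}\tilde N_{\tilde n-2}'$; and $\tilde N_{\tilde n-1}$ is one of the B-splines of $\mathcal{S}(\mathcal{T}^{p,r+1}_{k,\ell'},[0,1])$ with $\tilde N_{\tilde n-1}(\tau_{\ell'})\ne0$, with $\tilde g_{1,\tilde n-1}=-\frac{\beta^{(L)}(\tau_{\ell'})}{\alpha^{(L)}(\tau_{\ell'})}\tilde N_{\tilde n-1}'$. For $i=0,\dots,\tilde n-1$ let $\phi_{0,i}$ be given, for $S\in\{L,R\}$, by $$g^{(S)}(u,v)=\tilde N_i(v)\bigl(N^{p,r}_0(u)+N^{p,r}_1(u)\bigr)+\bigl(\alpha^{(S)}(v)\tilde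 g_{1,i}(v)+\beta^{(S)}(v)\tilde N_i'(v)\bigr)\frac{1}{(k+1)p}N^{p,r}_1(u).$$ (3) Let $\bar n=\dim\mathcal{S}(\mathcal{T}^{p-d_\alpha,r}_k,[0,1])$ and let $\bar N_j$, $j=0,\dots,\bar n-1$, be the B-splines of this space. Let $\phi_{1,j}$ be given, for $S\in\{L,R\}$, by $g^{(S)}(u,v)=\frac{1}{(k+1)p}\alpha^{(S)}(v)\bar N_j(v)N^{p,r}_1(u)$. Then $\{\phi^{(S)}_{i,j}: S\in\{L,R\},\ 2\le i\le p+k(p-r),\ 0\le j\le p+k(p-r)\}$ is a basis of $\mathcal{V}^1_1$, $\{\phi_{0,i}\}_{i=0}^{\tilde n-1}\cup\{\phi_{1,j}\}_{j=0}^{\bar n-1}$ is a basis of $\mathcal{V}^1_2$, and together they form a basis of $\mathcal{V}^1$.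
   Context: Splines. Let $p\ge 3$, $1\le r\le p-2$ and $k\ge 0$ be integers and $0<\tau_1<\dots<\tau_k<1$. For a degree $q$ and regularity $s$, $\mathcal{T}^{q,s}_k$ is the open knot vector on $[0,1]$ in which $0$ and $1$ occur $q+1$ times and each inner knot $\tau_i$ occurs $q-s$ times. $\mathcal{S}(\mathcal{T}^{q,s}_k,[0,1])$ is the space of splines of degree $q$ with this knot vector, with B-spline basis $N^{q,s}_i$, $i=0,\dots,q+k(q-s)$; $\mathcal{S}(\mathcal{T}^{q,s}_k,[0,1]^2)$ is the tensor-product space with basis $N^{q,s}_{i,j}(u,v)=N^{q,s}_i(u)N^{q,s}_j(v)$. $\mathcal{T}^{q,s}_{k,\ell}$ (resp. $\mathcal{T}^{q,s}_{k,\ell,\ell'}$, $\ell\ne\ell'$) is obtained from $\mathcal{T}^{q,s}_k$ by inserting one additional copy of $\tau_\ell$ (resp. of each of $\tau_\ell,\tau_{\ell'}$). $\mathcal{P}^m([0,1])$ is the space of polynomials of degree at most $m$. Geometry. For $S\in\{L,R\}$, $\boldsymbol{F}^{(S)}:[0,1]^2\to\Omega^{(S)}\subset\mathbb{R}^2$ is a regular, bijective map with both components in $\mathcal{S}(\mathcal{T}^{p,r}_k,[0,1]^2)$; $\Omega=\Omega^{(L)}\cup\Omega^{(R)}$, and the two patches share a whole edge as common interface $\Gamma=\Omega^{(L)}\cap\Omega^{(R)}$, parameterized by $\boldsymbol{F}_0(v)=\boldsymbol{F}^{(L)}(0,v)=\boldsymbol{F}^{(R)}(0,v)$, $v\in[0,1]$.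 Analysis-suitable $G^1$ (AS $G^1$). The parameterization is AS $G^1$ if there exist $\alpha^{(L)},\alpha^{(R)},\beta^{(L)},\beta^{(R)}\in\mathcal{P}^1([0,1])$, with $\alpha^{(L)},\alpha^{(R)}$ relatively prime and $\alpha^{(L)}(v)\alpha^{(R)}(v)<0$ on $[0,1]$, such that, with $\beta=\alpha^{(L)}\beta^{(R)}-\alpha^{(R)}\beta^{(L)}$, $$\alpha^{(R)}(v)D_u\boldsymbol{F}^{(L)}(0,v)-\alpha^{(L)}(v)D_u\boldsymbol{F}^{(R)}(0,v)+\beta(v)\boldsymbol{F}_0'(v)=\boldsymbol{0}\quad\text{for all } v\in[0,1].$$ The functions $\alpha^{(L)},\alpha^{(R)},\beta$ are then unique up to a common nonzero constant, and are fixed; $\beta^{(L)},\beta^{(R)}$ are in general not unique. Further notation. $d_\alpha=\max(\deg\alpha^{(L)},\deg\alpha^{(R)})\in\{0,1\}$; $z_\beta=|\{v_0\in\{\tau_1,\dots,\tau_k\}:\beta(v_0)=0\}|$. The knot vector $\widetilde{\mathcal{T}^p_k}$ is: $\mathcal{T}^{p,r}_k$ if $\beta=0$; and, if $\beta\neq0$, $\mathcal{T}^{p,r+1}_k$ if $z_\beta=0$, $\mathcal{T}^{p,r+1}_{k,\ell}$ if $z_\beta=1$ with $\beta(\tau_\ell)=0$, $\mathcal{T}^{p,r+1}_{k,\ell,\ell'}$ if $z_\beta=2$ with $\beta(\tau_\ell)=\beta(\tau_{\ell'})=0$, $\ell\neq\ell'$. Spaces. $\mathcal{V}$ is the space of $\phi:\Omega\to\mathbb{R}$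 with $g^{(S)}:=\phi\circ\boldsymbol{F}^{(S)}\in\mathcal{S}(\mathcal{T}^{p,r}_k,[0,1]^2)$, $S\in\{L,R\}$; a function in $\mathcal{V}$ is determined by the pair $g^{(L)},g^{(R)}$. Write $g^{(S)}=\sum_{i,j}d^{(S)}_{i,j}N^{p,r}_{i,j}$. $\mathcal{V}^1=\mathcal{V}\cap C^1(\Omega)$; explicitly, $\phi\in\mathcal{V}$ is in $\mathcal{V}^1$ iff $g^{(L)}(0,v)=g^{(R)}(0,v)=:g(v)$ and $\alpha^{(R)}(v)D_ug^{(L)}(0,v)-\alpha^{(L)}(v)D_ug^{(R)}(0,v)+\beta(v)g'(v)=0$ for all $v\in[0,1]$. $\mathcal{V}^1_1$ is the subspace of $\phi\in\mathcal{V}^1$ with $d^{(S)}_{i,j}=0$ for $S\in\{L,R\}$, $i\in\{0,1\}$ and all $j$; $\mathcal{V}^1_2$ is the subspace of $\phi\in\mathcal{V}^1$ with $d^{(S)}_{i,j}=0$ for $S\in\{L,R\}$, all $i\ge2$ and all $j$.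
   Formalization: In φ_{0,i} the factor 1/((k+1)p) is replaced by h/p, where h is the length of the first knot span (τ_1, or 1 if k=0); the literal factor fails when β≠0 and h≠1/(k+1), and agrees with it when h=1/(k+1), while for β=0 the term vanishes. *)

theory Defs
  imports
    "HOL-Analysis.Analysis"
    "HOL-Computational_Algebra.Polynomial"
    "HOL-Library.Function_Algebras"
begin

section \<open>Real-valued functions as a vector space\<close>

definition fun_scale :: "real \<Rightarrow> ('a \<Rightarrow> real) \<Rightarrow> 'a \<Rightarrow> real" where
  "fun_scale c f = (\<lambda>x. c * f x)"

interpretation fun_vs: vector_space "fun_scale :: real \<Rightarrow> ('a \<Rightarrow> real) \<Rightarrow> 'a \<Rightarrow> real"
  by unfold_locales (auto simp: fun_scale_def algebra_simps)

definition basis_family :: "'i set \<Rightarrow> ('i \<Rightarrow> 'a \<Rightarrow> real) \<Rightarrow> ('a \<Rightarrow> real) set \<Rightarrow> bool" where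
  "basis_family I f V \<longleftrightarrow>
     inj_on f I \<and> fun_vs.independent (f ` I) \<and> fun_vs.span (f ` I) = V"


section \<open>Splines\<close>

text \<open>The open knot vector on $[0,1]$ of degree \<open>q\<close> and regularity \<open>s\<close> with inner knots
  \<open>\<tau> 1 < \<dots> < \<tau> k\<close>, in which \<open>\<tau> i\<close> gets one additional copy for every \<open>i \<in> E\<close>.
  Hence \<open>E = {}\<close>, \<open>E = {l}\<close>, \<open>E = {l, l'}\<close> give
  $\mathcal{T}^{q,s}_{k}$, $\mathcal{T}^{q,s}_{k,l}$, $\mathcal{T}^{q,s}_{k,l,l'}$.\<close>

definition knots :: "nat \<Rightarrow> (nat \<Rightarrow> real) \<Rightarrow> nat \<Rightarrow> nat \<Rightarrow> nat set \<Rightarrow> real list" where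
  "knots k \<tau> q s E =
     replicate (q + 1) 0
     @ concat (map (\<lambda>i. replicate (if i \<in> E then q - s + 1 else q - s) (\<tau> i)) [1..<k+1])
     @ replicate (q + 1) 1"

text \<open>Cox-de Boor recursion; the quotients with denominator \<open>0\<close> are \<open>0\<close>. The last nonempty
  knot span is taken closed, so that the functions are the usual B-splines on the whole of
  $[0,1]$. They vanish outside $[0,1]$, hence linear (in)dependence as functions on the real
  line is the same as on $[0,1]$.\<close>

fun bspline :: "real list \<Rightarrow> nat \<Rightarrow> nat \<Rightarrow> real \<Rightarrow> real" where
  "bspline t 0 i x =
     (if t ! i \<le> x \<and> x < t ! (i + 1) \<or> t ! i < t ! (i + 1) \<and> x = t ! (i + 1) \<and> x = last t
      then 1 else 0)"
| "bspline t (Suc q) i x =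
     (x - t ! i) / (t ! (i + q + 1) - t ! i) * bspline t q i x
     + (t ! (i + q + 2) - x) / (t ! (i + q + 2) - t ! (i + 1)) * bspline t q (i + 1) x"

definition num_bsplines :: "nat \<Rightarrow> real list \<Rightarrow> nat" where
  "num_bsplines q t = length t - (q + 1)"

definition spline_space :: "nat \<Rightarrow> real list \<Rightarrow> (real \<Rightarrow> real) set" where
  "spline_space q t = fun_vs.span (bspline t q ` {..<num_bsplines q t})"

definition bspline2 :: "real list \<Rightarrow> nat \<Rightarrow> nat \<Rightarrow> nat \<Rightarrow> real \<times> real \<Rightarrow> real" where
  "bspline2 t q i j = (\<lambda>(u, v). bspline t q i u * bspline t q j v)"

definition spline_space2 :: "nat \<Rightarrow> real list \<Rightarrow> (real \<times> real \<Rightarrow> real) set" where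
  "spline_space2 q t =
     fun_vs.span {bspline2 t q i j | i j. i < num_bsplines q t \<and> j < num_bsplines q t}"


section \<open>Calculus on the unit interval and the unit square\<close>

definition unit_square :: "(real \<times> real) set" where
  "unit_square = {0..1} \<times> {0..1}"

text \<open>Restriction to the unit square, extended by zero (as the tensor-product B-splines are).\<close>

definition on_square :: "(real \<times> real \<Rightarrow> real) \<Rightarrow> real \<times> real \<Rightarrow> real" where
  "on_square f = (\<lambda>x. if x \<in> unit_square then f x else 0)"

text \<open>All derivatives are one-sided at the end points of $[0,1]$.\<close>

definition deriv01 :: "(real \<Rightarrow> 'b::real_normed_vector) \<Rightarrow> real \<Rightarrow> 'b" where
  "deriv01 f v = vector_derivative f (at v within {0..1})"

definition D_u :: "(real \<times> real \<Rightarrow> 'b::real_normed_vector) \<Rightarrow> real \<times> real \<Rightarrow> 'b" where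
  "D_u f = (\<lambda>(u, v). deriv01 (\<lambda>s. f (s, v)) u)"

definition D_v :: "(real \<times> real \<Rightarrow> 'b::real_normed_vector) \<Rightarrow> real \<times> real \<Rightarrow> 'b" where
  "D_v f = (\<lambda>(u, v). deriv01 (\<lambda>s. f (u, s)) v)"

definition C1_on :: "'a::real_inner set \<Rightarrow> ('a \<Rightarrow> real) \<Rightarrow> bool" where
  "C1_on X f \<longleftrightarrow>
     (\<exists>G. continuous_on X G \<and> (\<forall>x\<in>X. (f has_derivative (\<lambda>h. G x \<bullet> h)) (at x within X)))"


section \<open>Two-patch geometries\<close>

datatype side = PL | PR

definition patch :: "(side \<Rightarrow> real \<times> real \<Rightarrow> real \<times> real) \<Rightarrow> side \<Rightarrow> (real \<times> real) set" where
  "patch F S = F S ` unit_square"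

definition domain :: "(side \<Rightarrow> real \<times> real \<Rightarrow> real \<times> real) \<Rightarrow> (real \<times> real) set" where
  "domain F = patch F PL \<union> patch F PR"

definition regular :: "(real \<times> real \<Rightarrow> real \<times> real) \<Rightarrow> bool" where
  "regular f \<longleftrightarrow>
     (\<forall>x\<in>unit_square. fst (D_u f x) * snd (D_v f x) - snd (D_u f x) * fst (D_v f x) \<noteq> 0)"

definition two_patch_geometry ::
    "nat \<Rightarrow> real list \<Rightarrow> (side \<Rightarrow> real \<times> real \<Rightarrow> real \<times> real) \<Rightarrow> bool" where
  "two_patch_geometry p t F \<longleftrightarrow>
     (\<forall>S. on_square (fst \<circ> F S) \<in> spline_space2 p t \<and> on_square (snd \<circ> F S) \<in> spline_space2 p t) \<and>
     (\<forall>S. regular (F S) \<and> inj_on (F S) unit_square) \<and>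
     (\<forall>v\<in>{0..1}. F PL (0, v) = F PR (0, v)) \<and>
     patch F PL \<inter> patch F PR = (\<lambda>v. F PL (0, v)) ` {0..1}"

definition beta_split :: "(side \<Rightarrow> real poly) \<Rightarrow> real poly \<Rightarrow> (side \<Rightarrow> real poly) \<Rightarrow> bool" where
  "beta_split \<alpha> \<beta> b \<longleftrightarrow> (\<forall>S. degree (b S) \<le> 1) \<and> \<beta> = \<alpha> PL * b PR - \<alpha> PR * b PL"

definition AS_G1 ::
    "(side \<Rightarrow> real \<times> real \<Rightarrow> real \<times> real) \<Rightarrow> (side \<Rightarrow> real poly) \<Rightarrow> real poly \<Rightarrow> bool" where
  "AS_G1 F \<alpha> \<beta> \<longleftrightarrow>
     (\<forall>S. degree (\<alpha> S) \<le> 1) \<and> coprime (\<alpha> PL) (\<alpha> PR) \<and>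
     (\<forall>v\<in>{0..1}. poly (\<alpha> PL) v * poly (\<alpha> PR) v < 0) \<and>
     (\<exists>b. beta_split \<alpha> \<beta> b) \<and>
     (\<forall>v\<in>{0..1}. poly (\<alpha> PR) v *\<^sub>R D_u (F PL) (0, v) - poly (\<alpha> PL) v *\<^sub>R D_u (F PR) (0, v)
        + poly \<beta> v *\<^sub>R deriv01 (\<lambda>w. F PL (0, w)) v = 0)"

definition minimal_beta_split :: "(side \<Rightarrow> real poly) \<Rightarrow> real poly \<Rightarrow> (side \<Rightarrow> real poly) \<Rightarrow> bool" where
  "minimal_beta_split \<alpha> \<beta> b \<longleftrightarrow>
     is_arg_min
       (\<lambda>b. integral {0..1} (\<lambda>v. (poly (b PL) v)\<^sup>2) + integral {0..1} (\<lambda>v. (poly (b PR) v)\<^sup>2))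
       (beta_split \<alpha> \<beta>) b"

definition d_alpha :: "(side \<Rightarrow> real poly) \<Rightarrow> nat" where
  "d_alpha \<alpha> = max (degree (\<alpha> PL)) (degree (\<alpha> PR))"

text \<open>Indices of the inner knots at which \<open>\<beta>\<close> vanishes; $z_\beta$ is its cardinality.\<close>

definition root_knots :: "nat \<Rightarrow> (nat \<Rightarrow> real) \<Rightarrow> real poly \<Rightarrow> nat set" where
  "root_knots k \<tau> \<beta> = {l \<in> {1..k}. poly \<beta> (\<tau> l) = 0}"

definition z_beta :: "nat \<Rightarrow> (nat \<Rightarrow> real) \<Rightarrow> real poly \<Rightarrow> nat" where
  "z_beta k \<tau> \<beta> = card (root_knots k \<tau> \<beta>)"

definition tilde_knots :: "nat \<Rightarrow> (nat \<Rightarrow> real) \<Rightarrow> nat \<Rightarrow> nat \<Rightarrow> real poly \<Rightarrow> real list" where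
  "tilde_knots k \<tau> p r \<beta> =
     (if \<beta> = 0 then knots k \<tau> p r {} else knots k \<tau> p (r + 1) (root_knots k \<tau> \<beta>))"


section \<open>Isogeometric spaces\<close>

text \<open>A function on \<open>domain F\<close> is represented by its extension by zero.\<close>

definition space_V :: "nat \<Rightarrow> real list \<Rightarrow> (side \<Rightarrow> real \<times> real \<Rightarrow> real \<times> real)
    \<Rightarrow> (real \<times> real \<Rightarrow> real) set" where
  "space_V p t F =
     {\<phi>. (\<forall>x. x \<notin> domain F \<longrightarrow> \<phi> x = 0) \<and> (\<forall>S. on_square (\<phi> \<circ> F S) \<in> spline_space2 p t)}"

definition space_V1 :: "nat \<Rightarrow> real list \<Rightarrow> (side \<Rightarrow> real \<times> real \<Rightarrow> real \<times> real)
    \<Rightarrow> (real \<times> real \<Rightarrow> real) set" where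
  "space_V1 p t F = {\<phi> \<in> space_V p t F. C1_on (domain F) \<phi>}"

text \<open>The pull-backs of \<open>\<phi>\<close> have the B-spline coefficients \<open>d S i j\<close>.\<close>

definition has_coeffs :: "nat \<Rightarrow> real list \<Rightarrow> (side \<Rightarrow> real \<times> real \<Rightarrow> real \<times> real)
    \<Rightarrow> (real \<times> real \<Rightarrow> real) \<Rightarrow> (side \<Rightarrow> nat \<Rightarrow> nat \<Rightarrow> real) \<Rightarrow> bool" where
  "has_coeffs p t F \<phi> d \<longleftrightarrow>
     (\<forall>S. \<forall>x\<in>unit_square. \<phi> (F S x) =
        (\<Sum>i<num_bsplines p t. \<Sum>j<num_bsplines p t. d S i j * bspline2 t p i j x))"

definition space_V11 :: "nat \<Rightarrow> real list \<Rightarrow> (side \<Rightarrow> real \<times> real \<Rightarrow> real \<times> real)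
    \<Rightarrow> (real \<times> real \<Rightarrow> real) set" where
  "space_V11 p t F = {\<phi> \<in> space_V1 p t F.
     \<exists>d. has_coeffs p t F \<phi> d \<and> (\<forall>S. \<forall>i\<in>{0, 1}. \<forall>j<num_bsplines p t. d S i j = 0)}"

definition space_V12 :: "nat \<Rightarrow> real list \<Rightarrow> (side \<Rightarrow> real \<times> real \<Rightarrow> real \<times> real)
    \<Rightarrow> (real \<times> real \<Rightarrow> real) set" where
  "space_V12 p t F = {\<phi> \<in> space_V1 p t F.
     \<exists>d. has_coeffs p t F \<phi> d \<and>
       (\<forall>S. \<forall>i\<in>{2..<num_bsplines p t}. \<forall>j<num_bsplines p t. d S i j = 0)}"

text \<open>The function on \<open>domain F\<close> with pull-backs \<open>g PL\<close> and \<open>g PR\<close>. This is meaningful for pairs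
  with \<open>g PL (0, v) = g PR (0, v)\<close>, for which the precedence of \<open>PL\<close> on the interface is
  immaterial.\<close>

definition from_pair :: "(side \<Rightarrow> real \<times> real \<Rightarrow> real \<times> real) \<Rightarrow> (side \<Rightarrow> real \<times> real \<Rightarrow> real)
    \<Rightarrow> real \<times> real \<Rightarrow> real" where
  "from_pair F g x =
     (if x \<in> patch F PL then g PL (inv_into unit_square (F PL) x)
      else if x \<in> patch F PR then g PR (inv_into unit_square (F PR) x)
      else 0)"


section \<open>The basis functions\<close>

definition n_tilde :: "nat \<Rightarrow> (nat \<Rightarrow> real) \<Rightarrow> nat \<Rightarrow> nat \<Rightarrow> real poly \<Rightarrow> nat" where
  "n_tilde k \<tau> p r \<beta> = fun_vs.dim (spline_space p (tilde_knots k \<tau> p r \<beta>))"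

definition n_bar :: "nat \<Rightarrow> (nat \<Rightarrow> real) \<Rightarrow> nat \<Rightarrow> nat \<Rightarrow> (side \<Rightarrow> real poly) \<Rightarrow> nat" where
  "n_bar k \<tau> p r \<alpha> =
     fun_vs.dim (spline_space (p - d_alpha \<alpha>) (knots k \<tau> (p - d_alpha \<alpha>) r {}))"

text \<open>\<open>N\<close> and \<open>g\<close> are, on $[0,1]$, one of the B-splines of $\mathcal{T}^{p,r+1}_{k,l}$ that do
  not vanish at the knot \<open>\<tau> l\<close>, and the function $\tilde g_1$ that goes with it.\<close>

definition extra_choice :: "nat \<Rightarrow> (nat \<Rightarrow> real) \<Rightarrow> nat \<Rightarrow> nat \<Rightarrow> (side \<Rightarrow> real poly)
    \<Rightarrow> (side \<Rightarrow> real poly) \<Rightarrow> nat \<Rightarrow> (real \<Rightarrow> real) \<Rightarrow> (real \<Rightarrow> real) \<Rightarrow> bool" where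
  "extra_choice k \<tau> p r \<alpha> b l N g \<longleftrightarrow>
     (\<exists>j<num_bsplines p (knots k \<tau> p (r + 1) {l}).
        \<forall>v\<in>{0..1}. N v = bspline (knots k \<tau> p (r + 1) {l}) p j v) \<and>
     N (\<tau> l) \<noteq> 0 \<and>
     (\<forall>v\<in>{0..1}. g v = - (poly (b PL) (\<tau> l) / poly (\<alpha> PL) (\<tau> l)) * deriv01 N v)"

definition trace_choice :: "nat \<Rightarrow> (nat \<Rightarrow> real) \<Rightarrow> nat \<Rightarrow> nat \<Rightarrow> (side \<Rightarrow> real poly) \<Rightarrow> real poly
    \<Rightarrow> (side \<Rightarrow> real poly) \<Rightarrow> (nat \<Rightarrow> real \<Rightarrow> real) \<Rightarrow> (nat \<Rightarrow> real \<Rightarrow> real) \<Rightarrow> bool" where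
  "trace_choice k \<tau> p r \<alpha> \<beta> b N g \<longleftrightarrow>
     (let n = n_tilde k \<tau> p r \<beta>; z = z_beta k \<tau> \<beta> in
       (\<beta> = 0 \<or> z = 0 \<longrightarrow>
          (\<forall>i<n. \<forall>v\<in>{0..1}. N i v = bspline (tilde_knots k \<tau> p r \<beta>) p i v \<and> g i v = 0)) \<and>
       (\<beta> \<noteq> 0 \<and> z = 1 \<longrightarrow>
          (\<forall>i<n-1. \<forall>v\<in>{0..1}. N i v = bspline (knots k \<tau> p (r + 1) {}) p i v \<and> g i v = 0) \<and>
          (\<exists>l. root_knots k \<tau> \<beta> = {l} \<and>
             extra_choice k \<tau> p r \<alpha> b l (N (n - 1)) (g (n - 1)))) \<and>
       (\<beta> \<noteq> 0 \<and> z = 2 \<longrightarrow>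
          (\<forall>i<n-2. \<forall>v\<in>{0..1}. N i v = bspline (knots k \<tau> p (r + 1) {}) p i v \<and> g i v = 0) \<and>
          (\<exists>l l'. l \<noteq> l' \<and> root_knots k \<tau> \<beta> = {l, l'} \<and>
             extra_choice k \<tau> p r \<alpha> b l (N (n - 2)) (g (n - 2)) \<and>
             extra_choice k \<tau> p r \<alpha> b l' (N (n - 1)) (g (n - 1)))))"

definition phi_patch :: "nat \<Rightarrow> real list \<Rightarrow> (side \<Rightarrow> real \<times> real \<Rightarrow> real \<times> real)
    \<Rightarrow> side \<Rightarrow> nat \<Rightarrow> nat \<Rightarrow> real \<times> real \<Rightarrow> real" where
  "phi_patch p t F S i j = from_pair F (\<lambda>S'. if S' = S then bspline2 t p i j else (\<lambda>_. 0))"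

text \<open>Length of the first knot span. The derivative of \<open>bspline (knots k \<tau> p r {}) p 1\<close> at \<open>0\<close> is
  \<open>p / first_span k \<tau>\<close>.\<close>

definition first_span :: "nat \<Rightarrow> (nat \<Rightarrow> real) \<Rightarrow> real" where
  "first_span k \<tau> = (if k = 0 then 1 else \<tau> 1)"

text \<open>The factor of the second summand has to be the reciprocal of that derivative, otherwise
  \<open>phi_trace\<close> is in general not $C^1$ across the interface when \<open>\<beta> \<noteq> 0\<close>. For a first knot span of
  length $1/(k+1)$, in particular for equidistant knots, it is the $1/((k+1)p)$ of the literature
  (\<open>first_span_factor\<close>); when \<open>\<beta> = 0\<close> the second summand is zero.\<close>

definition phi_trace :: "nat \<Rightarrow> (nat \<Rightarrow> real) \<Rightarrow> nat \<Rightarrow> nat \<Rightarrow> (side \<Rightarrow> real \<times> real \<Rightarrow> real \<times> real)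
    \<Rightarrow> (side \<Rightarrow> real poly) \<Rightarrow> (side \<Rightarrow> real poly) \<Rightarrow> (real \<Rightarrow> real) \<Rightarrow> (real \<Rightarrow> real)
    \<Rightarrow> real \<times> real \<Rightarrow> real" where
  "phi_trace k \<tau> p r F \<alpha> b N g = from_pair F (\<lambda>S (u, v).
     N v * (bspline (knots k \<tau> p r {}) p 0 u + bspline (knots k \<tau> p r {}) p 1 u)
     + (poly (\<alpha> S) v * g v + poly (b S) v * deriv01 N v)
       * (first_span k \<tau> / real p) * bspline (knots k \<tau> p r {}) p 1 u)"

lemma first_span_factor:
  assumes "k > 0 \<Longrightarrow> \<tau> 1 = 1 / (real k + 1)"
  shows "first_span k \<tau> / real p = 1 / ((real k + 1) * real p)"
  using assms by (simp add: first_span_def)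

definition phi_normal :: "nat \<Rightarrow> (nat \<Rightarrow> real) \<Rightarrow> nat \<Rightarrow> nat \<Rightarrow> (side \<Rightarrow> real \<times> real \<Rightarrow> real \<times> real)
    \<Rightarrow> (side \<Rightarrow> real poly) \<Rightarrow> nat \<Rightarrow> real \<times> real \<Rightarrow> real" where
  "phi_normal k \<tau> p r F \<alpha> j = from_pair F (\<lambda>S (u, v).
     1 / ((real k + 1) * real p) * poly (\<alpha> S) v
     * bspline (knots k \<tau> (p - d_alpha \<alpha>) r {}) (p - d_alpha \<alpha>) j v
     * bspline (knots k \<tau> p r {}) p 1 u)"

datatype basis_index = Patch side nat nat | Trace nat | Normal nat

definition patch_indices :: "nat \<Rightarrow> nat \<Rightarrow> nat \<Rightarrow> basis_index set" where
  "patch_indices k p r =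
     {Patch S i j | S i j. 2 \<le> i \<and> i \<le> p + k * (p - r) \<and> j \<le> p + k * (p - r)}"

definition interface_indices :: "nat \<Rightarrow> nat \<Rightarrow> basis_index set" where
  "interface_indices n m = Trace ` {..<n} \<union> Normal ` {..<m}"

fun phi :: "nat \<Rightarrow> (nat \<Rightarrow> real) \<Rightarrow> nat \<Rightarrow> nat \<Rightarrow> (side \<Rightarrow> real \<times> real \<Rightarrow> real \<times> real)
    \<Rightarrow> (side \<Rightarrow> real poly) \<Rightarrow> (side \<Rightarrow> real poly) \<Rightarrow> (nat \<Rightarrow> real \<Rightarrow> real) \<Rightarrow> (nat \<Rightarrow> real \<Rightarrow> real)
    \<Rightarrow> basis_index \<Rightarrow> real \<times> real \<Rightarrow> real" where
  "phi k \<tau> p r F \<alpha> b N g (Patch S i j) = phi_patch p (knots k \<tau> p r {}) F S i j"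
| "phi k \<tau> p r F \<alpha> b N g (Trace i) = phi_trace k \<tau> p r F \<alpha> b (N i) (g i)"
| "phi k \<tau> p r F \<alpha> b N g (Normal j) = phi_normal k \<tau> p r F \<alpha> j"

end

theory Submission
  imports Defs
begin

text \<open>By the chain rule on each patch, \<open>\<phi>\<close> is $C^1$ on the domain iff its pull-backs satisfy the
  interface equation $\alpha^R D_u g^L - \alpha^L D_u g^R + \beta g' = 0$ at $u = 0$; only the first two
  columns of B-spline coefficients enter it. Univariate splines are sums of truncated polynomials, so
  the equation holds iff it holds for the polynomial jumps at every break point (the first piece
  counting as the jump at $0$). There, coprimality of $\alpha^L$ and $\alpha^R$ gives
  $D_u g^S = \alpha^S K + \beta^S g'$ with a polynomial $K$. Wherever $\beta$ does not vanish, the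
  equation forces one order of smoothness more on the trace $g$; at an inner knot where it
  vanishes, the trace keeps one degree of freedom, which the extra B-spline together with its
  $\tilde g_1$ provides. After subtracting the trace functions, $K$ is an arbitrary spline of degree
  $p - d_\alpha$ and regularity $r$.\<close>

section \<open>Finite families of functions\<close>

text \<open>That B-splines span exactly the truncated polynomials of the right smoothness is not
  postulated. Marsden's identity expands truncated powers in B-splines; there are equally many of
  both and the truncated powers are easily seen to be independent, so an exchange argument yields
  the independence of the B-splines and the equality of spans at once. The delicate point is the
  extra B-spline at a root \<tau>_l of \<beta>. It is only known not to vanish at \<tau>_l, but it
  must have a genuine jump in the derivative of order r + 1 there. An explicit functional on
  B-spline coefficients decides this: it annihilates every smoother spline and has a nonzero entry
  at each B-spline that does not vanish at the knot. The form of the function g_1 that accompanies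
  it comes from \<beta>(\<tau>_l) = 0, which says that the quotients b^S / \<alpha>^S of the two
  sides agree at \<tau>_l. With c = - b^L / \<alpha>^L taken there, both factors c \<alpha>^S + b^S
  vanish at \<tau>_l, and this zero makes up for the derivative that the trace lacks.\<close>

definition indep_fam :: "'i set \<Rightarrow> ('i \<Rightarrow> 'a \<Rightarrow> real) \<Rightarrow> bool" where
  "indep_fam I f \<longleftrightarrow> (\<forall>c. (\<forall>x. (\<Sum>i\<in>I. c i * f i x) = 0) \<longrightarrow> (\<forall>i\<in>I. c i = 0))"

lemma indep_famD:
  assumes "indep_fam I f" "\<And>x. (\<Sum>i\<in>I. c i * f i x) = 0" "i \<in> I"
  shows "c i = 0"
  using assms(1)[unfolded indep_fam_def, rule_format, of c i] assms(2,3) by simp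

lemma indep_fam_mono:
  assumes "indep_fam I f" "J \<subseteq> I" "finite I"
  shows "indep_fam J f"
  unfolding indep_fam_def
proof (intro allI impI ballI)
  fix c j assume c: "\<forall>x. (\<Sum>i\<in>J. c i * f i x) = 0" and j: "j \<in> J"
  have "(\<Sum>i\<in>I. (if i \<in> J then c i else 0) * f i x) = 0" for x
  proof -
    have "(\<Sum>i\<in>I. (if i \<in> J then c i else 0) * f i x) = (\<Sum>i\<in>J. (if i \<in> J then c i else 0) * f i x)"
      using assms by (intro sum.mono_neutral_right) auto
    also have "\<dots> = (\<Sum>i\<in>J. c i * f i x)" by (intro sum.cong) auto
    finally show ?thesis using c by simp
  qed
  with j assms(2) show "c j = 0"
    using indep_famD[OF assms(1), of "\<lambda>i. if i \<in> J then c i else 0" j] by auto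
qed

lemma sum_fun_apply: "(\<Sum>i\<in>I. F i) x = (\<Sum>i\<in>I. F i x)" for F :: "'i \<Rightarrow> 'a \<Rightarrow> real"
  by (induction I rule: infinite_finite_induct) auto

text \<open>The span is that of the image set, which forgets the indices. Repetitions in the family
  do no harm: each induction step adds its scalar to the coefficient of one index that maps to the
  vector at hand.\<close>

lemma in_span_family_iff:
  assumes "finite I"
  shows "h \<in> fun_vs.span (f ` I) \<longleftrightarrow> (\<exists>c. \<forall>x. h x = (\<Sum>i\<in>I. c i * f i x))"
proof
  assume "h \<in> fun_vs.span (f ` I)"
  then show "\<exists>c. \<forall>x. h x = (\<Sum>i\<in>I. c i * f i x)"
  proof (induction rule: fun_vs.span_induct_alt)
    case base
    have "\<forall>x. (0::'b \<Rightarrow> real) x = (\<Sum>i\<in>I. 0 * f i x)" by simp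
    then show ?case by (rule exI[of _ "\<lambda>_. 0"])
  next
    case (step a u y)
    then obtain c j where c: "\<forall>x. y x = (\<Sum>i\<in>I. c i * f i x)" and j: "j \<in> I" "u = f j" by blast
    have "(fun_scale a u + y) x = (\<Sum>i\<in>I. (c i + (if i = j then a else 0)) * f i x)" for x
    proof -
      have "(\<Sum>i\<in>I. (c i + (if i = j then a else 0)) * f i x)
        = (\<Sum>i\<in>I. c i * f i x) + (\<Sum>i\<in>I. (if i = j then a * f i x else 0))"
        by (subst sum.distrib[symmetric]) (intro sum.cong, auto simp: algebra_simps)
      also have "(\<Sum>i\<in>I. (if i = j then a * f i x else 0)) = a * u x"
        using assms j by simp
      finally show ?thesis using c by (simp add: fun_scale_def)
    qed
    then show ?case by (intro exI[of _ "\<lambda>i. c i + (if i = j then a else 0)"] allI)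
  qed
next
  assume "\<exists>c. \<forall>x. h x = (\<Sum>i\<in>I. c i * f i x)"
  then obtain c where "\<forall>x. h x = (\<Sum>i\<in>I. c i * f i x)" by blast
  then have "h = (\<Sum>i\<in>I. fun_scale (c i) (f i))"
    by (auto simp: fun_scale_def sum_fun_apply)
  then show "h \<in> fun_vs.span (f ` I)"
    by (simp only:) (intro fun_vs.span_sum fun_vs.span_scale fun_vs.span_base imageI)
qed

text \<open>A repetition f i = f j would give the nontrivial relation f i - f j = 0, so independence
  of the indexed family already contains injectivity. The right side is the pair of conditions in
  \<open>basis_family\<close>.\<close>

lemma indep_fam_iff:
  assumes "finite I"
  shows "indep_fam I f \<longleftrightarrow> inj_on f I \<and> fun_vs.independent (f ` I)"
proof
  assume ind: "indep_fam I f"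
  have inj: "inj_on f I"
  proof (rule inj_onI, rule ccontr)
    fix i j assume ij: "i \<in> I" "j \<in> I" "f i = f j" "i \<noteq> j"
    define c where "c l = (if l = i then 1 else if l = j then -1 else (0::real))" for l
    have "(\<Sum>l\<in>I. c l * f l x) = (\<Sum>l\<in>{i,j}. c l * f l x)" for x
      using ij assms by (intro sum.mono_neutral_right) (auto simp: c_def)
    also have "(\<Sum>l\<in>{i,j}. c l * f l x) = 0" for x
      using ij by (simp add: c_def)
    finally have "c i = 0" using indep_famD[OF ind, of c i] ij(1) by simp
    then show False by (simp add: c_def)
  qed
  moreover have "fun_vs.independent (f ` I)"
  proof (rule fun_vs.independent_if_scalars_zero)
    show "finite (f ` I)" using assms by simp
    fix u x assume u: "(\<Sum>x\<in>f ` I. fun_scale (u x) x) = 0" and x: "x \<in> f ` I"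
    have "(\<Sum>i\<in>I. u (f i) * f i y) = (\<Sum>x\<in>f ` I. fun_scale (u x) x) y" for y
      by (simp add: sum.reindex[OF inj] sum_fun_apply fun_scale_def)
    then have "(\<Sum>i\<in>I. u (f i) * f i y) = 0" for y using u by simp
    with x show "u x = 0" using indep_famD[OF ind, of "\<lambda>i. u (f i)"] by auto
  qed
  ultimately show "inj_on f I \<and> fun_vs.independent (f ` I)" by blast
next
  assume *: "inj_on f I \<and> fun_vs.independent (f ` I)"
  show "indep_fam I f" unfolding indep_fam_def
  proof (intro allI impI ballI)
    fix c i assume c: "\<forall>x. (\<Sum>i\<in>I. c i * f i x) = 0" and i: "i \<in> I"
    have "(\<Sum>x\<in>f ` I. fun_scale (c (inv_into I f x)) x) = 0"
    proof
      fix y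
      have "(\<Sum>x\<in>f ` I. fun_scale (c (inv_into I f x)) x) y = (\<Sum>i\<in>I. c i * f i y)"
        using * by (simp add: sum.reindex sum_fun_apply fun_scale_def)
      then show "(\<Sum>x\<in>f ` I. fun_scale (c (inv_into I f x)) x) y = 0 y" using c by simp
    qed
    then have "c (inv_into I f (f i)) = 0"
      using * i assms by (intro fun_vs.independentD[of "f ` I" "f ` I" "\<lambda>x. c (inv_into I f x)"]) auto
    then show "c i = 0" using * i by simp
  qed
qed

lemma basis_familyI:
  assumes "finite I" "indep_fam I f" "fun_vs.subspace V" "\<And>i. i \<in> I \<Longrightarrow> f i \<in> V"
    and "\<And>h. h \<in> V \<Longrightarrow> \<exists>c. \<forall>x. h x = (\<Sum>i\<in>I. c i * f i x)"
  shows "basis_family I f V"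
proof -
  have "fun_vs.span (f ` I) \<subseteq> V" using assms(3,4) by (intro fun_vs.span_minimal) auto
  moreover have "V \<subseteq> fun_vs.span (f ` I)"
    using assms(5) by (auto simp: in_span_family_iff[OF assms(1)])
  ultimately show ?thesis
    using assms(2) unfolding basis_family_def indep_fam_iff[OF assms(1)] by blast
qed

text \<open>An independent family of at least \<open>card J\<close> members inside the span of
  \<open>card J\<close> generators leaves no slack: no generator can lie outside its span, and none
  can be redundant. With truncated powers as \<open>f\<close> and B-splines as \<open>g\<close>, the
  B-splines get their independence from a count.\<close>

lemma steinitz_family:
  assumes "finite I" "finite J" "card J \<le> card I" "indep_fam I f"
    and "\<And>i. i \<in> I \<Longrightarrow> f i \<in> fun_vs.span (g ` J)"
  shows "indep_fam J g" "fun_vs.span (g ` J) = fun_vs.span (f ` I)"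
proof -
  note f' = iffD1[OF indep_fam_iff[OF assms(1)] assms(4)]
  have f: "inj_on f I" "fun_vs.independent (f ` I)"
    by (rule conjunct1[OF f'], rule conjunct2[OF f'])
  have sub: "f ` I \<subseteq> fun_vs.span (g ` J)" using assms(5) by (rule image_subsetI)
  have cf: "card (f ` I) = card I" using f by (simp add: card_image)
  have cg: "card (g ` J) \<le> card J" using assms(2) by (rule card_image_le)
  have bound: "card S \<le> card (g ` J)" if "fun_vs.independent S" "S \<subseteq> fun_vs.span (g ` J)" for S
    using fun_vs.independent_span_bound[OF finite_imageI[OF assms(2)] that] by (rule conjunct2)
  have sub2: "g ` J \<subseteq> fun_vs.span (f ` I)"
  proof
    fix a assume a: "a \<in> g ` J"
    show "a \<in> fun_vs.span (f ` I)"
    proof (rule ccontr)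
      assume na: "a \<notin> fun_vs.span (f ` I)"
      have "card (insert a (f ` I)) \<le> card (g ` J)"
        by (rule bound[OF fun_vs.independent_insertI[OF na f(2)]])
          (simp add: sub fun_vs.span_base[OF a])
      moreover have "a \<notin> f ` I" using na fun_vs.span_base[of a "f ` I"] by (rule contrapos_nn)
      ultimately show False using cg cf assms(1,3) by simp
    qed
  qed
  show eq: "fun_vs.span (g ` J) = fun_vs.span (f ` I)"
  proof
    show "fun_vs.span (g ` J) \<subseteq> fun_vs.span (f ` I)"
      by (intro fun_vs.span_minimal sub2 fun_vs.subspace_span)
    show "fun_vs.span (f ` I) \<subseteq> fun_vs.span (g ` J)"
      by (intro fun_vs.span_minimal sub fun_vs.subspace_span)
  qed
  have cgJ: "card (g ` J) = card J" using bound[OF f(2) sub] cf cg assms(3) by linarith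
  have "inj_on g J" by (rule eq_card_imp_inj_on[OF assms(2) cgJ])
  moreover have "fun_vs.independent (g ` J)"
  proof (rule notI)
    assume "fun_vs.dependent (g ` J)"
    then obtain a where a: "a \<in> g ` J" "a \<in> fun_vs.span (g ` J - {a})"
      unfolding fun_vs.dependent_def by (elim bexE)
    have "fun_vs.span (g ` J - {a}) = fun_vs.span (g ` J)"
      using fun_vs.span_redundant[OF a(2)] a(1) by (simp add: insert_absorb)
    then have "f ` I \<subseteq> fun_vs.span (g ` J - {a})" using sub by simp
    then have "card (f ` I) \<le> card (g ` J - {a})"
      using fun_vs.independent_span_bound[of "g ` J - {a}", OF _ f(2)] assms(2) by simp
    also have "\<dots> < card (g ` J)" using a assms(2) by (intro card_Diff1_less) auto
    finally show False using cf cgJ assms(3) by linarith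
  qed
  ultimately show "indep_fam J g" using assms(2) by (simp add: indep_fam_iff)
qed

lemma dim_span_indep_fam:
  assumes "finite I" "indep_fam I f"
  shows "fun_vs.dim (fun_vs.span (f ` I)) = card I"
  using assms(2) unfolding indep_fam_iff[OF assms(1)]
  by (metis fun_vs.dim_span_eq_card_independent card_image)

section \<open>Marsden's identity\<close>

lemma sorted_nth_eq:
  assumes "sorted t" "i \<le> l" "l \<le> j" "j < length t" "t ! i = t ! j"
  shows "t ! l = (t ! i :: real)"
  using sorted_nth_mono[OF assms(1), of i l] sorted_nth_mono[OF assms(1), of l j] assms by simp

lemma sorted_nth_le_last:
  assumes "sorted t" "i < length t"
  shows "t ! i \<le> (last t :: real)"
proof -
  have "t \<noteq> []" using assms(2) by auto
  then show ?thesis using sorted_nth_mono[OF assms(1), of i "length t - 1"] assms(2)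
    by (simp add: last_conv_nth)
qed

text \<open>The knots between the two outer ones coincide with them, so both denominators of the
  recursion are 0, and a quotient by 0 is 0.\<close>

lemma bspline_eq_knots:
  assumes "sorted t" "i + d + 1 < length t" "t ! i = t ! (i + d + 1)"
  shows "bspline t d i x = 0"
proof (cases d)
  case 0 then show ?thesis using assms by simp
next
  case (Suc e)
  have "t ! (i + e + 1) = t ! i" "t ! (i + 1) = t ! i" "t ! (i + e + 2) = t ! i"
    using sorted_nth_eq[OF assms(1), of i "i + e + 1" "i + d + 1"] sorted_nth_eq[OF assms(1), of i "i + 1" "i + d + 1"]
      sorted_nth_eq[OF assms(1), of i "i + e + 2" "i + d + 1"] assms(2,3) Suc by auto
  then show ?thesis using Suc by simp
qed

lemma bspline_support:
  assumes "sorted t" "i + d + 1 < length t" "bspline t d i x \<noteq> 0"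
  shows "t ! i \<le> x \<and> (x < t ! (i + d + 1) \<or> x = last t \<and> t ! (i + d + 1) = last t)"
  using assms(2,3)
proof (induction d arbitrary: i)
  case 0
  then show ?case by (auto split: if_splits)
next
  case (Suc d)
  from Suc.prems(2) have "bspline t d i x \<noteq> 0 \<or> bspline t d (i + 1) x \<noteq> 0"
    by (rule contrapos_np) simp
  then consider "bspline t d i x \<noteq> 0" | "bspline t d (i + 1) x \<noteq> 0" by blast
  then show ?case
  proof cases
    case 1
    with Suc.IH[of i] Suc.prems have *: "t ! i \<le> x \<and> (x < t ! (i + d + 1) \<or> x = last t \<and> t ! (i + d + 1) = last t)"
      by simp
    have "t ! (i + d + 1) \<le> t ! (i + Suc d + 1)" "t ! (i + Suc d + 1) \<le> last t"
      using Suc.prems assms(1) by (auto intro!: sorted_nth_mono sorted_nth_le_last)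
    with * show ?thesis by auto
  next
    case 2
    with Suc.IH[of "i + 1"] Suc.prems have *: "t ! (i + 1) \<le> x \<and> (x < t ! (i + 1 + d + 1) \<or> x = last t \<and> t ! (i + 1 + d + 1) = last t)"
      by simp
    have "t ! i \<le> t ! (i + 1)"
      using Suc.prems assms(1) by (auto intro!: sorted_nth_mono)
    with * show ?thesis by (auto simp: ac_simps)
  qed
qed

text \<open>The first summand of the recursion has the factor x - t ! i = 0. In the second, either
  the support begins later, or t ! (i + 1) = t ! i and the induction hypothesis applies to the
  shifted B-spline. The assumption excludes d + 1 equal knots on the left, where the value could be
  1.\<close>

lemma bspline_at_left_knot:
  assumes "sorted t" "i + d + 1 < length t" "t ! i < t ! (i + d)"
  shows "bspline t d i (t ! i) = 0"
  using assms(2,3)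
proof (induction d arbitrary: i)
  case 0 then show ?case by simp
next
  case (Suc d)
  have "bspline t d (i + 1) (t ! i) = 0"
  proof (cases "t ! i < t ! (i + 1)")
    case True
    then show ?thesis using bspline_support[OF assms(1), of "i + 1" d "t ! i"] Suc.prems by fastforce
  next
    case False
    then have eq: "t ! (i + 1) = t ! i"
      using sorted_nth_mono[OF assms(1), of i "i + 1"] Suc.prems by simp
    then show ?thesis using Suc.IH[of "i + 1"] Suc.prems by (simp add: ac_simps)
  qed
  then show ?case by simp
qed

text \<open>The dual polynomials of Marsden's identity: the value at y is the B-spline coefficient
  number j of x -> (y - x)^d. Being polynomials in y, they allow Taylor coefficients in y to be
  compared.\<close>

definition dual_poly :: "real list \<Rightarrow> nat \<Rightarrow> nat \<Rightarrow> real poly" where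
  "dual_poly t d j = (\<Prod>l\<in>{1..d}. [:- (t ! (j + l)), 1:])"

lemma pcompose_power: "pcompose (P ^ m) R = pcompose P R ^ m" for P R :: "real poly"
  by (induction m) (simp_all add: pcompose_1 pcompose_mult)

text \<open>Encoded by the shift X + a instead of by derivatives: no factorials occur, and
  divisibility by powers of X - a becomes vanishing of low coefficients.\<close>

definition taylor_coeff :: "real \<Rightarrow> real poly \<Rightarrow> nat \<Rightarrow> real" where
  "taylor_coeff a P \<nu> = coeff (pcompose P [:a, 1:]) \<nu>"

lemma taylor_coeff_smult: "taylor_coeff a (smult c P) \<nu> = c * taylor_coeff a P \<nu>"
  by (simp add: taylor_coeff_def pcompose_smult)

lemma taylor_coeff_sum: "taylor_coeff a (\<Sum>i\<in>A. P i) \<nu> = (\<Sum>i\<in>A. taylor_coeff a (P i) \<nu>)"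
  by (simp add: taylor_coeff_def pcompose_sum coeff_sum)

lemma taylor_coeff_dvd_eq_0:
  assumes "[:- a, 1:] ^ m dvd P" "\<nu> < m"
  shows "taylor_coeff a P \<nu> = 0"
proof -
  obtain Q where "P = [:- a, 1:] ^ m * Q" using assms(1) by (auto elim: dvdE)
  then have "pcompose P [:a, 1:] = pcompose ([:- a, 1:] ^ m) [:a, 1:] * pcompose Q [:a, 1:]"
    by (simp add: pcompose_mult)
  also have "pcompose ([:- a, 1:] ^ m) [:a, 1:] = monom 1 m"
    by (simp add: pcompose_power pcompose_pCons monom_altdef)
  finally show ?thesis using assms(2) by (simp add: taylor_coeff_def coeff_monom_mult)
qed

lemma taylor_coeff_linear_power:
  fixes a x :: real
  shows
  "taylor_coeff a ([:- x, 1:] ^ q) \<nu> = real (q choose \<nu>) * (a - x) ^ (q - \<nu>)"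
proof -
  have "pcompose ([:- x, 1:] ^ q) [:a, 1:] = [:a - x, 1:] ^ q"
    by (simp add: pcompose_power pcompose_pCons)
  moreover have "coeff ([:a - x, 1:] ^ q) \<nu> = real (q choose \<nu>) * (a - x) ^ (q - \<nu>)"
    by (cases "\<nu> \<le> q") (simp_all add: coeff_linear_poly_power coeff_eq_0 degree_linear_power)
  ultimately show ?thesis by (simp add: taylor_coeff_def)
qed

text \<open>The m equal knots starting at index s lie in the range j + 1, ..., j + d of the product,
  so each of them contributes a factor X - a.\<close>

lemma linear_power_dvd_dual_poly:
  assumes "\<And>l. s \<le> l \<Longrightarrow> l < s + m \<Longrightarrow> t ! l = a" "j < s" "s + m \<le> j + d + 1"
  shows "[:- a, 1:] ^ m dvd dual_poly t d j"
proof -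
  have "dual_poly t d j = (\<Prod>l\<in>{s - j..<s - j + m}. [:- (t ! (j + l)), 1:])
      * (\<Prod>l\<in>{1..d} - {s - j..<s - j + m}. [:- (t ! (j + l)), 1:])"
    unfolding dual_poly_def using assms(2,3) by (subst mult.commute, intro prod.subset_diff) auto
  moreover have "(\<Prod>l\<in>{s - j..<s - j + m}. [:- (t ! (j + l)), 1:]) = (\<Prod>l\<in>{s - j..<s - j + m}. [:- a, 1:])"
    using assms by (intro prod.cong) auto
  ultimately show ?thesis by simp
qed

text \<open>\<open>n\<close> is the number of B-splines of degree \<open>q\<close>. The q + 1 equal
  knots at either end make the boundary terms vanish in Marsden's identity, which therefore holds on
  all of [0,1].\<close>

locale open_knots =
  fixes t :: "real list" and n q :: nat
  assumes sorted: "sorted t" and length: "length t = n + q + 1" and q_less: "q < n"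
    and left_knots: "\<And>i. i \<le> q \<Longrightarrow> t ! i = 0"
    and right_knots: "\<And>i. n \<le> i \<Longrightarrow> i \<le> n + q \<Longrightarrow> t ! i = 1"
begin

lemma last_knot: "last t = 1"
proof -
  have "t \<noteq> []" using length by auto
  then show ?thesis using right_knots[of "n + q"] length by (simp add: last_conv_nth)
qed

lemma nth_mono: "i \<le> j \<Longrightarrow> j \<le> n + q \<Longrightarrow> t ! i \<le> t ! j"
  using sorted length by (intro sorted_nth_mono) auto

lemma bspline_outside:
  assumes "x \<notin> {0..1}" "i + d < n + q"
  shows "bspline t d i x = 0"
proof (rule ccontr)
  assume *: "bspline t d i x \<noteq> 0"
  have "t ! 0 \<le> t ! i" "t ! (i + d + 1) \<le> t ! (n + q)" using assms by (auto intro!: nth_mono)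
  then have "0 \<le> t ! i" "t ! (i + d + 1) \<le> 1" using left_knots[of 0] right_knots[of "n + q"] by auto
  then show False using bspline_support[OF sorted _ *] assms length last_knot by auto
qed

text \<open>The indicator of a knot span is the difference of the indicators of two half lines, so
  the sum telescopes. The point 1 is separate: there the span that counts is the one ending at 1 and
  starting strictly before it, hence the strict inequalities.\<close>

lemma sum_bspline_degree_0:
  assumes x: "x \<in> {0..1}"
  shows "(\<Sum>j<n + q. bspline t 0 j x) = 1"
proof (cases "x = 1")
  case False
  have "bspline t 0 j x = (if t ! j \<le> x then 1 else 0) - (if t ! Suc j \<le> x then 1 else 0)"
    if "j < n + q" for j
    using nth_mono[of j "Suc j"] that False last_knot by auto
  then have "(\<Sum>j<n + q. bspline t 0 j x)
     = (\<Sum>j<n + q. (if t ! j \<le> x then 1 else 0) - (if t ! Suc j \<le> x then 1 else 0))"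
    by (intro sum.cong) auto
  also have "\<dots> = (if t ! 0 \<le> x then 1 else 0) - (if t ! (n + q) \<le> x then 1 else 0)"
    by (rule sum_lessThan_telescope')
  finally show ?thesis using x False left_knots[of 0] right_knots[of "n + q"] by simp
next
  case True
  have "bspline t 0 j x = (if t ! j < 1 then 1 else 0) - (if t ! Suc j < 1 then 1 else 0)"
    if "j < n + q" for j
    using nth_mono[of j "Suc j"] nth_mono[of "Suc j" "n + q"] right_knots[of "n + q"] that True last_knot
    by auto
  then have "(\<Sum>j<n + q. bspline t 0 j x)
     = (\<Sum>j<n + q. (if t ! j < 1 then 1 else 0) - (if t ! Suc j < 1 then 1 else 0))"
    by (intro sum.cong) auto
  also have "\<dots> = (if t ! 0 < 1 then 1 else 0) - (if t ! (n + q) < 1 then 1 else 0)"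
    by (rule sum_lessThan_telescope')
  finally show ?thesis using left_knots[of 0] right_knots[of "n + q"] by simp
qed

text \<open>With y as the polynomial variable, y - x is the combination of y - t ! (j + d + 1) and y
  - t ! j whose weights are those of the Cox-de Boor recursion. Each of the two linear factors
  extends the dual polynomial by one knot, at its right or its left end.\<close>

lemma marsden_step:
  assumes "j + d < n + q"
  shows "smult (bspline t d j x) (dual_poly t d j) * [:- x, 1:]
    = smult ((x - t ! j) / (t ! (j + d + 1) - t ! j) * bspline t d j x) (dual_poly t (Suc d) j)
    + smult ((t ! (j + d + 1) - x) / (t ! (j + d + 1) - t ! j) * bspline t d j x)
        ([:- (t ! j), 1:] * dual_poly t d j)"
proof (cases "t ! j = t ! (j + d + 1)")
  case True
  then show ?thesis using bspline_eq_knots[OF sorted, of j d] length assms by simp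
next
  case False
  define D where "D = t ! (j + d + 1) - t ! j"
  have D: "D \<noteq> 0" using False by (simp add: D_def)
  have "(x - t ! j) / D * (- (t ! (j + d + 1))) + (t ! (j + d + 1) - x) / D * (- (t ! j)) = - x"
  proof -
    have "(x - t ! j) * (- (t ! (j + d + 1))) + (t ! (j + d + 1) - x) * (- (t ! j)) = (- x) * D"
      by (simp add: D_def algebra_simps)
    then show ?thesis
      by (metis (no_types) D add_divide_distrib nonzero_mult_div_cancel_right times_divide_eq_left)
  qed
  moreover have "(x - t ! j) / D + (t ! (j + d + 1) - x) / D = 1"
    using D by (simp add: add_divide_distrib[symmetric]) (simp add: D_def)
  ultimately have "smult ((x - t ! j) / D) [:- (t ! (j + d + 1)), 1:]
      + smult ((t ! (j + d + 1) - x) / D) [:- (t ! j), 1:] = [:- x, 1:]"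
    by simp
  then have "smult (bspline t d j x) (dual_poly t d j) * [:- x, 1:]
    = smult (bspline t d j x) (dual_poly t d j) * (smult ((x - t ! j) / D) [:- (t ! (j + d + 1)), 1:]
      + smult ((t ! (j + d + 1) - x) / D) [:- (t ! j), 1:])"
    by simp
  also have "\<dots> = smult ((x - t ! j) / D * bspline t d j x) (dual_poly t d j * [:- (t ! (j + d + 1)), 1:])
    + smult ((t ! (j + d + 1) - x) / D * bspline t d j x) ([:- (t ! j), 1:] * dual_poly t d j)"
    by (simp only: distrib_left mult_smult_left mult_smult_right smult_smult mult.commute)
  also have "dual_poly t d j * [:- (t ! (j + d + 1)), 1:] = dual_poly t (Suc d) j"
    by (simp add: dual_poly_def)
  finally show ?thesis unfolding D_def .
qed

lemma dual_poly_shift: "[:- (t ! Suc j), 1:] * dual_poly t d (Suc j) = dual_poly t (Suc d) j"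
proof -
  have "dual_poly t (Suc d) j = [:- (t ! (j + 1)), 1:] * (\<Prod>l\<in>{Suc 1..Suc d}. [:- (t ! (j + l)), 1:])"
    unfolding dual_poly_def by (rule prod.atLeast_Suc_atMost) simp
  also have "(\<Prod>l\<in>{Suc 1..Suc d}. [:- (t ! (j + l)), 1:]) = dual_poly t d (Suc j)"
    unfolding dual_poly_def prod.shift_bounds_cl_Suc_ivl by simp
  finally show ?thesis by simp
qed

lemma marsden_gen:
  assumes x: "x \<in> {0..1}" and "d \<le> q"
  shows "(\<Sum>j<n + q - d. smult (bspline t d j x) (dual_poly t d j)) = [:- x, 1:] ^ d"
  using assms(2)
proof (induction d)
  case 0
  have "(\<Sum>j<n + q. smult (bspline t 0 j x) 1) = smult (\<Sum>j<n + q. bspline t 0 j x) 1"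
    by (rule smult_sum[symmetric])
  then show ?case using sum_bspline_degree_0[OF x] by (simp add: dual_poly_def del: bspline.simps)
next
  case (Suc d)
  define M where "M = n + q - Suc d"
  have M: "n + q - d = Suc M" "M + d + 1 = n + q" "n \<le> M" using Suc.prems by (auto simp: M_def)
  define A where "A j = smult ((x - t ! j) / (t ! (j + d + 1) - t ! j) * bspline t d j x) (dual_poly t (Suc d) j)" for j
  define B where "B j = smult ((t ! (j + d + 1) - x) / (t ! (j + d + 1) - t ! j) * bspline t d j x)
        ([:- (t ! j), 1:] * dual_poly t d j)" for j
  \<comment> \<open>The boundary terms of the index shift vanish: the B-spline number
    \<open>M\<close> of degree \<open>d\<close> has only knots 1, and the one number 0 has only
    knots 0.\<close>
  have A: "A M = 0"
  proof -
    have "t ! M = t ! (M + d + 1)" using M right_knots by auto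
    then show ?thesis unfolding A_def using bspline_eq_knots[OF sorted, of M d] M length by simp
  qed
  have B: "B 0 = 0"
  proof -
    have "t ! 0 = t ! (0 + d + 1)" using left_knots Suc.prems by auto
    then show ?thesis unfolding B_def using bspline_eq_knots[OF sorted, of 0 d] M length by simp
  qed
  have step: "smult (bspline t (Suc d) j x) (dual_poly t (Suc d) j) = A j + B (Suc j)" for j
    unfolding A_def B_def dual_poly_shift
    by (simp add: smult_add_left[symmetric] ac_simps del: smult_smult)
  have "[:- x, 1:] ^ Suc d = (\<Sum>j<Suc M. smult (bspline t d j x) (dual_poly t d j)) * [:- x, 1:]"
    using Suc M by simp
  also have "\<dots> = (\<Sum>j<Suc M. A j + B j)"
    unfolding sum_distrib_right A_def B_def using M by (intro sum.cong refl marsden_step) auto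
  also have "\<dots> = (\<Sum>j<Suc M. A j) + (\<Sum>j<Suc M. B j)" by (rule sum.distrib)
  also have "(\<Sum>j<Suc M. A j) = (\<Sum>j<M. A j)" using A by simp
  also have "(\<Sum>j<Suc M. B j) = (\<Sum>j<M. B (Suc j))" using B by (subst sum.lessThan_Suc_shift) simp
  finally show ?case unfolding M_def[symmetric] by (simp only: step sum.distrib)
qed

lemma marsden:
  assumes "x \<in> {0..1}"
  shows "(\<Sum>j<n. smult (bspline t q j x) (dual_poly t q j)) = [:- x, 1:] ^ q"
  using marsden_gen[OF assms, of q] by simp

text \<open>Take the Taylor coefficient of order \<nu> at a knot a in Marsden's identity and drop
  the terms with j < s. To the left of a the terms with j >= s vanish by their support. To the right
  of a nothing is lost: a dropped B-spline either has its support to the left of a, or its dual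
  polynomial has an m-fold zero at a, so that the coefficient of order \<nu> < m is 0.\<close>

lemma truncated_marsden:
  fixes x a :: real
  assumes x: "x \<in> {0..1}" and s: "s + m \<le> n + q + 1" "\<And>l. s \<le> l \<Longrightarrow> l < s + m \<Longrightarrow> t ! l = a"
    and "a < 1" "\<nu> < m"
  shows "(\<Sum>j<n. (if s \<le> j then taylor_coeff a (dual_poly t q j) \<nu> else 0) * bspline t q j x)
    = (if a \<le> x then real (q choose \<nu>) * (a - x) ^ (q - \<nu>) else 0)"
proof (cases "a \<le> x")
  case False
  have "(if s \<le> j then taylor_coeff a (dual_poly t q j) \<nu> else 0) * bspline t q j x = 0" if "j < n" for j
  proof (cases "s \<le> j")
    case True
    have "a \<le> t ! j" using nth_mono[of s j] s(2)[of s] True assms(5) that by simp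
    then show ?thesis using bspline_support[OF sorted, of j q x] False that length by fastforce
  qed simp
  then show ?thesis using False by (subst sum.neutral) auto
next
  case True
  have "(if s \<le> j then taylor_coeff a (dual_poly t q j) \<nu> else 0) * bspline t q j x
      = taylor_coeff a (smult (bspline t q j x) (dual_poly t q j)) \<nu>" if "j < n" for j
  proof (cases "s \<le> j")
    case False
    show ?thesis
    proof (cases "s + m \<le> j + q + 1")
      case True
      have "[:- a, 1:] ^ m dvd dual_poly t q j"
        using linear_power_dvd_dual_poly[of s m t a j q] s(2) True False by simp
      then show ?thesis using assms(5) False by (simp add: taylor_coeff_smult taylor_coeff_dvd_eq_0)
    next
      case False
      have "t ! (j + q + 1) \<le> t ! (s + m - 1)" using False s(1) by (intro nth_mono) auto
      then have "t ! (j + q + 1) \<le> a" using s(2)[of "s + m - 1"] assms(5) by simp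
      \<comment> \<open>Here a < 1 excludes the closed right end of the last span.\<close>
      then have "bspline t q j x = 0"
        using bspline_support[OF sorted, of j q x] True that length assms(4) last_knot by fastforce
      then show ?thesis by (simp add: taylor_coeff_def)
    qed
  qed (simp add: taylor_coeff_smult mult.commute)
  then have "(\<Sum>j<n. (if s \<le> j then taylor_coeff a (dual_poly t q j) \<nu> else 0) * bspline t q j x)
    = taylor_coeff a (\<Sum>j<n. smult (bspline t q j x) (dual_poly t q j)) \<nu>"
    unfolding taylor_coeff_sum by (intro sum.cong) auto
  also have "\<dots> = real (q choose \<nu>) * (a - x) ^ (q - \<nu>)"
    unfolding marsden[OF x] by (rule taylor_coeff_linear_power)
  finally show ?thesis using True by simp
qed

end

section \<open>Splines as sums of truncated polynomials\<close>

lemma length_concat_replicate: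
  "length (concat (map (\<lambda>i. replicate (m i) (b i)) [0..<N])) = (\<Sum>i<N. m i)"
  by (induction N) simp_all

lemma sum_lessThan_add_le:
  fixes m :: "nat \<Rightarrow> nat" and i N :: nat
  shows "i < N \<Longrightarrow> (\<Sum>l<i. m l) + m i \<le> (\<Sum>l<N. m l)"
  by (induction N) (auto simp: less_Suc_eq)

lemma nth_concat_replicate:
  assumes "i < N" "a < m i"
  shows "concat (map (\<lambda>i. replicate (m i) (b i)) [0..<N]) ! ((\<Sum>l<i. m l) + a) = b i"
  using assms(1)
proof (induction N)
  case (Suc N)
  show ?case
  proof (cases "i = N")
    case True
    then show ?thesis using assms(2) by (simp add: nth_append length_concat_replicate)
  next
    case False
    then have "i < N" using Suc.prems by simp
    moreover from this have "(\<Sum>l<i. m l) + a < (\<Sum>l<N. m l)"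
      using sum_lessThan_add_le[of i N m] assms(2) by simp
    ultimately show ?thesis using Suc.IH by (simp add: nth_append length_concat_replicate)
  qed
qed simp

lemma index_concat_replicate:
  fixes m :: "nat \<Rightarrow> nat" and j N :: nat
  assumes "j < (\<Sum>l<N. m l)"
  shows "\<exists>i<N. \<exists>a<m i. j = (\<Sum>l<i. m l) + a"
  using assms
proof (induction N)
  case (Suc N)
  show ?case
  proof (cases "j < (\<Sum>l<N. m l)")
    case True
    then show ?thesis using Suc.IH less_Suc_eq by blast
  next
    case False
    then have "j = (\<Sum>l<N. m l) + (j - (\<Sum>l<N. m l))" "j - (\<Sum>l<N. m l) < m N" using Suc.prems by auto
    then show ?thesis by blast
  qed
qed simp

lemma sorted_concat_replicate:
  assumes "\<And>i j. i \<le> j \<Longrightarrow> j < N \<Longrightarrow> b i \<le> (b j :: real)"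
  shows "sorted (concat (map (\<lambda>i. replicate (m i) (b i)) [0..<N]))"
  using assms
proof (induction N)
  case (Suc N)
  then show ?case by (auto simp: sorted_append)
qed simp

lemma taylor_coeff_self_power: "taylor_coeff a ([:- a, 1:] ^ d) i = (if i = d then 1 else 0)"
proof -
  have "pcompose ([:- a, 1:] ^ d) [:a, 1:] = monom 1 d"
    by (simp add: pcompose_power pcompose_pCons monom_altdef)
  then show ?thesis by (simp add: taylor_coeff_def)
qed

lemma taylor_poly:
  assumes "degree P \<le> q"
  shows "P = (\<Sum>d\<le>q. smult (taylor_coeff a P d) ([:- a, 1:] ^ d))"
proof -
  define Q where "Q = pcompose P [:a, 1:]"
  have "degree Q \<le> q" unfolding Q_def using degree_pcompose_le[of P "[:a, 1:]"] assms by simp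
  then have "Q = (\<Sum>d\<le>q. monom (coeff Q d) d)" by (simp add: poly_as_sum_of_monoms')
  then have "pcompose Q [:- a, 1:] = pcompose (\<Sum>d\<le>q. monom (coeff Q d) d) [:- a, 1:]" by simp
  also have "\<dots> = (\<Sum>d\<le>q. smult (coeff Q d) ([:- a, 1:] ^ d))"
  proof -
    have "pcompose (monom c d) [:- a, 1:] = smult c ([:- a, 1:] ^ d)" for c d
      by (simp add: monom_altdef pcompose_smult pcompose_power pcompose_pCons)
    then show ?thesis by (simp add: pcompose_sum)
  qed
  also have "pcompose Q [:- a, 1:] = P"
    unfolding Q_def by (simp add: pcompose_assoc[symmetric] pcompose_pCons)
  finally show ?thesis by (simp add: Q_def taylor_coeff_def)
qed

section \<open>Piecewise polynomials and their jumps\<close>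

locale breakpoints =
  fixes k :: nat and \<tau> :: "nat \<Rightarrow> real"
  assumes strict_mono_breaks: "strict_mono_on {1..k} \<tau>"
    and breaks_in: "\<forall>i\<in>{1..k}. 0 < \<tau> i \<and> \<tau> i < 1"
begin

text \<open>Break points are numbered from 0 to k + 1 with the end points included, so that the
  first polynomial piece can be handled as a jump like all others.\<close>

definition break :: "nat \<Rightarrow> real" where
  "break i = (if i = 0 then 0 else if i \<le> k then \<tau> i else 1)"

lemma break_0 [simp]: "break 0 = 0"
  by (simp add: break_def)

lemma break_less: "i < j \<Longrightarrow> j \<le> k + 1 \<Longrightarrow> break i < break j"
  using breaks_in strict_mono_onD[OF strict_mono_breaks, of i j] by (auto simp: break_def)

lemma break_mono: "i \<le> j \<Longrightarrow> j \<le> k + 1 \<Longrightarrow> break i \<le> break j"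
  using break_less[of i j] by (cases "i = j") auto

lemma break_nonneg: "0 \<le> break i"
  using breaks_in by (auto simp: break_def less_imp_le)

lemma break_less_1: "i \<le> k \<Longrightarrow> break i < 1"
  using breaks_in by (auto simp: break_def)

lemma break_inject: "i \<le> k \<Longrightarrow> j \<le> k \<Longrightarrow> break i = break j \<longleftrightarrow> i = j"
  using break_less[of i j] break_less[of j i] by (cases i j rule: linorder_cases) auto

definition trunc_poly :: "(nat \<Rightarrow> real poly) \<Rightarrow> real \<Rightarrow> real" where
  "trunc_poly J x = (if x \<in> {0..1} then \<Sum>i\<le>k. if break i \<le> x then poly (J i) x else 0 else 0)"

text \<open>The function \<^term>\<open>trunc_poly J\<close> has the polynomial \<^term>\<open>J i\<close> as jump of its
  polynomial pieces at the \<open>i\<close>-th break point; the jump at \<open>0\<close> is the first piece.\<close>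

definition jump_space :: "nat \<Rightarrow> (nat \<Rightarrow> nat) \<Rightarrow> (nat \<Rightarrow> real poly) set" where
  "jump_space q e = {J. \<forall>i\<le>k. degree (J i) \<le> q \<and> [:- break i, 1:] ^ e i dvd J i}"

lemma trunc_poly_cong: "(\<And>i. i \<le> k \<Longrightarrow> J i = J' i) \<Longrightarrow> trunc_poly J = trunc_poly J'"
  by (auto simp: trunc_poly_def fun_eq_iff intro!: sum.cong)

lemma trunc_poly_on_piece:
  assumes "i \<le> k" "break i \<le> x" "x < break (Suc i)"
  shows "trunc_poly J x = poly (\<Sum>l\<le>i. J l) x"
proof -
  have "break (Suc i) \<le> 1" using break_mono[of "Suc i" "k + 1"] assms(1) by (simp add: break_def)
  then have "x \<in> {0..1}" using assms break_nonneg[of i] by auto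
  then have "trunc_poly J x = (\<Sum>l\<le>k. if break l \<le> x then poly (J l) x else 0)"
    by (simp add: trunc_poly_def)
  also have "\<dots> = (\<Sum>l\<le>i. if break l \<le> x then poly (J l) x else 0)"
  proof (rule sum.mono_neutral_right)
    show "\<forall>l\<in>{..k} - {..i}. (if break l \<le> x then poly (J l) x else 0) = 0"
    proof
      fix l assume "l \<in> {..k} - {..i}"
      then have "break (Suc i) \<le> break l" using break_mono[of "Suc i" l] by simp
      then show "(if break l \<le> x then poly (J l) x else 0) = 0" using assms(3) by simp
    qed
  qed (use assms in auto)
  also have "\<dots> = (\<Sum>l\<le>i. poly (J l) x)"
  proof (rule sum.cong)
    fix l assume "l \<in> {..i}"
    then have "break l \<le> x" using break_mono[of l i] assms by auto
    then show "(if break l \<le> x then poly (J l) x else 0) = poly (J l) x" by simp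
  qed simp
  finally show ?thesis by (simp add: poly_sum)
qed

text \<open>By induction over the pieces: once the earlier jumps are 0, the function equals the
  polynomial \<open>J i\<close> on the i-th span, which is infinite. This turns identities of
  functions into identities of polynomials, one for each break point.\<close>

lemma trunc_poly_eq_0_imp:
  assumes "\<And>x. x \<in> {0..1} \<Longrightarrow> trunc_poly J x = 0" "i \<le> k"
  shows "J i = 0"
  using assms(2)
proof (induction i rule: less_induct)
  case (less i)
  have "poly (J i) x = 0" if x: "x \<in> {break i..<break (Suc i)}" for x
  proof -
    have "break (Suc i) \<le> 1" using break_mono[of "Suc i" "k + 1"] less.prems by (simp add: break_def)
    then have "x \<in> {0..1}" using x break_nonneg[of i] by auto
    then have "poly (\<Sum>l\<le>i. J l) x = 0"
      using assms(1)[of x] trunc_poly_on_piece[of i x J] x less.prems by auto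
    moreover have "(\<Sum>l\<le>i. J l) = J i"
      using less by (cases i) auto
    ultimately show ?thesis by simp
  qed
  then have "{break i..<break (Suc i)} \<subseteq> {x. poly (J i) x = 0}" by blast
  moreover have "infinite {break i..<break (Suc i)}"
    using break_less[of i "Suc i"] less.prems by (simp add: infinite_Ico)
  ultimately show ?case using poly_roots_finite[of "J i"] finite_subset by blast
qed

lemma trunc_poly_sum:
  "(\<Sum>a\<in>A. c a * trunc_poly (J a) x) = trunc_poly (\<lambda>i. \<Sum>a\<in>A. smult (c a) (J a i)) x"
proof (cases "x \<in> {0..1}")
  case True
  then have "(\<Sum>a\<in>A. c a * trunc_poly (J a) x)
    = (\<Sum>a\<in>A. \<Sum>i\<le>k. if break i \<le> x then c a * poly (J a i) x else 0)"
    by (auto simp: trunc_poly_def sum_distrib_left intro!: sum.cong)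
  also have "\<dots> = (\<Sum>i\<le>k. \<Sum>a\<in>A. if break i \<le> x then c a * poly (J a i) x else 0)"
    by (rule sum.swap)
  also have "\<dots> = trunc_poly (\<lambda>i. \<Sum>a\<in>A. smult (c a) (J a i)) x"
    using True by (auto simp: trunc_poly_def poly_sum intro!: sum.cong)
  finally show ?thesis .
next
  case False
  then have "trunc_poly J' x = 0" for J' by (auto simp: trunc_poly_def)
  then show ?thesis by simp
qed

lemma trunc_poly_eq_imp:
  assumes "\<And>x. x \<in> {0..1} \<Longrightarrow> trunc_poly J x = trunc_poly J' x" "i \<le> k"
  shows "J i = J' i"
proof -
  have "trunc_poly (\<lambda>i. J i - J' i) x = 0" if "x \<in> {0..1}" for x
  proof -
    have "trunc_poly (\<lambda>i. J i - J' i) x = trunc_poly J x - trunc_poly J' x"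
      using that by (auto simp: trunc_poly_def sum_subtractf[symmetric] intro!: sum.cong)
    then show ?thesis using assms(1)[OF that] by simp
  qed
  from trunc_poly_eq_0_imp[OF this assms(2)] show ?thesis by simp
qed

section \<open>Multiplicities and positions of the knots\<close>

definition knot_mult :: "nat \<Rightarrow> nat \<Rightarrow> nat set \<Rightarrow> nat \<Rightarrow> nat" where
  "knot_mult q s E i = (if i = 0 \<or> i = k + 1 then q + 1 else if i \<in> E then q - s + 1 else q - s)"

definition knot_start :: "nat \<Rightarrow> nat \<Rightarrow> nat set \<Rightarrow> nat \<Rightarrow> nat" where
  "knot_start q s E i = (\<Sum>l<i. knot_mult q s E l)"

text \<open>The copies of 1 fill the last q + 1 places of the knot vector, so the index at which
  they start is the number of B-splines.\<close>

definition spline_count :: "nat \<Rightarrow> nat \<Rightarrow> nat set \<Rightarrow> nat" where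
  "spline_count q s E = knot_start q s E (k + 1)"

lemma knots_eq_concat:
  "knots k \<tau> q s E = concat (map (\<lambda>i. replicate (knot_mult q s E i) (break i)) [0..<k + 2])"
proof -
  have l: "[0..<k + 2] = 0 # [1..<k + 1] @ [k + 1]"
    by (simp add: upt_rec[of 0])
  have "map (\<lambda>i. replicate (if i \<in> E then q - s + 1 else q - s) (\<tau> i)) [1..<k + 1]
      = map (\<lambda>i. replicate (knot_mult q s E i) (break i)) [1..<k + 1]"
    by (auto simp: knot_mult_def break_def)
  moreover have "knot_mult q s E 0 = q + 1" "knot_mult q s E (k + 1) = q + 1" "break (k + 1) = 1"
    by (simp_all add: knot_mult_def break_def)
  ultimately show ?thesis unfolding l knots_def
    by (simp only: map_append concat_append list.map concat.simps append_Nil2 break_0)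
qed

lemma nth_knots:
  assumes "i \<le> k + 1" "knot_start q s E i \<le> l" "l < knot_start q s E i + knot_mult q s E i"
  shows "knots k \<tau> q s E ! l = break i"
  unfolding knots_eq_concat
  using nth_concat_replicate[of i "k + 2" "l - knot_start q s E i" "knot_mult q s E" break] assms
  by (simp add: knot_start_def)

lemma knot_start_Suc: "knot_start q s E (Suc i) = knot_start q s E i + knot_mult q s E i"
  by (simp add: knot_start_def)

lemma index_knots:
  assumes "l < knot_start q s E N"
  shows "\<exists>i<N. knot_start q s E i \<le> l \<and> l < knot_start q s E i + knot_mult q s E i"
proof -
  obtain i a where "i < N" "a < knot_mult q s E i" "l = knot_start q s E i + a"
    using index_concat_replicate[where j = l and N = N and m = "knot_mult q s E"] assms
    unfolding knot_start_def by blast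
  then show ?thesis by (intro exI[of _ i]) simp
qed

lemma length_knots: "length (knots k \<tau> q s E) = spline_count q s E + q + 1"
  unfolding knots_eq_concat length_concat_replicate
  by (simp add: spline_count_def knot_start_def knot_mult_def[of _ _ _ "Suc k"])

lemma num_bsplines_knots: "num_bsplines q (knots k \<tau> q s E) = spline_count q s E"
  by (simp add: num_bsplines_def length_knots)

lemma spline_count_eq: "spline_count q s E = (\<Sum>i\<le>k. knot_mult q s E i)"
  by (simp add: spline_count_def knot_start_def lessThan_Suc_atMost)

lemma degree_less_spline_count: "q < spline_count q s E"
proof -
  have "knot_mult q s E 0 \<le> (\<Sum>i\<le>k. knot_mult q s E i)" by (rule member_le_sum) auto
  then show ?thesis by (simp add: spline_count_eq knot_mult_def[of _ _ _ 0])
qed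

sublocale knots: open_knots "knots k \<tau> q s E" "spline_count q s E" q for q s E
proof
  show "sorted (knots k \<tau> q s E)"
    unfolding knots_eq_concat by (intro sorted_concat_replicate break_mono) auto
  show "length (knots k \<tau> q s E) = spline_count q s E + q + 1" by (rule length_knots)
  show "q < spline_count q s E" by (rule degree_less_spline_count)
  show "knots k \<tau> q s E ! i = 0" if "i \<le> q" for i
    using nth_knots[of 0 q s E i] that by (simp add: knot_start_def knot_mult_def)
  show "knots k \<tau> q s E ! i = 1" if "spline_count q s E \<le> i" "i \<le> spline_count q s E + q" for i
    using nth_knots[of "k + 1" q s E i] that by (simp add: spline_count_def knot_mult_def break_def)
qed

text \<open>The order to which the jump must vanish, one more than the number of continuous
  derivatives: s + 1 at an ordinary inner knot, s at a knot with an additional copy, and 0 for the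
  first piece, which is arbitrary.\<close>

definition contact :: "nat \<Rightarrow> nat set \<Rightarrow> nat \<Rightarrow> nat" where
  "contact s E i = (if i = 0 then 0 else if i \<in> E then s else s + 1)"

lemma contact_eq: "s \<le> q \<Longrightarrow> i \<le> k \<Longrightarrow> contact s E i = q + 1 - knot_mult q s E i"
  by (auto simp: contact_def knot_mult_def)

lemma knot_mult_le: "1 \<le> s \<Longrightarrow> knot_mult q s E i \<le> q + 1"
  by (auto simp: knot_mult_def)

section \<open>Truncated powers and the Curry-Schoenberg theorem\<close>

definition tpower :: "nat \<Rightarrow> nat \<times> nat \<Rightarrow> real \<Rightarrow> real" where
  "tpower q = (\<lambda>(i, \<nu>). trunc_poly (\<lambda>l. if l = i then [:- break i, 1:] ^ (q - \<nu>) else 0))"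

text \<open>The number \<nu> counts down from the top degree: a break point of multiplicity m admits
  the exponents q, q - 1, ..., q - m + 1. There are thus as many truncated powers as knots that do
  not belong to the end point 1.\<close>

definition tpower_indices :: "(nat \<Rightarrow> nat) \<Rightarrow> (nat \<times> nat) set" where
  "tpower_indices m = Sigma {..k} (\<lambda>i. {..<m i})"

lemma finite_tpower_indices [simp]: "finite (tpower_indices m)"
  by (simp add: tpower_indices_def)

lemma tpower_sum:
  "(\<Sum>a\<in>tpower_indices m. c a * tpower q a x)
    = trunc_poly (\<lambda>i. \<Sum>\<nu><m i. smult (c (i, \<nu>)) ([:- break i, 1:] ^ (q - \<nu>))) x"
proof -
  have "(\<Sum>a\<in>tpower_indices m. c a * tpower q a x)
    = (\<Sum>a\<in>tpower_indices m. c a * trunc_poly (\<lambda>l. if l = fst a then [:- break (fst a), 1:] ^ (q - snd a) else 0) x)"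
    by (simp add: tpower_def case_prod_beta)
  also have "\<dots> = trunc_poly (\<lambda>i. \<Sum>a\<in>tpower_indices m.
      smult (c a) (if i = fst a then [:- break (fst a), 1:] ^ (q - snd a) else 0)) x"
    by (rule trunc_poly_sum)
  also have "\<dots> = trunc_poly (\<lambda>i. \<Sum>\<nu><m i. smult (c (i, \<nu>)) ([:- break i, 1:] ^ (q - \<nu>))) x"
  proof (rule fun_cong[OF trunc_poly_cong])
    fix i assume i: "i \<le> k"
    have "(\<Sum>a\<in>tpower_indices m. smult (c a) (if i = fst a then [:- break (fst a), 1:] ^ (q - snd a) else 0))
      = (\<Sum>l\<le>k. \<Sum>\<nu><m l. smult (c (l, \<nu>)) (if i = l then [:- break l, 1:] ^ (q - \<nu>) else 0))"
      unfolding tpower_indices_def by (subst sum.Sigma) (auto simp: case_prod_beta)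
    also have "\<dots> = (\<Sum>l\<le>k. if l = i then \<Sum>\<nu><m i. smult (c (i, \<nu>)) ([:- break i, 1:] ^ (q - \<nu>)) else 0)"
      by (intro sum.cong) auto
    finally show "(\<Sum>a\<in>tpower_indices m. smult (c a) (if i = fst a then [:- break (fst a), 1:] ^ (q - snd a) else 0))
      = (\<Sum>\<nu><m i. smult (c (i, \<nu>)) ([:- break i, 1:] ^ (q - \<nu>)))"
      using i by simp
  qed
  finally show ?thesis .
qed

text \<open>Uniqueness of the jumps separates the break points, and Taylor coefficients separate the
  exponents at one break point. The bound on \<open>m\<close> keeps the exponents q - \<nu> distinct
  under truncated subtraction.\<close>

lemma indep_tpower:
  assumes "\<And>i. i \<le> k \<Longrightarrow> m i \<le> q + 1"
  shows "indep_fam (tpower_indices m) (tpower q)"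
  unfolding indep_fam_def
proof (intro allI impI ballI)
  fix c a assume c: "\<forall>x. (\<Sum>a\<in>tpower_indices m. c a * tpower q a x) = 0" and a: "a \<in> tpower_indices m"
  obtain i \<nu> where a_eq: "a = (i, \<nu>)" and i: "i \<le> k" "\<nu> < m i"
    using a by (auto simp: tpower_indices_def)
  have "(\<Sum>\<nu><m i. smult (c (i, \<nu>)) ([:- break i, 1:] ^ (q - \<nu>))) = 0"
    using trunc_poly_eq_0_imp[of "\<lambda>i. \<Sum>\<nu><m i. smult (c (i, \<nu>)) ([:- break i, 1:] ^ (q - \<nu>))" i]
      c i unfolding tpower_sum by simp
  then have "0 = taylor_coeff (break i) (\<Sum>\<nu><m i. smult (c (i, \<nu>)) ([:- break i, 1:] ^ (q - \<nu>))) (q - \<nu>)"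
    by (simp add: taylor_coeff_def)
  also have "\<dots> = (\<Sum>\<mu><m i. if \<mu> = \<nu> then c (i, \<mu>) else 0)"
    unfolding taylor_coeff_sum taylor_coeff_smult taylor_coeff_self_power
    using assms[OF i(1)] i(2) by (intro sum.cong) auto
  also have "\<dots> = c a" using i a_eq by simp
  finally show "c a = 0" by simp
qed

text \<open>Taylor expansion of each jump at its own break point: vanishing to order q + 1 - m
  leaves exactly the exponents q + 1 - m, ..., q.\<close>

lemma span_tpower:
  assumes "\<And>i. i \<le> k \<Longrightarrow> m i \<le> q + 1"
  shows "fun_vs.span (tpower q ` tpower_indices m) = trunc_poly ` jump_space q (\<lambda>i. q + 1 - m i)"
proof (intro set_eqI iffI)
  fix h assume "h \<in> fun_vs.span (tpower q ` tpower_indices m)"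
  then obtain c where c: "\<forall>x. h x = (\<Sum>a\<in>tpower_indices m. c a * tpower q a x)"
    unfolding in_span_family_iff[OF finite_tpower_indices] by blast
  define J where "J i = (\<Sum>\<nu><m i. smult (c (i, \<nu>)) ([:- break i, 1:] ^ (q - \<nu>)))" for i
  have "h = trunc_poly J" using c unfolding tpower_sum J_def by (simp add: fun_eq_iff)
  moreover have "J \<in> jump_space q (\<lambda>i. q + 1 - m i)"
    unfolding jump_space_def J_def
    by (auto intro!: degree_sum_le dvd_sum dvd_smult le_imp_power_dvd order.trans[OF degree_smult_le]
        simp: degree_linear_power)
  ultimately show "h \<in> trunc_poly ` jump_space q (\<lambda>i. q + 1 - m i)" by blast
next
  fix h assume "h \<in> trunc_poly ` jump_space q (\<lambda>i. q + 1 - m i)"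
  then obtain J where J: "J \<in> jump_space q (\<lambda>i. q + 1 - m i)" "h = trunc_poly J" by blast
  define c where "c = (\<lambda>(i, \<nu>). taylor_coeff (break i) (J i) (q - \<nu>))"
  have "J i = (\<Sum>\<nu><m i. smult (c (i, \<nu>)) ([:- break i, 1:] ^ (q - \<nu>)))" if i: "i \<le> k" for i
  proof -
    have Ji: "degree (J i) \<le> q" "[:- break i, 1:] ^ (q + 1 - m i) dvd J i"
      using J(1) i by (auto simp: jump_space_def)
    let ?f = "\<lambda>d. smult (taylor_coeff (break i) (J i) d) ([:- break i, 1:] ^ d)"
    have "J i = sum ?f {..q}" by (rule taylor_poly[OF Ji(1)])
    also have "\<dots> = sum ?f {q + 1 - m i..q}"
      using taylor_coeff_dvd_eq_0[OF Ji(2)] by (intro sum.mono_neutral_right) auto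
    also have "\<dots> = sum (\<lambda>\<nu>. ?f (q - \<nu>)) {..<m i}"
      using assms[OF i] by (intro sum.reindex_bij_witness[of _ "\<lambda>\<nu>. q - \<nu>" "\<lambda>d. q - d"]) auto
    finally show ?thesis by (simp add: c_def)
  qed
  then have "trunc_poly J = trunc_poly (\<lambda>i. \<Sum>\<nu><m i. smult (c (i, \<nu>)) ([:- break i, 1:] ^ (q - \<nu>)))"
    by (rule trunc_poly_cong)
  then have "\<forall>x. h x = (\<Sum>a\<in>tpower_indices m. c a * tpower q a x)"
    unfolding tpower_sum J(2) by simp
  then show "h \<in> fun_vs.span (tpower q ` tpower_indices m)"
    unfolding in_span_family_iff[OF finite_tpower_indices] by blast
qed

text \<open>These are the coefficients of \<open>truncated_marsden\<close>; the divisor removes the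
  binomial coefficient and the sign that turns (a - x)^(q - \<nu>) into (x - a)^(q - \<nu>).\<close>

definition tpower_coeff :: "nat \<Rightarrow> nat \<Rightarrow> nat set \<Rightarrow> nat \<times> nat \<Rightarrow> nat \<Rightarrow> real" where
  "tpower_coeff q s E = (\<lambda>(i, \<nu>) j. if knot_start q s E i \<le> j
     then taylor_coeff (break i) (dual_poly (knots k \<tau> q s E) q j) \<nu> / (real (q choose \<nu>) * (-1) ^ (q - \<nu>)) else 0)"

lemma tpower_eq_bspline_sum:
  assumes "1 \<le> s" "a \<in> tpower_indices (knot_mult q s E)"
  shows "tpower q a x = (\<Sum>j<spline_count q s E. tpower_coeff q s E a j * bspline (knots k \<tau> q s E) q j x)"
proof (cases "x \<in> {0..1}")
  case False
  have "bspline (knots k \<tau> q s E) q j x = 0" if "j < spline_count q s E" for j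
    using knots.bspline_outside[OF False, of j q] that by simp
  then show ?thesis using False by (cases a) (auto simp: tpower_def trunc_poly_def)
next
  case True
  obtain i \<nu> where a: "a = (i, \<nu>)" and i: "i \<le> k" "\<nu> < knot_mult q s E i"
    using assms(2) by (auto simp: tpower_indices_def)
  have \<nu>: "\<nu> \<le> q" using i(2) knot_mult_le[OF assms(1), of q E i] by simp
  have le: "knot_start q s E i + knot_mult q s E i \<le> spline_count q s E + q + 1"
    using sum_lessThan_add_le[of i "k + 1" "knot_mult q s E"] i by (simp add: knot_start_def spline_count_def)
  define C where "C = real (q choose \<nu>) * (-1) ^ (q - \<nu>)"
  have C: "C \<noteq> 0" using \<nu> by (simp add: C_def)
  have "(\<Sum>j<spline_count q s E. tpower_coeff q s E a j * bspline (knots k \<tau> q s E) q j x)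
    = (\<Sum>j<spline_count q s E. (if knot_start q s E i \<le> j
        then taylor_coeff (break i) (dual_poly (knots k \<tau> q s E) q j) \<nu> else 0)
        * bspline (knots k \<tau> q s E) q j x) / C"
    unfolding sum_divide_distrib by (intro sum.cong) (auto simp: tpower_coeff_def a C_def)
  also have "\<dots> = (if break i \<le> x then real (q choose \<nu>) * (break i - x) ^ (q - \<nu>) else 0) / C"
    using knots.truncated_marsden[OF True le nth_knots[of i] break_less_1[OF i(1)] i(2)] i(1) by simp
  also have "\<dots> = (if break i \<le> x then (x - break i) ^ (q - \<nu>) else 0)"
  proof -
    have "(break i - x) ^ (q - \<nu>) = (-1) ^ (q - \<nu>) * (x - break i) ^ (q - \<nu>)"
      by (simp add: power_mult_distrib[symmetric])
    then show ?thesis using C by (simp add: C_def)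
  qed
  also have "\<dots> = (\<Sum>l\<le>k. if l = i then (if break i \<le> x then (x - break i) ^ (q - \<nu>) else 0) else 0)"
    using i by simp
  also have "\<dots> = (\<Sum>l\<le>k. if break l \<le> x then poly (if l = i then [:- break i, 1:] ^ (q - \<nu>) else 0) x else 0)"
    by (intro sum.cong) (auto simp: poly_power)
  also have "\<dots> = tpower q a x"
    using True by (simp only: a tpower_def trunc_poly_def prod.case if_True)
  finally show ?thesis by simp
qed

text \<open>The independent truncated powers lie in the span of equally many B-splines, so
  \<open>steinitz_family\<close> gives both claims together.\<close>

theorem curry_schoenberg:
  assumes "1 \<le> s" "s \<le> q"
  shows indep_bspline: "indep_fam {..<spline_count q s E} (bspline (knots k \<tau> q s E) q)"
    and spline_space_eq: "spline_space q (knots k \<tau> q s E) = trunc_poly ` jump_space q (contact s E)"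
proof -
  let ?m = "knot_mult q s E"
  have m: "?m i \<le> q + 1" for i by (rule knot_mult_le[OF assms(1)])
  have card: "card {..<spline_count q s E} \<le> card (tpower_indices ?m)"
    unfolding tpower_indices_def by (subst card_SigmaI) (auto simp: spline_count_eq)
  have sp: "tpower q a \<in> fun_vs.span (bspline (knots k \<tau> q s E) q ` {..<spline_count q s E})"
    if "a \<in> tpower_indices ?m" for a
    unfolding in_span_family_iff[OF finite_lessThan] using tpower_eq_bspline_sum[OF assms(1) that] by blast
  note * = steinitz_family[OF finite_tpower_indices finite_lessThan card indep_tpower[OF m] sp]
  show "indep_fam {..<spline_count q s E} (bspline (knots k \<tau> q s E) q)" by (rule *)
  have "jump_space q (contact s E) = jump_space q (\<lambda>i. q + 1 - ?m i)"
    by (auto simp: jump_space_def contact_eq[OF assms(2)])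
  then show "spline_space q (knots k \<tau> q s E) = trunc_poly ` jump_space q (contact s E)"
    unfolding spline_space_def num_bsplines_knots using *(2) span_tpower[of ?m q, OF m] by simp
qed

lemma bspline_in_spline_space:
  "j < spline_count q s E \<Longrightarrow> bspline (knots k \<tau> q s E) q j \<in> spline_space q (knots k \<tau> q s E)"
  unfolding spline_space_def num_bsplines_knots by (intro fun_vs.span_base) simp

lemma dim_spline_space:
  assumes "1 \<le> s" "s \<le> q"
  shows "fun_vs.dim (spline_space q (knots k \<tau> q s E)) = spline_count q s E"
  unfolding spline_space_def num_bsplines_knots
  using dim_span_indep_fam[OF _ indep_bspline[OF assms]] by simp

end

section \<open>The additional spline at a root of \<open>\<beta>\<close>\<close>

context open_knots
begin

text \<open>The functional \<open>K\<close> on B-spline coefficients is, up to a factor, the jump of order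
  \<open>q + 1 - m\<close> at the knot \<open>x0\<close> of multiplicity \<open>m\<close>. The polynomials \<open>K j * dual_poly t q j\<close>
  are differences of consecutive products, so that all sums over \<open>j \<ge> c\<close> telescope.\<close>

lemma jump_functional:
  assumes block: "\<And>l. l \<le> n + q \<Longrightarrow> t ! l = x0 \<longleftrightarrow> s0 \<le> l \<and> l < s0 + m"
    and m: "1 \<le> m" "m \<le> q" and s0: "q < s0" "s0 + m \<le> n"
  obtains K :: "nat \<Rightarrow> real" where
    "\<And>j. j < s0 \<Longrightarrow> s0 + m \<le> j + q + 1 \<Longrightarrow> K j \<noteq> 0"
    "\<And>c a m' \<nu>. \<lbrakk>c + m' \<le> n; m' \<le> q + 1; \<And>l. c \<le> l \<Longrightarrow> l < c + m' \<Longrightarrow> t ! l = a; \<nu> < m';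
        a = x0 \<Longrightarrow> \<nu> < m - 1\<rbrakk>
      \<Longrightarrow> (\<Sum>j<n. K j * (if c \<le> j then taylor_coeff a (dual_poly t q j) \<nu> else 0)) = 0"
proof -
  define L where "L = [:- x0, 1:]"
  \<comment> \<open>\<open>f i\<close> is the linear factor of the i-th knot, scaled to have the
    value 1 at \<open>x0\<close>; for the copies of \<open>x0\<close> themselves it is replaced by
    1. The constants \<open>w\<close> record the scaling.\<close>
  define f where "f i = (if t ! i = x0 then 1 else smult (1 / (x0 - t ! i)) [:- (t ! i), 1:])" for i
  define R where "R j = (\<Prod>i\<in>{j + 1..j + q}. f i)" for j
  define w where "w j = (\<Prod>i\<in>{j + 1..j + q}. if t ! i = x0 then 1 else 1 / (x0 - t ! i))" for j
  \<comment> \<open>A product over q + 1 consecutive knots, kept only if the indices j, ..., j + q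
    contain the whole block of copies of \<open>x0\<close>.\<close>
  define Q where "Q j = (if s0 + m \<le> j + q + 1 \<and> j \<le> s0 then \<Prod>i\<in>{j..j + q}. f i else 0)" for j
  have w: "w j \<noteq> 0" for j by (auto simp: w_def)
  have dual: "smult (w j) (dual_poly t q j) = L ^ card {i \<in> {j + 1..j + q}. t ! i = x0} * R j" for j
  proof -
    have "dual_poly t q j = (\<Prod>i\<in>{j + 1..j + q}. [:- (t ! i), 1:])"
      unfolding dual_poly_def by (rule prod.reindex_bij_witness[of _ "\<lambda>i. i - j" "\<lambda>l. j + l"]) auto
    then have "smult (w j) (dual_poly t q j) = (\<Prod>i\<in>{j + 1..j + q}.
        smult (if t ! i = x0 then 1 else 1 / (x0 - t ! i)) [:- (t ! i), 1:])"
      by (simp only: w_def prod_smult)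
    also have "\<dots> = (\<Prod>i\<in>{j + 1..j + q}. (if t ! i = x0 then L else 1) * f i)"
      by (intro prod.cong) (auto simp: f_def L_def)
    also have "\<dots> = L ^ card {i \<in> {j + 1..j + q}. t ! i = x0} * R j"
      unfolding prod.distrib R_def by (simp add: prod.If_cases Int_def)
    finally show ?thesis .
  qed
  have Qr: "(\<Prod>i\<in>{j..j + q}. f i) = f j * R j" for j
    unfolding R_def by (subst prod.atLeast_Suc_atMost) auto
  have Ql: "(\<Prod>i\<in>{Suc j..Suc j + q}. f i) = R j * f (j + q + 1)" for j
    unfolding R_def by (simp add: prod.cl_ivl_Suc)
  have ex: "\<exists>K. smult K (dual_poly t q j) = L ^ (m - 1) * (Q j - Q (Suc j))
      \<and> (j < s0 \<and> s0 + m \<le> j + q + 1 \<longrightarrow> K \<noteq> 0)" if "j < n" for j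
  proof -
    have card: "card {i \<in> {j + 1..j + q}. t ! i = x0} = card ({j + 1..j + q} \<inter> {s0..<s0 + m})"
    proof -
      have "{i \<in> {j + 1..j + q}. t ! i = x0} = {j + 1..j + q} \<inter> {s0..<s0 + m}"
      proof (intro set_eqI iffI)
        fix i assume i: "i \<in> {i \<in> {j + 1..j + q}. t ! i = x0}"
        then show "i \<in> {j + 1..j + q} \<inter> {s0..<s0 + m}" using block[of i] that by simp
      next
        fix i assume i: "i \<in> {j + 1..j + q} \<inter> {s0..<s0 + m}"
        then show "i \<in> {i \<in> {j + 1..j + q}. t ! i = x0}" using block[of i] that by simp
      qed
      then show ?thesis by simp
    qed
    \<comment> \<open>Where both \<open>Q j\<close> and \<open>Q (Suc j)\<close> are kept, their
      difference has one more factor X - x0, which matches the full block in j + 1, ..., j + q. At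
      the two edges of the window one of them is 0 and that range has lost one copy of
      \<open>x0\<close>. Outside the window both are 0 and K = 0 will do.\<close>
    have "(j < s0 \<and> s0 + m \<le> j + q + 1) \<or> j = s0 \<or> j + q + 2 = s0 + m \<or> s0 < j \<or> j + q + 2 < s0 + m"
      by presburger
    then consider "j < s0" "s0 + m \<le> j + q + 1" | "j = s0" | "j + q + 2 = s0 + m" | "s0 < j" | "j + q + 2 < s0 + m"
      by blast
    then show ?thesis
    proof cases
      case 1
      then have "{j + 1..j + q} \<inter> {s0..<s0 + m} = {s0..<s0 + m}" by auto
      with dual[of j] card have d: "smult (w j) (dual_poly t q j) = L ^ m * R j" by simp
      have ne: "t ! j \<noteq> x0" "t ! (j + q + 1) \<noteq> x0" using block[of j] block[of "j + q + 1"] 1 that s0 by auto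
      have "t ! j \<le> t ! s0" "t ! s0 \<le> t ! (j + q + 1)" using 1 that s0 m by (auto intro!: nth_mono)
      moreover have "t ! s0 = x0" using block[of s0] s0 m by simp
      ultimately have lt: "t ! j < x0" "x0 < t ! (j + q + 1)" using ne by auto
      \<comment> \<open>\<open>f j\<close> and \<open>f (j + q + 1)\<close> are linear with value 1
        at \<open>x0\<close>, so their difference is a multiple of X - x0. The factor is nonzero
        because the outer knots lie strictly on either side of \<open>x0\<close>.\<close>
      define \<kappa> where "\<kappa> = - (t ! (j + q + 1) - t ! j) / ((x0 - t ! j) * (x0 - t ! (j + q + 1)))"
      have \<kappa>: "\<kappa> \<noteq> 0" using lt by (simp add: \<kappa>_def)
      have "f j - f (j + q + 1) = smult \<kappa> L"
      proof -
        have nz: "x0 - t ! j \<noteq> 0" "x0 - t ! (j + q + 1) \<noteq> 0" using lt by auto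
        have a1: "1 / (x0 - t ! j) - 1 / (x0 - t ! (j + q + 1)) = \<kappa>"
          unfolding \<kappa>_def using nz by (simp add: diff_frac_eq)
        have "t ! j / (x0 - t ! j) = x0 / (x0 - t ! j) - 1"
          "t ! (j + q + 1) / (x0 - t ! (j + q + 1)) = x0 / (x0 - t ! (j + q + 1)) - 1"
          using nz by (simp_all add: field_simps)
        then have "t ! (j + q + 1) / (x0 - t ! (j + q + 1)) - t ! j / (x0 - t ! j)
          = - x0 * (1 / (x0 - t ! j) - 1 / (x0 - t ! (j + q + 1)))"
          by (simp add: algebra_simps)
        then show ?thesis using a1 ne by (simp add: f_def L_def)
      qed
      moreover have "Q j - Q (Suc j) = R j * (f j - f (j + q + 1))"
      proof -
        have "Q j = f j * R j" using 1 m Qr[of j] by (simp add: Q_def)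
        moreover have "Q (Suc j) = R j * f (j + q + 1)" using 1 m Ql[of j] by (simp add: Q_def)
        ultimately show ?thesis by (simp add: algebra_simps)
      qed
      ultimately have "L ^ (m - 1) * (Q j - Q (Suc j)) = smult \<kappa> (L ^ Suc (m - 1) * R j)"
        by (simp add: ac_simps)
      also have "\<dots> = smult (\<kappa> * w j) (dual_poly t q j)"
        using d m by (simp flip: smult_smult)
      finally show ?thesis using \<kappa> w[of j] by (intro exI[of _ "\<kappa> * w j"]) auto
    next
      case 2
      then have "{j + 1..j + q} \<inter> {s0..<s0 + m} = {s0 + 1..<s0 + m}" using m by auto
      with dual[of j] card have d: "smult (w j) (dual_poly t q j) = L ^ (m - 1) * R j" by simp
      have "f j = 1" using block[of j] 2 m s0 by (simp add: f_def)
      then have "Q j = R j" "Q (Suc j) = 0" using 2 m Qr[of j] by (simp_all add: Q_def)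
      then show ?thesis using d 2 by (intro exI[of _ "w j"]) simp
    next
      case 3
      then have "{j + 1..j + q} \<inter> {s0..<s0 + m} = {s0..<s0 + m - 1}" using m by auto
      with dual[of j] card have d: "smult (w j) (dual_poly t q j) = L ^ (m - 1) * R j" by simp
      have "f (j + q + 1) = 1" using block[of "j + q + 1"] 3 m s0 by (simp add: f_def)
      then have "Q (Suc j) = R j" "Q j = 0" using 3 m Ql[of j] by (simp_all add: Q_def)
      then show ?thesis using d 3 by (intro exI[of _ "- w j"]) (simp add: smult_minus_left)
    next
      case 4
      then have "Q j = 0" "Q (Suc j) = 0" by (simp_all add: Q_def)
      then show ?thesis using 4 by (intro exI[of _ 0]) simp
    next
      case 5
      then have "Q j = 0" "Q (Suc j) = 0" by (simp_all add: Q_def)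
      then show ?thesis using 5 by (intro exI[of _ 0]) simp
    qed
  qed
  then obtain K where K: "\<And>j. j < n \<Longrightarrow> smult (K j) (dual_poly t q j) = L ^ (m - 1) * (Q j - Q (Suc j))"
    "\<And>j. j < n \<Longrightarrow> j < s0 \<Longrightarrow> s0 + m \<le> j + q + 1 \<Longrightarrow> K j \<noteq> 0"
    by metis
  show ?thesis
  proof (rule that[of K])
    show "K j \<noteq> 0" if "j < s0" "s0 + m \<le> j + q + 1" for j using K(2)[of j] that s0 by simp
    fix c a m' \<nu>
    assume c: "c + m' \<le> n" "m' \<le> q + 1" "\<And>l. c \<le> l \<Longrightarrow> l < c + m' \<Longrightarrow> t ! l = a"
      and \<nu>: "\<nu> < m'" "a = x0 \<Longrightarrow> \<nu> < m - 1"
    have "(\<Sum>j<n. K j * (if c \<le> j then taylor_coeff a (dual_poly t q j) \<nu> else 0))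
      = (\<Sum>j\<in>{c..<n}. K j * (if c \<le> j then taylor_coeff a (dual_poly t q j) \<nu> else 0))"
      by (intro sum.mono_neutral_right) auto
    also have "\<dots> = taylor_coeff a (\<Sum>j\<in>{c..<n}. smult (K j) (dual_poly t q j)) \<nu>"
      by (simp add: taylor_coeff_sum taylor_coeff_smult)
    also have "(\<Sum>j\<in>{c..<n}. smult (K j) (dual_poly t q j)) = (\<Sum>j\<in>{c..<n}. L ^ (m - 1) * (Q j - Q (Suc j)))"
      using K(1) by (intro sum.cong) auto
    \<comment> \<open>The sum telescopes, and the upper term vanishes since the window has left the
      block.\<close>
    also have "\<dots> = L ^ (m - 1) * (Q c - Q n)"
      using sum_Suc_diff'[of c n "\<lambda>j. - Q j"] c(1) by (simp flip: sum_distrib_left)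
    also have "Q n = 0" using s0 m by (simp add: Q_def)
    finally have eq: "(\<Sum>j<n. K j * (if c \<le> j then taylor_coeff a (dual_poly t q j) \<nu> else 0))
      = taylor_coeff a (L ^ (m - 1) * Q c) \<nu>" by simp
    \<comment> \<open>At \<open>x0\<close> the power of \<open>L\<close> suffices. At another knot
      a, the m' copies from index c on lie in c, ..., c + q, hence contribute (X - a)^m' to
      \<open>Q c\<close>.\<close>
    have "taylor_coeff a (L ^ (m - 1) * Q c) \<nu> = 0"
    proof (cases "a = x0")
      case True
      then show ?thesis using \<nu>(2) by (intro taylor_coeff_dvd_eq_0[of _ "m - 1"]) (simp_all add: L_def)
    next
      case False
      have "[:- a, 1:] ^ m' dvd (\<Prod>i\<in>{c..c + q}. f i)"
      proof -
        have "(\<Prod>i\<in>{c..<c + m'}. f i) = (\<Prod>i\<in>{c..<c + m'}. smult (1 / (x0 - a)) [:- a, 1:])"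
          using c(3) False by (intro prod.cong) (auto simp: f_def)
        also have "\<dots> = smult ((1 / (x0 - a)) ^ m') ([:- a, 1:] ^ m')"
          by (simp only: prod_constant smult_power card_atLeastLessThan) simp
        finally have "[:- a, 1:] ^ m' dvd (\<Prod>i\<in>{c..<c + m'}. f i)"
          by (simp add: dvd_smult)
        also have "\<dots> dvd (\<Prod>i\<in>{c..c + q}. f i)"
          using c(2) by (intro prod_dvd_prod_subset) auto
        finally show ?thesis .
      qed
      then have "[:- a, 1:] ^ m' dvd L ^ (m - 1) * Q c" by (simp add: Q_def)
      then show ?thesis using \<nu>(1) by (rule taylor_coeff_dvd_eq_0)
    qed
    with eq show "(\<Sum>j<n. K j * (if c \<le> j then taylor_coeff a (dual_poly t q j) \<nu> else 0)) = 0" by simp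
  qed
qed

end

context breakpoints
begin

lemma knots_eq_break_iff:
  assumes "i \<le> k" "l \<le> spline_count q s E + q"
  shows "knots k \<tau> q s E ! l = break i \<longleftrightarrow> knot_start q s E i \<le> l \<and> l < knot_start q s E i + knot_mult q s E i"
proof
  assume *: "knots k \<tau> q s E ! l = break i"
  have "l < knot_start q s E (Suc (k + 1))"
    using assms(2) unfolding knot_start_Suc by (simp add: spline_count_def knot_mult_def)
  then obtain i' where i': "i' < Suc (k + 1)" "knot_start q s E i' \<le> l" "l < knot_start q s E i' + knot_mult q s E i'"
    using index_knots by blast
  then have "break i' = break i" using nth_knots[of i' q s E l] * by simp
  then have "i' = i" using break_less[of i i'] break_less[of i' i] i'(1) assms(1) by (cases i i' rule: linorder_cases) auto
  then show "knot_start q s E i \<le> l \<and> l < knot_start q s E i + knot_mult q s E i" using i' by simp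
qed (use nth_knots[of i q s E l] assms(1) in simp)

text \<open>If the jump at the knot vanished to order s + 1, the B-spline would be a combination of
  truncated powers that do not use the additional copy. The functional of
  \<open>jump_functional\<close> annihilates the B-spline coefficients of all of these. The
  coefficients of the B-spline itself form the unit vector at j, so K j = 0, although a B-spline
  that is nonzero at the knot has K j nonzero.\<close>

lemma bspline_not_smoother:
  assumes l: "l \<in> {1..k}" and s: "1 \<le> s" "s < q"
    and j: "j < spline_count q s {l}" and nz: "bspline (knots k \<tau> q s {l}) q j (break l) \<noteq> 0"
    and J: "J \<in> jump_space q (contact s {l})" "bspline (knots k \<tau> q s {l}) q j = trunc_poly J"
  shows "\<not> [:- break l, 1:] ^ (s + 1) dvd J l"
proof
  assume dvd: "[:- break l, 1:] ^ (s + 1) dvd J l"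
  define n where "n = spline_count q s {l}"
  define t where "t = knots k \<tau> q s {l}"
  define B where "B = bspline t q"
  define s0 where "s0 = knot_start q s {l} l"
  define m where "m = q - s + 1"
  \<comment> \<open>The multiplicities without the additional copy; at \<open>break l\<close> this
    is \<open>m - 1\<close>.\<close>
  define m' where "m' = knot_mult q s {}"
  interpret t: open_knots t n q unfolding t_def n_def by unfold_locales
  have ml: "knot_mult q s {l} l = m" using l by (simp add: knot_mult_def m_def)
  have block: "t ! i = break l \<longleftrightarrow> s0 \<le> i \<and> i < s0 + m" if "i \<le> n + q" for i
    using knots_eq_break_iff[of l i q s "{l}"] l that ml unfolding t_def s0_def n_def by simp
  have m1: "1 \<le> m" "m \<le> q" using s by (auto simp: m_def)
  have "knot_start q s {l} 1 \<le> s0"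
    using sum_mono2[of "{..<l}" "{..<1}" "knot_mult q s {l}"] l by (auto simp: s0_def knot_start_def)
  then have s01: "q < s0" by (simp add: knot_start_def knot_mult_def)
  have s02: "s0 + m \<le> n"
    using sum_lessThan_add_le[of l "k + 1" "knot_mult q s {l}"] l ml
    by (simp add: s0_def n_def spline_count_def knot_start_def)
  show False
  proof (rule t.jump_functional[OF block m1 s01 s02])
    fix K assume K: "\<And>j. j < s0 \<Longrightarrow> s0 + m \<le> j + q + 1 \<Longrightarrow> K j \<noteq> 0"
      "\<And>c a m' \<nu>. \<lbrakk>c + m' \<le> n; m' \<le> q + 1; \<And>l. c \<le> l \<Longrightarrow> l < c + m' \<Longrightarrow> t ! l = a; \<nu> < m';
          a = break l \<Longrightarrow> \<nu> < m - 1\<rbrakk>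
        \<Longrightarrow> (\<Sum>j<n. K j * (if c \<le> j then taylor_coeff a (dual_poly t q j) \<nu> else 0)) = 0"
    \<comment> \<open>The nonzero value forces the whole block of the knot into the range j + 1,
      ..., j + q of inner knots of the support. On the right this is the half-open support; on the
      left, a B-spline starting at the knot would vanish there, since the multiplicity is at most
      q.\<close>
    have Kj: "K j \<noteq> 0"
    proof (rule K(1))
      have supp: "t ! j \<le> break l" "break l < t ! (j + q + 1)"
        using bspline_support[OF t.sorted, of j q "break l"] nz j t.length t.last_knot break_less_1[of l] l
        unfolding t_def[symmetric] n_def by auto
      have x0: "t ! (s0 + m - 1) = break l" using block[of "s0 + m - 1"] s02 m1 by simp
      show "s0 + m \<le> j + q + 1"
      proof (rule ccontr)
        assume "\<not> s0 + m \<le> j + q + 1"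
        then have "t ! (j + q + 1) \<le> t ! (s0 + m - 1)" using s02 by (intro t.nth_mono) auto
        then show False using supp x0 by simp
      qed
      show "j < s0"
      proof (rule ccontr)
        assume n: "\<not> j < s0"
        have "t ! s0 \<le> t ! j" using n j by (intro t.nth_mono) (auto simp: n_def)
        moreover have "t ! s0 = break l" using block[of s0] s02 m1 by simp
        ultimately have tj: "t ! j = break l" using supp by simp
        have "t ! j \<le> t ! (j + q)" using j by (intro t.nth_mono) (auto simp: n_def)
        moreover have "t ! (j + q) \<noteq> break l" using block[of "j + q"] n m1 j by (simp add: n_def)
        ultimately have "t ! j < t ! (j + q)" using tj by simp
        from bspline_at_left_knot[OF t.sorted _ this] show False
          using nz tj j t.length unfolding t_def[symmetric] n_def by simp
      qed
    qed
    have m'_le: "m' i \<le> knot_mult q s {l} i" for i by (simp add: m'_def knot_mult_def)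
    have "J \<in> jump_space q (contact s {})"
      unfolding jump_space_def
    proof (intro CollectI allI impI conjI)
      fix i assume i: "i \<le> k"
      then show "degree (J i) \<le> q" using J(1) by (simp add: jump_space_def)
      show "[:- break i, 1:] ^ contact s {} i dvd J i"
      proof (cases "i = l")
        case True
        then have "contact s {} i = s + 1" using l by (simp add: contact_def)
        then show ?thesis using dvd True by (simp only:)
      next
        case False
        then have "contact s {} i = contact s {l} i" by (simp add: contact_def)
        then show ?thesis using J(1) i by (simp add: jump_space_def)
      qed
    qed
    also have "jump_space q (contact s {}) = jump_space q (\<lambda>i. q + 1 - m' i)"
      using contact_eq[of s q _ "{}"] s by (auto simp: jump_space_def m'_def)
    finally have "trunc_poly J \<in> fun_vs.span (tpower q ` tpower_indices m')"
      using span_tpower[of m' q] knot_mult_le[OF s(1)] unfolding m'_def by blast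
    then obtain c where c: "\<And>x. B j x = (\<Sum>a\<in>tpower_indices m'. c a * tpower q a x)"
      unfolding in_span_family_iff[OF finite_tpower_indices] B_def t_def J(2)[symmetric] by blast
    define T where "T = tpower_coeff q s {l}"
    have sub: "a \<in> tpower_indices (knot_mult q s {l})" if "a \<in> tpower_indices m'" for a
      using that m'_le by (fastforce simp: tpower_indices_def dest: less_le_trans)
    \<comment> \<open>Two expansions of the same function in B-splines: the unit vector at
      \<open>j\<close>, and the one obtained from the truncated powers.\<close>
    have "(\<Sum>i<n. ((if i = j then 1 else 0) - (\<Sum>a\<in>tpower_indices m'. c a * T a i)) * B i x) = 0" for x
    proof -
      have "B j x = (\<Sum>a\<in>tpower_indices m'. c a * (\<Sum>i<n. T a i * B i x))"
        unfolding c using tpower_eq_bspline_sum[OF s(1) sub] by (simp add: T_def B_def t_def n_def)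
      also have "\<dots> = (\<Sum>a\<in>tpower_indices m'. \<Sum>i<n. c a * T a i * B i x)"
        by (simp add: sum_distrib_left mult.assoc)
      also have "\<dots> = (\<Sum>i<n. \<Sum>a\<in>tpower_indices m'. c a * T a i * B i x)"
        by (rule sum.swap)
      also have "\<dots> = (\<Sum>i<n. (\<Sum>a\<in>tpower_indices m'. c a * T a i) * B i x)"
        by (simp add: sum_distrib_right)
      finally have "B j x = (\<Sum>i<n. (\<Sum>a\<in>tpower_indices m'. c a * T a i) * B i x)" .
      moreover have "B j x = (\<Sum>i<n. (if i = j then 1 else 0) * B i x)"
      proof -
        have "(\<Sum>i<n. (if i = j then 1 else 0) * B i x) = (\<Sum>i<n. if i = j then B j x else 0)"
          by (intro sum.cong) auto
        then show ?thesis using j by (simp add: n_def)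
      qed
      ultimately show ?thesis by (simp add: left_diff_distrib sum_subtractf)
    qed
    then have \<delta>: "(if i = j then 1 else 0) = (\<Sum>a\<in>tpower_indices m'. c a * T a i)" if "i < n" for i
      using indep_famD[OF indep_bspline[of s q "{l}"], of "\<lambda>i. (if i = j then 1 else 0) - (\<Sum>a\<in>tpower_indices m'. c a * T a i)" i]
        that s unfolding B_def t_def n_def by simp
    have "K j = (\<Sum>i<n. if i = j then K j else 0)" using j by (simp add: n_def)
    also have "\<dots> = (\<Sum>i<n. K i * (\<Sum>a\<in>tpower_indices m'. c a * T a i))"
      by (intro sum.cong) (auto simp flip: \<delta>)
    also have "\<dots> = (\<Sum>i<n. \<Sum>a\<in>tpower_indices m'. c a * (K i * T a i))"
      by (simp add: sum_distrib_left ac_simps)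
    also have "\<dots> = (\<Sum>a\<in>tpower_indices m'. \<Sum>i<n. c a * (K i * T a i))"
      by (rule sum.swap)
    also have "\<dots> = (\<Sum>a\<in>tpower_indices m'. c a * (\<Sum>i<n. K i * T a i))"
      by (simp add: sum_distrib_left)
    also have "\<dots> = (\<Sum>a\<in>tpower_indices m'. c a * 0)"
    proof (rule sum.cong)
      fix a assume a: "a \<in> tpower_indices m'"
      obtain i \<nu> where a_eq: "a = (i, \<nu>)" and i: "i \<le> k" "\<nu> < m' i" using a by (auto simp: tpower_indices_def)
      define C where "C = real (q choose \<nu>) * (-1) ^ (q - \<nu>)"
      have "(\<Sum>i'<n. K i' * T a i') = (\<Sum>i'<n. K i' * (if knot_start q s {l} i \<le> i'
          then taylor_coeff (break i) (dual_poly t q i') \<nu> else 0)) / C"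
        unfolding sum_divide_distrib by (intro sum.cong) (auto simp: T_def tpower_coeff_def a_eq C_def t_def)
      also have "(\<Sum>i'<n. K i' * (if knot_start q s {l} i \<le> i'
          then taylor_coeff (break i) (dual_poly t q i') \<nu> else 0)) = 0"
      proof (rule K(2))
        show "knot_start q s {l} i + knot_mult q s {l} i \<le> n"
          using sum_lessThan_add_le[of i "k + 1" "knot_mult q s {l}"] i
          by (simp add: n_def spline_count_def knot_start_def)
        show "knot_mult q s {l} i \<le> q + 1" by (rule knot_mult_le[OF s(1)])
        show "t ! i' = break i" if "knot_start q s {l} i \<le> i'" "i' < knot_start q s {l} i + knot_mult q s {l} i" for i'
          unfolding t_def using nth_knots[of i q s "{l}" i'] i that by simp
        show "\<nu> < knot_mult q s {l} i" using i m'_le[of i] by simp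
        \<comment> \<open>This is where the missing copy counts: at \<open>break l\<close> only
          exponents with \<nu> < q - s occur.\<close>
        show "\<nu> < m - 1" if "break i = break l"
        proof -
          have "i = l" using break_inject[of i l] that i l by simp
          then show ?thesis using i l by (simp add: m'_def knot_mult_def m_def)
        qed
      qed
      finally show "c a * (\<Sum>i<n. K i * T a i) = c a * 0" by simp
    qed simp
    finally show False using Kj by simp
  qed
qed

end

section \<open>Derivatives of splines\<close>

lemma linear_power_dvd_pderiv:
  assumes "[:- a, 1:] ^ Suc e dvd (P :: real poly)"
  shows "[:- a, 1:] ^ e dvd pderiv P"
proof -
  obtain Q where "P = [:- a, 1:] ^ Suc e * Q" using assms by (auto elim: dvdE)
  then have "pderiv P = [:- a, 1:] ^ e * ([:- a, 1:] * pderiv Q + smult (1 + of_nat e) Q)"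
    by (simp only: pderiv_mult pderiv_power_Suc) (simp add: algebra_simps pderiv_pCons)
  then show ?thesis by simp
qed

lemma deriv01_eqI:
  assumes "(f has_vector_derivative D) (at x within {0..1})" "x \<in> {0..1::real}"
  shows "deriv01 f x = D"
  unfolding deriv01_def using vector_derivative_within_cbox[of 0 1 x f D] assms
  by (simp add: cbox_interval)

text \<open>A double zero at a makes both branches agree there in value and derivative, so they can
  be glued.\<close>

lemma has_derivative_truncated:
  assumes "[:- a, 1:] ^ 2 dvd P"
  shows "((\<lambda>x. if a \<le> x then poly P x else 0) has_real_derivative
      (if a \<le> x then poly (pderiv P) x else 0)) (at x)"
proof -
  have "[:- a, 1:] dvd P"
    by (rule dvd_trans[OF dvd_power assms]) simp
  moreover have "[:- a, 1:] ^ 1 dvd pderiv P"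
    by (rule linear_power_dvd_pderiv) (use assms in \<open>simp only: Suc_1\<close>)
  ultimately have 0: "poly P a = 0" "poly (pderiv P) a = 0" by (simp_all add: poly_eq_0_iff_dvd)
  have "((\<lambda>x. if x \<in> {a..} then poly P x else 0) has_vector_derivative
      (if x \<in> {a..} then poly (pderiv P) x else 0)) (at x within UNIV)"
  proof (rule has_vector_derivative_If_within_closures[where T = "{..a}"])
    show "(poly P has_vector_derivative poly (pderiv P) x) (at x within {a..} \<union> closure {a..} \<inter> closure {..a})"
      unfolding has_real_derivative_iff_has_vector_derivative[symmetric]
      by (rule DERIV_subset[OF poly_DERIV]) simp
    show "((\<lambda>_. 0) has_vector_derivative 0) (at x within {..a} \<union> closure {a..} \<inter> closure {..a})"
      by (rule has_vector_derivative_const)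
  qed (use 0 in auto)
  then show ?thesis by (simp add: has_real_derivative_iff_has_vector_derivative)
qed

context breakpoints
begin

lemma trunc_poly_has_derivative:
  assumes "J \<in> jump_space q e" "\<And>i. i \<in> {1..k} \<Longrightarrow> 2 \<le> e i" "x \<in> {0..1}"
  shows "(trunc_poly J has_real_derivative trunc_poly (\<lambda>i. pderiv (J i)) x) (at x within {0..1})"
proof -
  have "((\<lambda>x. \<Sum>i\<le>k. if break i \<le> x then poly (J i) x else 0) has_real_derivative
      (\<Sum>i\<le>k. if break i \<le> x then poly (pderiv (J i)) x else 0)) (at x within {0..1})"
  proof (rule DERIV_sum)
    fix i assume "i \<in> {..k}"
    show "((\<lambda>x. if break i \<le> x then poly (J i) x else 0) has_real_derivative
      (if break i \<le> x then poly (pderiv (J i)) x else 0)) (at x within {0..1})"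
    \<comment> \<open>The piece at break point 0 need not vanish there, but on [0,1] its truncation
      is invisible.\<close>
    proof (cases "i = 0")
      case True
      have "(poly (J i) has_real_derivative poly (pderiv (J i)) x) (at x within {0..1})"
        by (rule DERIV_subset[OF poly_DERIV]) simp
      then have "((\<lambda>x. if break i \<le> x then poly (J i) x else 0) has_real_derivative poly (pderiv (J i)) x)
          (at x within {0..1})"
        by (rule has_field_derivative_transform_within[OF _ zero_less_one assms(3)]) (simp add: True)
      then show ?thesis using assms(3) True by simp
    next
      case False
      then have "[:- break i, 1:] ^ 2 dvd J i"
        using assms(1) assms(2)[of i] \<open>i \<in> {..k}\<close> dvd_trans[OF le_imp_power_dvd[of 2 "e i"]]
        by (auto simp: jump_space_def)
      then show ?thesis using DERIV_subset[OF has_derivative_truncated] by blast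
    qed
  qed
  then have "(trunc_poly J has_real_derivative
      (\<Sum>i\<le>k. if break i \<le> x then poly (pderiv (J i)) x else 0)) (at x within {0..1})"
    by (rule has_field_derivative_transform_within[OF _ zero_less_one assms(3)]) (simp add: trunc_poly_def)
  then show ?thesis using assms(3) by (simp add: trunc_poly_def)
qed

lemma pderiv_jump_space:
  assumes "J \<in> jump_space q e"
  shows "(\<lambda>i. pderiv (J i)) \<in> jump_space q (\<lambda>i. e i - 1)"
proof -
  have "degree (pderiv (J i)) \<le> q \<and> [:- break i, 1:] ^ (e i - 1) dvd pderiv (J i)" if "i \<le> k" for i
  proof
    have "degree (J i) \<le> q" using assms that by (simp add: jump_space_def)
    then show "degree (pderiv (J i)) \<le> q" by (simp add: degree_pderiv)
    show "[:- break i, 1:] ^ (e i - 1) dvd pderiv (J i)"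
      using assms that linear_power_dvd_pderiv[of "break i" "e i - 1" "J i"]
      by (cases "e i") (auto simp: jump_space_def)
  qed
  then show ?thesis by (simp add: jump_space_def)
qed

lemma continuous_on_trunc_poly:
  assumes "J \<in> jump_space q e" "\<And>i. i \<in> {1..k} \<Longrightarrow> 1 \<le> e i"
  shows "continuous_on {0..1} (trunc_poly J)"
proof -
  \<comment> \<open>A polynomial that vanishes at its break point is truncated by evaluating it at
    \<open>max (break i) x\<close>, which is visibly continuous.\<close>
  have "continuous_on {0..1} (\<lambda>x. \<Sum>i\<le>k. poly (J i) (max (break i) x))"
    by (intro continuous_intros)
  moreover have "trunc_poly J x = (\<Sum>i\<le>k. poly (J i) (max (break i) x))" if "x \<in> {0..1}" for x
  proof -
    have "(if break i \<le> x then poly (J i) x else 0) = poly (J i) (max (break i) x)" if i: "i \<le> k" for i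
    proof (cases "break i \<le> x")
      case False
      then have "i \<in> {1..k}" using i \<open>x \<in> {0..1}\<close> by (cases i) auto
      then have "[:- break i, 1:] dvd J i"
        using assms(1) assms(2)[of i] dvd_trans[OF le_imp_power_dvd[of 1 "e i"]] by (auto simp: jump_space_def)
      then show ?thesis using False by (simp add: max_def poly_eq_0_iff_dvd)
    qed (simp add: max_def)
    then show ?thesis using that by (simp add: trunc_poly_def)
  qed
  ultimately show ?thesis by (metis (no_types, lifting) continuous_on_cong)
qed

lemma deriv01_trunc_poly:
  assumes "J \<in> jump_space q e" "\<And>i. i \<in> {1..k} \<Longrightarrow> 2 \<le> e i" "x \<in> {0..1}"
  shows "deriv01 (trunc_poly J) x = trunc_poly (\<lambda>i. pderiv (J i)) x"
  using trunc_poly_has_derivative[OF assms] assms(3)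
  by (intro deriv01_eqI) (simp_all add: has_real_derivative_iff_has_vector_derivative)

lemma bspline_C1:
  assumes "1 \<le> r" "r < q" "j < spline_count q r {}"
  shows "\<And>x. x \<in> {0..1} \<Longrightarrow> (bspline (knots k \<tau> q r {}) q j has_real_derivative
      deriv01 (bspline (knots k \<tau> q r {}) q j) x) (at x within {0..1})"
    and "continuous_on {0..1} (deriv01 (bspline (knots k \<tau> q r {}) q j))"
proof -
  have "bspline (knots k \<tau> q r {}) q j \<in> trunc_poly ` jump_space q (contact r {})"
    using bspline_in_spline_space[OF assms(3)] spline_space_eq[of r q "{}"] assms by simp
  then obtain J where J: "J \<in> jump_space q (contact r {})" "bspline (knots k \<tau> q r {}) q j = trunc_poly J"
    by (elim imageE)
  have e: "2 \<le> contact r {} i" if "i \<in> {1..k}" for i using that assms by (simp add: contact_def)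
  show "(bspline (knots k \<tau> q r {}) q j has_real_derivative
      deriv01 (bspline (knots k \<tau> q r {}) q j) x) (at x within {0..1})" if "x \<in> {0..1}" for x
    using trunc_poly_has_derivative[OF J(1) e that] deriv01_trunc_poly[OF J(1) e that] unfolding J(2) by simp
  have "continuous_on {0..1} (trunc_poly (\<lambda>i. pderiv (J i)))"
    using e by (intro continuous_on_trunc_poly[OF pderiv_jump_space[OF J(1)]]) fastforce
  moreover have "continuous_on {0..1} (deriv01 (bspline (knots k \<tau> q r {}) q j))
      \<longleftrightarrow> continuous_on {0..1} (trunc_poly (\<lambda>i. pderiv (J i)))"
    unfolding J(2) by (rule continuous_on_cong[OF refl deriv01_trunc_poly[OF J(1) e]])
  ultimately show "continuous_on {0..1} (deriv01 (bspline (knots k \<tau> q r {}) q j))" by simp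
qed

end

section \<open>Values and derivatives at the interface\<close>

lemma abs_mult_le_power_step:
  fixes x y c C D :: real
  assumes "\<bar>y\<bar> \<le> C * x ^ a" "\<bar>c\<bar> \<le> D * x ^ b" "0 \<le> x" "x \<le> 1" "0 \<le> C" "0 \<le> D" "e \<le> a + b"
  shows "\<bar>c * y\<bar> \<le> D * C * x ^ e"
proof -
  have "\<bar>c * y\<bar> \<le> (D * x ^ b) * (C * x ^ a)"
    unfolding abs_mult using assms by (intro mult_mono) auto
  also have "\<dots> = D * C * x ^ (a + b)" by (simp add: power_add)
  also have "\<dots> \<le> D * C * x ^ e" using assms by (intro mult_left_mono power_decreasing) auto
  finally show ?thesis .
qed

text \<open>For indices i <= q the knot t ! i is 0, so the first weight of the recursion gains a
  factor x; the second weight is bounded and its B-spline has the next index. For i > q the support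
  starts at h or later. In degree q the exponent is i, so B-splines from number 1 on vanish at 0,
  and those from number 2 on have derivative 0 there.\<close>

lemma (in open_knots) bspline_order_at_0:
  assumes h: "\<And>i. q < i \<Longrightarrow> i \<le> n + q \<Longrightarrow> h \<le> t ! i" "h \<le> 1" and id: "i + d < n + q"
  shows "\<exists>C\<ge>0. \<forall>x\<in>{0..<h}. \<bar>bspline t d i x\<bar> \<le> C * x ^ (i + d - q)"
  using id
proof (induction d arbitrary: i)
  case 0
  show ?case
  proof (cases "i \<le> q")
    case True
    then show ?thesis by (intro exI[of _ 1]) auto
  next
    case False
    have "bspline t 0 i x = 0" if "x \<in> {0..<h}" for x
      using bspline_support[OF sorted, of i 0 x] h(1)[of i] False that 0 length by fastforce
    then show ?thesis by (intro exI[of _ 0]) (auto simp del: bspline.simps)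
  qed
next
  case (Suc d)
  show ?case
  proof (cases "i \<le> q")
    case False
    have "bspline t (Suc d) i x = 0" if "x \<in> {0..<h}" for x
      using bspline_support[OF sorted, of i "Suc d" x] h(1)[of i] False that Suc.prems length by fastforce
    then show ?thesis by (intro exI[of _ 0]) (auto simp del: bspline.simps)
  next
    case True
    obtain C1 where C1: "C1 \<ge> 0" "\<And>x. x \<in> {0..<h} \<Longrightarrow> \<bar>bspline t d i x\<bar> \<le> C1 * x ^ (i + d - q)"
      using Suc.IH[of i] Suc.prems by auto
    obtain C2 where C2: "C2 \<ge> 0" "\<And>x. x \<in> {0..<h} \<Longrightarrow> \<bar>bspline t d (i + 1) x\<bar> \<le> C2 * x ^ (i + 1 + d - q)"
      using Suc.IH[of "i + 1"] Suc.prems by auto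
    define D1 where "D1 = \<bar>1 / (t ! (i + d + 1) - t ! i)\<bar>"
    define D2 where "D2 = \<bar>1 / (t ! (i + d + 2) - t ! (i + 1))\<bar>"
    have "\<bar>bspline t (Suc d) i x\<bar> \<le> (D1 * C1 + D2 * C2) * x ^ (i + Suc d - q)" if x: "x \<in> {0..<h}" for x
    proof -
      have x01: "0 \<le> x" "x \<le> 1" using x h(2) by auto
      have "t ! 0 \<le> t ! (i + d + 2)" "t ! (i + d + 2) \<le> t ! (n + q)"
        using Suc.prems by (auto intro!: nth_mono)
      then have t01: "0 \<le> t ! (i + d + 2)" "t ! (i + d + 2) \<le> 1"
        using left_knots[of 0] right_knots[of "n + q"] by auto
      have "\<bar>(x - t ! i) / (t ! (i + d + 1) - t ! i)\<bar> \<le> D1 * x ^ 1"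
        using left_knots[OF True] x01 by (simp add: D1_def abs_mult)
      from abs_mult_le_power_step[OF C1(2)[OF x] this x01 C1(1), of "i + Suc d - q"]
      have 1: "\<bar>(x - t ! i) / (t ! (i + d + 1) - t ! i) * bspline t d i x\<bar> \<le> D1 * C1 * x ^ (i + Suc d - q)"
        by (simp add: D1_def)
      have "\<bar>t ! (i + d + 2) - x\<bar> \<le> 1" using t01 x01 by auto
      then have "\<bar>(t ! (i + d + 2) - x) / (t ! (i + d + 2) - t ! (i + 1))\<bar> \<le> D2 * x ^ 0"
        by (simp add: D2_def divide_right_mono)
      from abs_mult_le_power_step[OF C2(2)[OF x] this x01 C2(1), of "i + Suc d - q"]
      have 2: "\<bar>(t ! (i + d + 2) - x) / (t ! (i + d + 2) - t ! (i + 1)) * bspline t d (i + 1) x\<bar>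
          \<le> D2 * C2 * x ^ (i + Suc d - q)"
        by (simp add: D2_def)
      have "\<bar>bspline t (Suc d) i x\<bar>
        \<le> \<bar>(x - t ! i) / (t ! (i + d + 1) - t ! i) * bspline t d i x\<bar>
        + \<bar>(t ! (i + d + 2) - x) / (t ! (i + d + 2) - t ! (i + 1)) * bspline t d (i + 1) x\<bar>"
        unfolding bspline.simps by (rule abs_triangle_ineq)
      then show ?thesis using 1 2 by (simp add: distrib_right)
    qed
    then show ?thesis using C1(1) C2(1)
      by (intro exI[of _ "D1 * C1 + D2 * C2"]) (auto simp: D1_def D2_def simp del: bspline.simps)
  qed
qed

lemma has_derivative_0_of_quadratic:
  assumes "h > 0" "\<And>x. x \<in> {0..<h} \<Longrightarrow> \<bar>f x\<bar> \<le> C * x ^ 2"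
  shows "(f has_real_derivative 0) (at 0 within {0..1})"
proof -
  have f0: "f 0 = 0" using assms(2)[of 0] assms(1) by simp
  have "((\<lambda>y. (f y - f 0) / (y - 0)) \<longlongrightarrow> 0) (at 0 within {0..1})"
  proof (rule Lim_null_comparison)
    have "\<forall>\<^sub>F y in at 0 within {0..1}. y < h"
      using eventually_at_topological assms(1) by (intro order_tendstoD[OF tendsto_ident_at]) auto
    moreover have "\<forall>\<^sub>F y in at 0 within {0..1}. y \<in> {0..1} - {0}" by (simp add: eventually_at_filter)
    ultimately show "\<forall>\<^sub>F y in at 0 within {0..1}. norm ((f y - f 0) / (y - 0)) \<le> C * y"
    proof eventually_elim
      case (elim y)
      then have "\<bar>f y\<bar> \<le> C * y ^ 2" "0 < y" using assms(2)[of y] by auto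
      then show ?case using f0 by (simp add: divide_le_eq power2_eq_square mult.assoc)
    qed
    show "((\<lambda>y. C * y) \<longlongrightarrow> 0) (at 0 within {0..1})"
      by (rule tendsto_eq_intros | simp)+
  qed
  then show ?thesis by (simp add: has_field_derivative_iff)
qed

context breakpoints
begin

lemma first_span_eq: "first_span k \<tau> = break 1"
  by (simp add: first_span_def break_def)

lemma first_span_pos: "0 < first_span k \<tau>" "first_span k \<tau> \<le> 1"
  using break_less[of 0 1] break_mono[of 1 "k + 1"] by (simp_all add: first_span_eq break_def)

context
  fixes p r :: nat
  assumes r: "1 \<le> r" "r < p"
begin

lemma spline_count_gt_2: "2 < spline_count p r {}"
  using degree_less_spline_count[of p r "{}"] r by simp

lemma knots_second: "knots k \<tau> p r {} ! (p + 1) = first_span k \<tau>"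
  using nth_knots[of 1 p r "{}" "p + 1"] r by (simp add: knot_start_def knot_mult_def first_span_eq)

lemma knots_ge_first_span: "p < i \<Longrightarrow> i \<le> spline_count p r {} + p \<Longrightarrow> first_span k \<tau> \<le> knots k \<tau> p r {} ! i"
  using knots.nth_mono[of "p + 1" i p r "{}"] knots_second by simp

lemma bspline_at_0:
  assumes "1 \<le> i" "i < spline_count p r {}"
  shows "bspline (knots k \<tau> p r {}) p i 0 = 0"
proof -
  obtain C where "\<forall>x\<in>{0..<first_span k \<tau>}. \<bar>bspline (knots k \<tau> p r {}) p i x\<bar> \<le> C * x ^ (i + p - p)"
    using knots.bspline_order_at_0[OF knots_ge_first_span first_span_pos(2), of i p] assms by auto
  from bspec[OF this, of 0] show ?thesis using first_span_pos assms(1) by (simp add: power_0_left)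
qed

lemma deriv_bspline_at_0:
  assumes "2 \<le> i" "i < spline_count p r {}"
  shows "deriv01 (bspline (knots k \<tau> p r {}) p i) 0 = 0"
proof -
  obtain C where C: "C \<ge> 0" "\<forall>x\<in>{0..<first_span k \<tau>}. \<bar>bspline (knots k \<tau> p r {}) p i x\<bar> \<le> C * x ^ (i + p - p)"
    using knots.bspline_order_at_0[OF knots_ge_first_span first_span_pos(2), of i p] assms by auto
  have "\<bar>bspline (knots k \<tau> p r {}) p i x\<bar> \<le> C * x ^ 2" if x: "x \<in> {0..<first_span k \<tau>}" for x
  proof -
    have "\<bar>bspline (knots k \<tau> p r {}) p i x\<bar> \<le> C * x ^ i" using bspec[OF C(2) x] by simp
    also have "\<dots> \<le> C * x ^ 2"
      using x first_span_pos(2) C(1) assms(1) by (intro mult_left_mono power_decreasing) auto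
    finally show ?thesis .
  qed
  from has_derivative_0_of_quadratic[OF first_span_pos(1) this]
  show ?thesis by (intro deriv01_eqI) (simp_all add: has_real_derivative_iff_has_vector_derivative)
qed

text \<open>At break point 0 the truncation has no effect on [0,1], so the truncated powers there
  are the monomials.\<close>

lemma monomial_eq_bspline_sum:
  assumes "\<nu> \<le> p" "x \<in> {0..1}"
  shows "x ^ (p - \<nu>) = (\<Sum>j<spline_count p r {}. tpower_coeff p r {} (0, \<nu>) j * bspline (knots k \<tau> p r {}) p j x)"
proof -
  have "(0, \<nu>) \<in> tpower_indices (knot_mult p r {})"
    using assms by (simp add: tpower_indices_def knot_mult_def)
  from tpower_eq_bspline_sum[OF r(1) this, of x]
  have "tpower p (0, \<nu>) x = (\<Sum>j<spline_count p r {}. tpower_coeff p r {} (0, \<nu>) j * bspline (knots k \<tau> p r {}) p j x)" .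
  moreover have "tpower p (0, \<nu>) x
      = (\<Sum>i\<le>k. if break i \<le> x then poly (if i = 0 then [:- break 0, 1:] ^ (p - \<nu>) else 0) x else 0)"
    using assms(2) by (simp only: tpower_def prod.case trunc_poly_def if_True)
  moreover have "\<dots> = (\<Sum>i\<le>k. if i = 0 then x ^ (p - \<nu>) else 0)"
    using assms(2) by (intro sum.cong) (auto simp: poly_power)
  ultimately show ?thesis by simp
qed

text \<open>The first two B-spline coefficients of the functions 1 and x. The value
  \<open>first_span k \<tau> / p\<close> is a Greville abscissa: the mean of the p knots with
  indices 2, ..., p + 1, of which only the last is nonzero.\<close>

lemma tpower_coeff_0:
  "tpower_coeff p r {} (0, p) 0 = 1" "tpower_coeff p r {} (0, p) 1 = 1"
  "tpower_coeff p r {} (0, p - 1) 0 = 0" "tpower_coeff p r {} (0, p - 1) 1 = first_span k \<tau> / p"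
proof -
  define t where "t = knots k \<tau> p r {}"
  have t0: "t ! i = 0" if "i \<le> p" for i using knots.left_knots[of i p r "{}"] that by (simp add: t_def)
  obtain p' where p': "p = Suc p'" using r by (cases p) auto
  have "dual_poly t p 0 = (\<Prod>l\<in>{1..p}. [:0, 1:])" unfolding dual_poly_def using t0 by (intro prod.cong) auto
  then have d0: "dual_poly t p 0 = monom 1 p" by (simp add: monom_altdef)
  have "dual_poly t p 1 = (\<Prod>l\<in>{1..p'}. [:- (t ! (1 + l)), 1:]) * [:- (t ! (p + 1)), 1:]"
    unfolding dual_poly_def p' by simp
  also have "(\<Prod>l\<in>{1..p'}. [:- (t ! (1 + l)), 1:]) = (\<Prod>l\<in>{1..p'}. [:0, 1:])"
    using t0 p' by (intro prod.cong) auto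
  also have "\<dots> = monom 1 p'" by (simp add: monom_altdef)
  finally have d1: "dual_poly t p 1 = monom 1 p' * [:- first_span k \<tau>, 1:]"
    using knots_second by (simp add: t_def)
  have c1: "coeff (dual_poly t p 1) p = 1" "coeff (dual_poly t p 1) (p - 1) = - first_span k \<tau>"
    unfolding d1 coeff_monom_mult by (simp_all add: p')
  have ch: "p choose (p - 1) = p" by (simp add: p')
  have tc: "taylor_coeff 0 P \<nu> = coeff P \<nu>" for P \<nu> by (simp add: taylor_coeff_def)
  have st: "knot_start p r {} 0 = 0" by (simp add: knot_start_def)
  show "tpower_coeff p r {} (0, p) 0 = 1" "tpower_coeff p r {} (0, p) 1 = 1"
    "tpower_coeff p r {} (0, p - 1) 0 = 0" "tpower_coeff p r {} (0, p - 1) 1 = first_span k \<tau> / p"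
    unfolding tpower_coeff_def prod.case st t_def[symmetric] d0 c1 break_0 tc
    using r ch by (simp_all add: of_nat_diff field_simps)
qed

text \<open>Only the first two B-splines have a nonzero derivative at 0. Differentiating the
  expansions of x and of 1 at 0 therefore leaves two equations for two unknowns; the Greville
  abscissa in the former is the source of the factor \<open>first_span k \<tau> / p\<close> in
  \<open>phi_trace\<close>.\<close>

lemma first_bsplines_at_0:
  shows "bspline (knots k \<tau> p r {}) p 0 0 = 1"
    and "deriv01 (bspline (knots k \<tau> p r {}) p 0) 0 = - (p / first_span k \<tau>)"
    and "deriv01 (bspline (knots k \<tau> p r {}) p 1) 0 = p / first_span k \<tau>"
proof -
  define n where "n = spline_count p r {}"
  define B where "B = bspline (knots k \<tau> p r {}) p"
  define h where "h = first_span k \<tau>"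
  define c where "c \<nu> = tpower_coeff p r {} (0, \<nu>)" for \<nu>
  have n2: "2 < n" unfolding n_def by (rule spline_count_gt_2)
  have mon: "x ^ (p - \<nu>) = (\<Sum>j<n. c \<nu> j * B j x)" if "\<nu> \<le> p" "x \<in> {0..1}" for x \<nu>
    unfolding n_def c_def B_def by (rule monomial_eq_bspline_sum[OF that])
  have split: "(\<Sum>j<n. f j) = f 0 + f 1" if "\<And>j. 2 \<le> j \<Longrightarrow> j < n \<Longrightarrow> f j = 0" for f :: "nat \<Rightarrow> real"
  proof -
    have "(\<Sum>j<n. f j) = (\<Sum>j\<in>{0, 1}. f j)"
      using that n2 by (intro sum.mono_neutral_right) auto
    then show ?thesis by simp
  qed
  have "1 = (\<Sum>j<n. c p j * B j 0)" using mon[of p 0] by simp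
  also have "\<dots> = c p 0 * B 0 0 + c p 1 * B 1 0"
    using bspline_at_0 by (intro split) (simp add: B_def n_def)
  also have "\<dots> = B 0 0"
    using bspline_at_0[of 1] n2 by (simp add: c_def tpower_coeff_0[unfolded One_nat_def] B_def n_def)
  finally show "bspline (knots k \<tau> p r {}) p 0 0 = 1" by (simp add: B_def)
  have deriv: "c \<nu> 0 * deriv01 (B 0) 0 + c \<nu> 1 * deriv01 (B 1) 0 = D"
    if D: "((\<lambda>x. x ^ (p - \<nu>)) has_real_derivative D) (at 0 within {0..1})" and \<nu>: "\<nu> \<le> p" for D \<nu>
  proof -
    have "((\<lambda>x. \<Sum>j<n. c \<nu> j * B j x) has_real_derivative (\<Sum>j<n. c \<nu> j * deriv01 (B j) 0)) (at 0 within {0..1})"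
      unfolding B_def n_def by (intro DERIV_sum DERIV_cmult bspline_C1(1) r) auto
    then have "((\<lambda>x. x ^ (p - \<nu>)) has_real_derivative (\<Sum>j<n. c \<nu> j * deriv01 (B j) 0)) (at 0 within {0..1})"
      by (rule has_field_derivative_transform_within[OF _ zero_less_one]) (use mon[OF \<nu>] in auto)
    then have "(\<Sum>j<n. c \<nu> j * deriv01 (B j) 0) = D"
      using deriv01_eqI[of "\<lambda>x. x ^ (p - \<nu>)" _ 0] D
      by (metis (no_types, lifting) atLeastAtMost_iff has_real_derivative_iff_has_vector_derivative order_refl zero_le_one)
    moreover have "(\<Sum>j<n. c \<nu> j * deriv01 (B j) 0) = c \<nu> 0 * deriv01 (B 0) 0 + c \<nu> 1 * deriv01 (B 1) 0"
      using deriv_bspline_at_0 by (intro split) (simp add: B_def n_def)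
    ultimately show ?thesis by simp
  qed
  have "c (p - 1) 0 * deriv01 (B 0) 0 + c (p - 1) 1 * deriv01 (B 1) 0 = 1"
    using r by (intro deriv) simp_all
  then have hp: "h / p * deriv01 (B 1) 0 = 1"
    unfolding c_def tpower_coeff_0 h_def[symmetric] by (simp only: mult_zero_left add_0_left)
  have "deriv01 (B 1) 0 = (p / h) * (h / p * deriv01 (B 1) 0)"
    using first_span_pos r by (simp add: h_def)
  then have d1: "deriv01 (B 1) 0 = p / h" unfolding hp by simp
  have "c p 0 * deriv01 (B 0) 0 + c p 1 * deriv01 (B 1) 0 = 0"
    by (intro deriv) simp_all
  then have "deriv01 (B 0) 0 + deriv01 (B 1) 0 = 0" unfolding c_def tpower_coeff_0 by simp
  then show "deriv01 (bspline (knots k \<tau> p r {}) p 0) 0 = - (p / first_span k \<tau>)"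
    "deriv01 (bspline (knots k \<tau> p r {}) p 1) 0 = p / first_span k \<tau>"
    using d1 by (simp_all add: B_def h_def)
qed

end

end

section \<open>Smoothness across the interface\<close>

text \<open>The partial derivatives are arguments, so that sums and products can state theirs
  explicitly; the total derivative is required, as the chain rule needs it.\<close>

definition C1_square :: "(real \<times> real \<Rightarrow> real) \<Rightarrow> (real \<times> real \<Rightarrow> real) \<Rightarrow> (real \<times> real \<Rightarrow> real) \<Rightarrow> bool" where
  "C1_square f fu fv \<longleftrightarrow> continuous_on unit_square fu \<and> continuous_on unit_square fv \<and>
    (\<forall>x\<in>unit_square. (f has_derivative (\<lambda>h. fst h * fu x + snd h * fv x)) (at x within unit_square))"

lemma deriv01_cong:
  assumes "v = w" "\<And>s. s \<in> {0..1} \<Longrightarrow> f s = g s" "w \<in> {0..1}"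
  shows "deriv01 f v = deriv01 g w"
proof -
  have "(f has_vector_derivative D) (at w within {0..1}) \<longleftrightarrow> (g has_vector_derivative D) (at w within {0..1})" for D
    using has_vector_derivative_transform[OF assms(3), of f g D] has_vector_derivative_transform[OF assms(3), of g f D]
      assms(2) by auto
  then show ?thesis unfolding deriv01_def vector_derivative_def assms(1) by simp
qed

lemma compact_unit_square: "compact unit_square"
  unfolding unit_square_def by (intro compact_Times compact_Icc)

lemma has_derivative_squareD:
  fixes f :: "real \<times> real \<Rightarrow> 'b::real_normed_vector"
  assumes "(f has_derivative (\<lambda>h. fst h *\<^sub>R a + snd h *\<^sub>R b)) (at (u, v) within unit_square)"
    and "u \<in> {0..1}" "v \<in> {0..1}"
  shows "((\<lambda>s. f (s, v)) has_vector_derivative a) (at u within {0..1})"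
    and "((\<lambda>s. f (u, s)) has_vector_derivative b) (at v within {0..1})"
proof -
  have "((\<lambda>s. (s, v)) has_derivative (\<lambda>h. (h, 0))) (at u within {0..1})"
    by (auto intro!: derivative_eq_intros)
  moreover have "(f has_derivative (\<lambda>h. fst h *\<^sub>R a + snd h *\<^sub>R b)) (at (u, v) within (\<lambda>s. (s, v)) ` {0..1})"
    by (rule has_derivative_subset[OF assms(1)]) (use assms(3) in \<open>auto simp: unit_square_def\<close>)
  ultimately have "(f \<circ> (\<lambda>s. (s, v)) has_derivative (\<lambda>h. fst h *\<^sub>R a + snd h *\<^sub>R b) \<circ> (\<lambda>h. (h, 0))) (at u within {0..1})"
    by (rule diff_chain_within)
  then show "((\<lambda>s. f (s, v)) has_vector_derivative a) (at u within {0..1})"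
    by (simp add: has_vector_derivative_def o_def)
  have "((\<lambda>s. (u, s)) has_derivative (\<lambda>h. (0, h))) (at v within {0..1})"
    by (auto intro!: derivative_eq_intros)
  moreover have "(f has_derivative (\<lambda>h. fst h *\<^sub>R a + snd h *\<^sub>R b)) (at (u, v) within (\<lambda>s. (u, s)) ` {0..1})"
    by (rule has_derivative_subset[OF assms(1)]) (use assms(2) in \<open>auto simp: unit_square_def\<close>)
  ultimately have "(f \<circ> (\<lambda>s. (u, s)) has_derivative (\<lambda>h. fst h *\<^sub>R a + snd h *\<^sub>R b) \<circ> (\<lambda>h. (0, h))) (at v within {0..1})"
    by (rule diff_chain_within)
  then show "((\<lambda>s. f (u, s)) has_vector_derivative b) (at v within {0..1})"
    by (simp add: has_vector_derivative_def o_def)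
qed

lemma D_u_D_v_eqI:
  fixes f :: "real \<times> real \<Rightarrow> 'b::real_normed_vector"
  assumes "(f has_derivative (\<lambda>h. fst h *\<^sub>R a + snd h *\<^sub>R b)) (at x within unit_square)" "x \<in> unit_square"
  shows "D_u f x = a" "D_v f x = b"
  using has_derivative_squareD[of f a b "fst x" "snd x"] assms
  by (auto simp: D_u_def D_v_def unit_square_def intro!: deriv01_eqI split: prod.splits)

lemma C1_square_cong:
  assumes "C1_square f fu fv" "\<And>x. x \<in> unit_square \<Longrightarrow> g x = f x"
  shows "C1_square g fu fv"
  using assms unfolding C1_square_def by (metis (no_types, lifting) has_derivative_transform)

lemma C1_square_sum:
  assumes "\<And>i. i \<in> I \<Longrightarrow> C1_square (f i) (fu i) (fv i)"
  shows "C1_square (\<lambda>x. \<Sum>i\<in>I. c i * f i x) (\<lambda>x. \<Sum>i\<in>I. c i * fu i x) (\<lambda>x. \<Sum>i\<in>I. c i * fv i x)"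
  unfolding C1_square_def
proof (intro conjI ballI)
  show "continuous_on unit_square (\<lambda>x. \<Sum>i\<in>I. c i * fu i x)" "continuous_on unit_square (\<lambda>x. \<Sum>i\<in>I. c i * fv i x)"
    using assms by (auto intro!: continuous_intros simp: C1_square_def)
  fix x assume x: "x \<in> unit_square"
  have "((\<lambda>x. \<Sum>i\<in>I. c i * f i x) has_derivative (\<lambda>h. \<Sum>i\<in>I. c i * (fst h * fu i x + snd h * fv i x)))
    (at x within unit_square)"
    using assms x by (intro has_derivative_sum has_derivative_mult_right) (auto simp: C1_square_def)
  also have "(\<lambda>h. \<Sum>i\<in>I. c i * (fst h * fu i x + snd h * fv i x))
    = (\<lambda>h. fst h * (\<Sum>i\<in>I. c i * fu i x) + snd h * (\<Sum>i\<in>I. c i * fv i x))"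
    by (simp add: fun_eq_iff sum_distrib_left sum.distrib algebra_simps)
  finally show "((\<lambda>x. \<Sum>i\<in>I. c i * f i x) has_derivative
      (\<lambda>h. fst h * (\<Sum>i\<in>I. c i * fu i x) + snd h * (\<Sum>i\<in>I. c i * fv i x))) (at x within unit_square)" .
qed

lemma C1_square_product:
  assumes a: "\<And>x. x \<in> {0..1} \<Longrightarrow> (a has_real_derivative a' x) (at x within {0..1})" "continuous_on {0..1} a'"
    and b: "\<And>x. x \<in> {0..1} \<Longrightarrow> (b has_real_derivative b' x) (at x within {0..1})" "continuous_on {0..1} b'"
  shows "C1_square (\<lambda>x. a (fst x) * b (snd x)) (\<lambda>x. a' (fst x) * b (snd x)) (\<lambda>x. a (fst x) * b' (snd x))"
proof -
  have ca: "continuous_on {0..1} a" using a(1) by (intro DERIV_continuous_on)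
  have cb: "continuous_on {0..1} b" using b(1) by (intro DERIV_continuous_on)
  have c1: "continuous_on unit_square (\<lambda>x. f (fst x))" if "continuous_on {0..1} f" for f :: "real \<Rightarrow> real"
    by (rule continuous_on_compose2[OF that]) (auto simp: unit_square_def intro!: continuous_intros)
  have c2: "continuous_on unit_square (\<lambda>x. f (snd x))" if "continuous_on {0..1} f" for f :: "real \<Rightarrow> real"
    by (rule continuous_on_compose2[OF that]) (auto simp: unit_square_def intro!: continuous_intros)
  show ?thesis unfolding C1_square_def
  proof (intro conjI ballI)
    show "continuous_on unit_square (\<lambda>x. a' (fst x) * b (snd x))" by (intro continuous_on_mult c1 c2 a cb)
    show "continuous_on unit_square (\<lambda>x. a (fst x) * b' (snd x))" by (intro continuous_on_mult c1 c2 b ca)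
    fix x assume x: "x \<in> unit_square"
    have "(a \<circ> fst has_derivative (\<lambda>h. a' (fst x) * h) \<circ> fst) (at x within unit_square)"
    proof (rule diff_chain_within)
      show "(fst has_derivative fst) (at x within unit_square)" by (intro derivative_intros)
      show "(a has_derivative (\<lambda>h. a' (fst x) * h)) (at (fst x) within fst ` unit_square)"
        using a(1)[of "fst x"] x by (auto simp: has_field_derivative_def unit_square_def)
    qed
    moreover have "(b \<circ> snd has_derivative (\<lambda>h. b' (snd x) * h) \<circ> snd) (at x within unit_square)"
    proof (rule diff_chain_within)
      show "(snd has_derivative snd) (at x within unit_square)" by (intro derivative_intros)
      show "(b has_derivative (\<lambda>h. b' (snd x) * h)) (at (snd x) within snd ` unit_square)"
        using b(1)[of "snd x"] x by (auto simp: has_field_derivative_def unit_square_def)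
    qed
    ultimately have "((\<lambda>x. (a \<circ> fst) x * (b \<circ> snd) x) has_derivative
      (\<lambda>h. (a \<circ> fst) x * ((\<lambda>h. b' (snd x) * h) \<circ> snd) h + ((\<lambda>h. a' (fst x) * h) \<circ> fst) h * (b \<circ> snd) x))
      (at x within unit_square)"
      by (rule has_derivative_mult)
    then show "((\<lambda>x. a (fst x) * b (snd x)) has_derivative
      (\<lambda>h. fst h * (a' (fst x) * b (snd x)) + snd h * (a (fst x) * b' (snd x)))) (at x within unit_square)"
      by (simp add: o_def algebra_simps)
  qed
qed

text \<open>The gradient of \<phi> at F x is the solution of the 2 x 2 system for its products with
  \<open>Fu x\<close> and \<open>Fv x\<close>. It is a derivative within the patch, boundary points
  included, because the inverse of F is differentiable within the image of the square.\<close>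

lemma C1_patch:
  fixes F Fu Fv :: "real \<times> real \<Rightarrow> real \<times> real"
  assumes inj: "inj_on F unit_square"
    and dF: "\<And>x. x \<in> unit_square \<Longrightarrow>
      (F has_derivative (\<lambda>h. fst h *\<^sub>R Fu x + snd h *\<^sub>R Fv x)) (at x within unit_square)"
    and cont: "continuous_on unit_square Fu" "continuous_on unit_square Fv"
    and det: "\<And>x. x \<in> unit_square \<Longrightarrow> fst (Fu x) * snd (Fv x) - snd (Fu x) * fst (Fv x) \<noteq> 0"
    and g: "C1_square g gu gv" and \<phi>: "\<And>x. x \<in> unit_square \<Longrightarrow> \<phi> (F x) = g x"
  obtains G where "continuous_on (F ` unit_square) G"
    "\<And>x. x \<in> unit_square \<Longrightarrow> (\<phi> has_derivative (\<lambda>h. G (F x) \<bullet> h)) (at (F x) within F ` unit_square)"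
    "\<And>x. x \<in> unit_square \<Longrightarrow> G (F x) \<bullet> Fu x = gu x"
    "\<And>x. x \<in> unit_square \<Longrightarrow> G (F x) \<bullet> Fv x = gv x"
proof -
  define D where "D x = fst (Fu x) * snd (Fv x) - snd (Fu x) * fst (Fv x)" for x
  \<comment> \<open>Cramer's rule for the system H . Fu = gu, H . Fv = gv.\<close>
  define H where "H x = ((gu x * snd (Fv x) - gv x * snd (Fu x)) / D x, (gv x * fst (Fu x) - gu x * fst (Fv x)) / D x)" for x
  define iF where "iF = inv_into unit_square F"
  define G where "G y = H (iF y)" for y
  have D: "D x \<noteq> 0" if "x \<in> unit_square" for x using det[OF that] by (simp add: D_def)
  have iF: "iF (F x) = x" if "x \<in> unit_square" for x unfolding iF_def using inj that by simp
  have contF: "continuous_on unit_square F" using dF by (rule has_derivative_continuous_on)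
  \<comment> \<open>A continuous injection on a compact set has a continuous inverse; this is what
    differentiability of the inverse within the image rests on.\<close>
  have cont_iF: "continuous_on (F ` unit_square) iF"
    by (rule continuous_on_inv[OF contF compact_unit_square]) (use iF in auto)
  have cgu: "continuous_on unit_square gu" "continuous_on unit_square gv" using g by (auto simp: C1_square_def)
  have "continuous_on unit_square H"
    unfolding H_def D_def using det by (intro continuous_intros cont cgu) auto
  then have contG: "continuous_on (F ` unit_square) G"
    unfolding G_def by (rule continuous_on_compose2[OF _ cont_iF]) (use iF in auto)
  have HF: "H x \<bullet> (a *\<^sub>R Fu x + b *\<^sub>R Fv x) = a * gu x + b * gv x" if "x \<in> unit_square" for x a b
  proof -
    have "(gu x * snd (Fv x) - gv x * snd (Fu x)) * fst (Fu x) + (gv x * fst (Fu x) - gu x * fst (Fv x)) * snd (Fu x) = gu x * D x"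
      "(gu x * snd (Fv x) - gv x * snd (Fu x)) * fst (Fv x) + (gv x * fst (Fu x) - gu x * fst (Fv x)) * snd (Fv x) = gv x * D x"
      by (simp_all add: D_def algebra_simps)
    moreover have "H x \<bullet> y = ((gu x * snd (Fv x) - gv x * snd (Fu x)) * fst y
        + (gv x * fst (Fu x) - gu x * fst (Fv x)) * snd y) / D x" for y
      by (simp add: H_def inner_prod_def add_divide_distrib)
    ultimately have "H x \<bullet> Fu x = gu x" "H x \<bullet> Fv x = gv x" using D[OF that] by simp_all
    then show ?thesis by (simp add: inner_add_right)
  qed
  show ?thesis
  proof (rule that[OF contG])
    fix x assume x: "x \<in> unit_square"
    show "G (F x) \<bullet> Fu x = gu x" using HF[OF x, of 1 0] by (simp add: G_def iF[OF x])
    show "G (F x) \<bullet> Fv x = gv x" using HF[OF x, of 0 1] by (simp add: G_def iF[OF x])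
    define L where "L h = fst h *\<^sub>R Fu x + snd h *\<^sub>R Fv x" for h :: "real \<times> real"
    \<comment> \<open>The inverse of the Jacobian matrix of F at x.\<close>
    define L' where "L' h = ((fst h * snd (Fv x) - snd h * fst (Fv x)) / D x,
      (snd h * fst (Fu x) - fst h * snd (Fu x)) / D x)" for h :: "real \<times> real"
    have L'L: "L' (L h) = h" for h
    proof -
      have "fst (L h) * snd (Fv x) - snd (L h) * fst (Fv x) = fst h * D x"
        "snd (L h) * fst (Fu x) - fst (L h) * snd (Fu x) = snd h * D x"
        by (simp_all add: L_def D_def algebra_simps)
      then show ?thesis using D[OF x] by (simp add: L'_def)
    qed
    have LL': "L (L' h) = h" for h
    proof -
      have "(fst h * snd (Fv x) - snd h * fst (Fv x)) * fst (Fu x) + (snd h * fst (Fu x) - fst h * snd (Fu x)) * fst (Fv x) = fst h * D x"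
        "(fst h * snd (Fv x) - snd h * fst (Fv x)) * snd (Fu x) + (snd h * fst (Fu x) - fst h * snd (Fu x)) * snd (Fv x) = snd h * D x"
        by (simp_all add: D_def algebra_simps)
      moreover have "fst (L (L' h)) = ((fst h * snd (Fv x) - snd h * fst (Fv x)) * fst (Fu x)
          + (snd h * fst (Fu x) - fst h * snd (Fu x)) * fst (Fv x)) / D x"
        "snd (L (L' h)) = ((fst h * snd (Fv x) - snd h * fst (Fv x)) * snd (Fu x)
          + (snd h * fst (Fu x) - fst h * snd (Fu x)) * snd (Fv x)) / D x"
        by (simp_all add: L_def L'_def add_divide_distrib)
      ultimately show ?thesis using D[OF x] by (simp add: prod_eq_iff)
    qed
    have "linear L'"
      by (rule linearI) (simp_all add: L'_def add_divide_distrib diff_divide_distrib algebra_simps)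
    then have "(iF has_derivative L') (at (F x) within F ` unit_square)"
      using dF[OF x] cont_iF x iF L'L
      by (intro has_derivative_inverse_within[of F L])
        (auto simp: L_def[abs_def] continuous_on_eq_continuous_within fun_eq_iff)
    moreover have "(g has_derivative (\<lambda>h. fst h * gu x + snd h * gv x)) (at (iF (F x)) within iF ` F ` unit_square)"
      using g x iF unfolding C1_square_def image_image by (simp cong: image_cong)
    ultimately have "(g \<circ> iF has_derivative (\<lambda>h. fst h * gu x + snd h * gv x) \<circ> L') (at (F x) within F ` unit_square)"
      by (rule diff_chain_within)
    then have "(\<phi> has_derivative (\<lambda>h. fst h * gu x + snd h * gv x) \<circ> L') (at (F x) within F ` unit_square)"
      by (rule has_derivative_transform[rotated 2]) (use x \<phi> iF in auto)
    moreover have "(\<lambda>h. fst h * gu x + snd h * gv x) \<circ> L' = (\<lambda>h. G (F x) \<bullet> h)"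
    proof
      fix h
      have "G (F x) \<bullet> h = H x \<bullet> L (L' h)" by (simp add: LL' G_def iF[OF x])
      then show "((\<lambda>h. fst h * gu x + snd h * gv x) \<circ> L') h = G (F x) \<bullet> h"
        unfolding L_def HF[OF x] by simp
    qed
    ultimately show "(\<phi> has_derivative (\<lambda>h. G (F x) \<bullet> h)) (at (F x) within F ` unit_square)" by simp
  qed
qed

lemma has_derivative_within_Un:
  assumes "(f has_derivative f') (at x within S)" "(f has_derivative f') (at x within T)"
  shows "(f has_derivative f') (at x within S \<union> T)"
  using assms unfolding has_derivative_within by (auto simp: at_within_union intro: filterlim_sup)

text \<open>Away from a closed set the filter within it is trivial, so every bounded linear map is a
  derivative there. Points of the domain that lie in one patch only then need no separate gluing
  argument.\<close>

lemma has_derivative_within_not_closure: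
  assumes "closed S" "x \<notin> S" "bounded_linear f'"
  shows "(f has_derivative f') (at x within S)"
proof -
  have "at x within S = bot" using assms closed_limpt trivial_limit_within by blast
  then show ?thesis using assms(3) by (simp add: has_derivative_bot)
qed

lemma inner_eq_0_of_det:
  fixes d a b :: "real \<times> real"
  assumes "d \<bullet> a = 0" "d \<bullet> b = 0" "fst a * snd b - snd a * fst b \<noteq> 0"
  shows "d = 0"
proof -
  have "fst d * (fst a * snd b - snd a * fst b) = snd b * (d \<bullet> a) - snd a * (d \<bullet> b)"
    "snd d * (fst a * snd b - snd a * fst b) = fst a * (d \<bullet> b) - fst b * (d \<bullet> a)"
    by (simp_all add: inner_prod_def algebra_simps)
  then show ?thesis using assms by (simp add: prod_eq_iff)
qed

locale spline_geometry = breakpoints k \<tau> for k \<tau> +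
  fixes p r :: nat and F :: "side \<Rightarrow> real \<times> real \<Rightarrow> real \<times> real"
    and \<alpha> :: "side \<Rightarrow> real poly" and \<beta> :: "real poly"
  assumes r: "1 \<le> r" "r + 1 < p"
    and geometry: "two_patch_geometry p (knots k \<tau> p r {}) F"
    and AS_G1: "AS_G1 F \<alpha> \<beta>"
begin

abbreviation t where "t \<equiv> knots k \<tau> p r {}"

lemma r_less: "r < p" using r by simp

lemma spline_space2E:
  assumes "h \<in> spline_space2 p t"
  obtains d where "\<forall>x. h x = (\<Sum>i<spline_count p r {}. \<Sum>j<spline_count p r {}. d i j * bspline2 t p i j x)"
proof -
  define I where "I = {..<spline_count p r {}} \<times> {..<spline_count p r {}}"
  have "{bspline2 t p i j | i j. i < num_bsplines p t \<and> j < num_bsplines p t} = (\<lambda>(i, j). bspline2 t p i j) ` I"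
    by (auto simp: num_bsplines_knots I_def)
  then have "h \<in> fun_vs.span ((\<lambda>(i, j). bspline2 t p i j) ` I)"
    using assms by (simp add: spline_space2_def)
  moreover have "finite I" by (simp add: I_def)
  ultimately have "\<exists>c. \<forall>x. h x = (\<Sum>a\<in>I. c a * (case a of (i, j) \<Rightarrow> bspline2 t p i j) x)"
    by (simp only: in_span_family_iff)
  then obtain c where c: "\<forall>x. h x = (\<Sum>a\<in>I. c a * (case a of (i, j) \<Rightarrow> bspline2 t p i j) x)"
    by (rule exE)
  have "h x = (\<Sum>i<spline_count p r {}. \<Sum>j<spline_count p r {}. c (i, j) * bspline2 t p i j x)" for x
    unfolding spec[OF c, of x] I_def by (simp add: sum.cartesian_product case_prod_beta)
  then show ?thesis by (intro that[of "\<lambda>i j. c (i, j)"] allI)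
qed

lemma spline_space2I:
  "(\<lambda>x. \<Sum>i<spline_count p r {}. \<Sum>j<spline_count p r {}. d i j * bspline2 t p i j x) \<in> spline_space2 p t"
proof -
  have "(\<lambda>x. \<Sum>i<spline_count p r {}. \<Sum>j<spline_count p r {}. d i j * bspline2 t p i j x)
    = (\<Sum>i<spline_count p r {}. \<Sum>j<spline_count p r {}. fun_scale (d i j) (bspline2 t p i j))"
    by (simp add: fun_eq_iff sum_fun_apply fun_scale_def)
  also have "\<dots> \<in> spline_space2 p t"
    unfolding spline_space2_def num_bsplines_knots
    by (intro fun_vs.span_sum fun_vs.span_scale fun_vs.span_base) auto
  finally show ?thesis .
qed

lemma C1_square_spline:
  assumes "on_square f \<in> spline_space2 p t"
  obtains fu fv where "C1_square f fu fv"
proof -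
  obtain d where d: "\<forall>x. on_square f x = (\<Sum>i<spline_count p r {}. \<Sum>j<spline_count p r {}. d i j * bspline2 t p i j x)"
    by (rule spline_space2E[OF assms]) (rule that)
  define I where "I = {..<spline_count p r {}} \<times> {..<spline_count p r {}}"
  have "C1_square (\<lambda>x. bspline t p i (fst x) * bspline t p j (snd x))
     (\<lambda>x. deriv01 (bspline t p i) (fst x) * bspline t p j (snd x))
     (\<lambda>x. bspline t p i (fst x) * deriv01 (bspline t p j) (snd x))"
    if "i < spline_count p r {}" "j < spline_count p r {}" for i j
    using bspline_C1[OF r(1) r_less] that by (intro C1_square_product)
  then have "C1_square (\<lambda>x. \<Sum>a\<in>I. d (fst a) (snd a) * (bspline t p (fst a) (fst x) * bspline t p (snd a) (snd x)))
    (\<lambda>x. \<Sum>a\<in>I. d (fst a) (snd a) * (deriv01 (bspline t p (fst a)) (fst x) * bspline t p (snd a) (snd x)))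
    (\<lambda>x. \<Sum>a\<in>I. d (fst a) (snd a) * (bspline t p (fst a) (fst x) * deriv01 (bspline t p (snd a)) (snd x)))"
    by (intro C1_square_sum) (auto simp: I_def)
  then have "C1_square f
    (\<lambda>x. \<Sum>a\<in>I. d (fst a) (snd a) * (deriv01 (bspline t p (fst a)) (fst x) * bspline t p (snd a) (snd x)))
    (\<lambda>x. \<Sum>a\<in>I. d (fst a) (snd a) * (bspline t p (fst a) (fst x) * deriv01 (bspline t p (snd a)) (snd x)))"
  proof (rule C1_square_cong)
    fix x assume "x \<in> unit_square"
    then have "f x = on_square f x" by (simp add: on_square_def)
    also have "\<dots> = (\<Sum>a\<in>I. d (fst a) (snd a) * (bspline t p (fst a) (fst x) * bspline t p (snd a) (snd x)))"
      unfolding spec[OF d, of x] I_def sum.cartesian_product by (simp add: bspline2_def case_prod_beta)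
    finally show "f x = (\<Sum>a\<in>I. d (fst a) (snd a) * (bspline t p (fst a) (fst x) * bspline t p (snd a) (snd x)))" .
  qed
  then show ?thesis by (rule that)
qed

lemma geometry_derivative:
  shows "\<And>x. x \<in> unit_square \<Longrightarrow>
      (F S has_derivative (\<lambda>h. fst h *\<^sub>R D_u (F S) x + snd h *\<^sub>R D_v (F S) x)) (at x within unit_square)"
    and "continuous_on unit_square (D_u (F S))" "continuous_on unit_square (D_v (F S))"
proof -
  obtain au av where a: "C1_square (fst \<circ> F S) au av"
    using geometry C1_square_spline unfolding two_patch_geometry_def by metis
  obtain bu bv where b: "C1_square (snd \<circ> F S) bu bv"
    using geometry C1_square_spline unfolding two_patch_geometry_def by metis
  have d: "(F S has_derivative (\<lambda>h. fst h *\<^sub>R (au x, bu x) + snd h *\<^sub>R (av x, bv x))) (at x within unit_square)"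
    if "x \<in> unit_square" for x
  proof -
    have "((\<lambda>x. ((fst \<circ> F S) x, (snd \<circ> F S) x)) has_derivative
       (\<lambda>h. (fst h * au x + snd h * av x, fst h * bu x + snd h * bv x))) (at x within unit_square)"
      using a b that unfolding C1_square_def by (intro has_derivative_Pair) blast+
    then show ?thesis by (simp add: o_def)
  qed
  have eq: "D_u (F S) x = (au x, bu x)" "D_v (F S) x = (av x, bv x)" if "x \<in> unit_square" for x
    using D_u_D_v_eqI[OF d[OF that] that] by auto
  show "(F S has_derivative (\<lambda>h. fst h *\<^sub>R D_u (F S) x + snd h *\<^sub>R D_v (F S) x)) (at x within unit_square)"
    if "x \<in> unit_square" for x
    using d[OF that] eq[OF that] by simp
  have "continuous_on unit_square (\<lambda>x. (au x, bu x))" "continuous_on unit_square (\<lambda>x. (av x, bv x))"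
    using a b unfolding C1_square_def by (auto intro!: continuous_intros)
  then show "continuous_on unit_square (D_u (F S))" "continuous_on unit_square (D_v (F S))"
    using eq by (simp_all cong: continuous_on_cong)
qed

lemma inj_F: "inj_on (F S) unit_square"
  and det_F: "x \<in> unit_square \<Longrightarrow> fst (D_u (F S) x) * snd (D_v (F S) x) - snd (D_u (F S) x) * fst (D_v (F S) x) \<noteq> 0"
  and F_interface: "v \<in> {0..1} \<Longrightarrow> F PR (0, v) = F PL (0, v)"
  and patches_Int: "patch F PL \<inter> patch F PR = (\<lambda>v. F PL (0, v)) ` {0..1}"
  using geometry by (auto simp: two_patch_geometry_def regular_def)

lemma alpha_nonzero: "v \<in> {0..1} \<Longrightarrow> poly (\<alpha> S) v \<noteq> 0"
  using AS_G1 unfolding AS_G1_def by (cases S) (metis less_irrefl mult_zero_left mult_zero_right)+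

lemma AS_G1_eq:
  "v \<in> {0..1} \<Longrightarrow> poly (\<alpha> PR) v *\<^sub>R D_u (F PL) (0, v) - poly (\<alpha> PL) v *\<^sub>R D_u (F PR) (0, v)
        + poly \<beta> v *\<^sub>R D_v (F PL) (0, v) = 0"
  using AS_G1 by (simp add: AS_G1_def D_v_def)

text \<open>A common gradient G on the interface turns the equation into the inner product of G with
  the AS G1 relation of the geometry, which is 0. Conversely, each patch has its own continuous
  gradient. On the interface the two agree in the tangential direction by continuity of \<phi>, and
  the equation transfers the transversal component from left to right, as \<alpha>^L has no zero;
  hence they can be glued.\<close>

theorem C1_on_domain_iff:
  assumes \<phi>: "\<And>S. on_square (\<phi> \<circ> F S) \<in> spline_space2 p t"
  shows "C1_on (domain F) \<phi> \<longleftrightarrow> (\<forall>v\<in>{0..1}. poly (\<alpha> PR) v * D_u (\<phi> \<circ> F PL) (0, v)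
    - poly (\<alpha> PL) v * D_u (\<phi> \<circ> F PR) (0, v) + poly \<beta> v * D_v (\<phi> \<circ> F PL) (0, v) = 0)"
proof
  assume "C1_on (domain F) \<phi>"
  then obtain G where G: "\<And>x. x \<in> domain F \<Longrightarrow> (\<phi> has_derivative (\<lambda>h. G x \<bullet> h)) (at x within domain F)"
    unfolding C1_on_def by blast
  show "\<forall>v\<in>{0..1}. poly (\<alpha> PR) v * D_u (\<phi> \<circ> F PL) (0, v)
    - poly (\<alpha> PL) v * D_u (\<phi> \<circ> F PR) (0, v) + poly \<beta> v * D_v (\<phi> \<circ> F PL) (0, v) = 0"
  proof
    fix v :: real assume v: "v \<in> {0..1}"
    then have x: "(0, v) \<in> unit_square" by (simp add: unit_square_def)
    have D: "D_u (\<phi> \<circ> F S) (0, v) = G (F S (0, v)) \<bullet> D_u (F S) (0, v)"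
      "D_v (\<phi> \<circ> F S) (0, v) = G (F S (0, v)) \<bullet> D_v (F S) (0, v)" for S
    proof -
      have sub: "F S ` unit_square \<subseteq> domain F" by (cases S) (auto simp: domain_def patch_def)
      then have "F S (0, v) \<in> domain F" using x by blast
      from has_derivative_subset[OF G[OF this] sub]
      have "(\<phi> \<circ> F S has_derivative (\<lambda>h. G (F S (0, v)) \<bullet> h) \<circ> (\<lambda>h. fst h *\<^sub>R D_u (F S) (0, v) + snd h *\<^sub>R D_v (F S) (0, v)))
        (at (0, v) within unit_square)"
        by (rule diff_chain_within[OF geometry_derivative(1)[OF x]])
      then have "(\<phi> \<circ> F S has_derivative (\<lambda>h. fst h *\<^sub>R (G (F S (0, v)) \<bullet> D_u (F S) (0, v))
          + snd h *\<^sub>R (G (F S (0, v)) \<bullet> D_v (F S) (0, v)))) (at (0, v) within unit_square)"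
        by (simp add: o_def inner_add_right)
      from D_u_D_v_eqI[OF this x] show "D_u (\<phi> \<circ> F S) (0, v) = G (F S (0, v)) \<bullet> D_u (F S) (0, v)"
        "D_v (\<phi> \<circ> F S) (0, v) = G (F S (0, v)) \<bullet> D_v (F S) (0, v)" by simp_all
    qed
    have "poly (\<alpha> PR) v * D_u (\<phi> \<circ> F PL) (0, v)
      - poly (\<alpha> PL) v * D_u (\<phi> \<circ> F PR) (0, v) + poly \<beta> v * D_v (\<phi> \<circ> F PL) (0, v)
      = G (F PL (0, v)) \<bullet> (poly (\<alpha> PR) v *\<^sub>R D_u (F PL) (0, v) - poly (\<alpha> PL) v *\<^sub>R D_u (F PR) (0, v)
        + poly \<beta> v *\<^sub>R D_v (F PL) (0, v))"
      unfolding D F_interface[OF v] by (simp add: inner_add_right inner_diff_right)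
    then show "poly (\<alpha> PR) v * D_u (\<phi> \<circ> F PL) (0, v)
      - poly (\<alpha> PL) v * D_u (\<phi> \<circ> F PR) (0, v) + poly \<beta> v * D_v (\<phi> \<circ> F PL) (0, v) = 0"
      unfolding AS_G1_eq[OF v] by simp
  qed
next
  assume eq: "\<forall>v\<in>{0..1}. poly (\<alpha> PR) v * D_u (\<phi> \<circ> F PL) (0, v)
    - poly (\<alpha> PL) v * D_u (\<phi> \<circ> F PR) (0, v) + poly \<beta> v * D_v (\<phi> \<circ> F PL) (0, v) = 0"
  have ex: "\<forall>S. \<exists>G. continuous_on (patch F S) G \<and>
    (\<forall>x\<in>unit_square. (\<phi> has_derivative (\<lambda>h. G (F S x) \<bullet> h)) (at (F S x) within patch F S) \<and>
      G (F S x) \<bullet> D_u (F S) x = D_u (\<phi> \<circ> F S) x \<and> G (F S x) \<bullet> D_v (F S) x = D_v (\<phi> \<circ> F S) x)"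
  proof
    fix S
    obtain gu gv where g: "C1_square (\<phi> \<circ> F S) gu gv" using C1_square_spline[OF \<phi>] by blast
    have eq: "D_u (\<phi> \<circ> F S) x = gu x" "D_v (\<phi> \<circ> F S) x = gv x" if "x \<in> unit_square" for x
      using g that by (auto simp: C1_square_def intro!: D_u_D_v_eqI)
    obtain G where "continuous_on (F S ` unit_square) G"
      "\<And>x. x \<in> unit_square \<Longrightarrow> (\<phi> has_derivative (\<lambda>h. G (F S x) \<bullet> h)) (at (F S x) within F S ` unit_square)"
      "\<And>x. x \<in> unit_square \<Longrightarrow> G (F S x) \<bullet> D_u (F S) x = gu x"
      "\<And>x. x \<in> unit_square \<Longrightarrow> G (F S x) \<bullet> D_v (F S) x = gv x"
      by (rule C1_patch[OF inj_F geometry_derivative det_F g, of \<phi>]) auto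
    then show "\<exists>G. continuous_on (patch F S) G \<and>
    (\<forall>x\<in>unit_square. (\<phi> has_derivative (\<lambda>h. G (F S x) \<bullet> h)) (at (F S x) within patch F S) \<and>
      G (F S x) \<bullet> D_u (F S) x = D_u (\<phi> \<circ> F S) x \<and> G (F S x) \<bullet> D_v (F S) x = D_v (\<phi> \<circ> F S) x)"
      using eq unfolding patch_def by (intro exI[of _ G]) simp
  qed
  obtain G where G0: "\<forall>S. continuous_on (patch F S) (G S) \<and>
    (\<forall>x\<in>unit_square. (\<phi> has_derivative (\<lambda>h. G S (F S x) \<bullet> h)) (at (F S x) within patch F S) \<and>
      G S (F S x) \<bullet> D_u (F S) x = D_u (\<phi> \<circ> F S) x \<and> G S (F S x) \<bullet> D_v (F S) x = D_v (\<phi> \<circ> F S) x)"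
    using choice[OF ex] by (rule exE)
  have G: "\<And>S. continuous_on (patch F S) (G S)"
    "\<And>S x. x \<in> unit_square \<Longrightarrow> (\<phi> has_derivative (\<lambda>h. G S (F S x) \<bullet> h)) (at (F S x) within patch F S)"
    "\<And>S x. x \<in> unit_square \<Longrightarrow> G S (F S x) \<bullet> D_u (F S) x = D_u (\<phi> \<circ> F S) x"
    "\<And>S x. x \<in> unit_square \<Longrightarrow> G S (F S x) \<bullet> D_v (F S) x = D_v (\<phi> \<circ> F S) x"
    using G0 by simp_all
  have agree: "G PL y = G PR y" if "y \<in> patch F PL" "y \<in> patch F PR" for y
  proof -
    have "y \<in> (\<lambda>v. F PL (0, v)) ` {0..1}" unfolding patches_Int[symmetric] by (rule IntI[OF that])
    then obtain v where v: "v \<in> {0..1}" "y = F PL (0, v)" by (rule imageE)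
    then have x: "(0, v) \<in> unit_square" by (simp add: unit_square_def)
    have y: "F PR (0, v) = y" using F_interface v by simp
    have Dv: "D_v (F PR) (0, v) = D_v (F PL) (0, v)" "D_v (\<phi> \<circ> F PR) (0, v) = D_v (\<phi> \<circ> F PL) (0, v)"
      unfolding D_v_def prod.case using v(1) F_interface by (intro deriv01_cong; simp)+
    have "poly (\<alpha> PR) v * D_u (\<phi> \<circ> F PL) (0, v)
      - poly (\<alpha> PL) v * (G PL y \<bullet> D_u (F PR) (0, v)) + poly \<beta> v * D_v (\<phi> \<circ> F PL) (0, v)
      = G PL y \<bullet> (poly (\<alpha> PR) v *\<^sub>R D_u (F PL) (0, v) - poly (\<alpha> PL) v *\<^sub>R D_u (F PR) (0, v)
        + poly \<beta> v *\<^sub>R D_v (F PL) (0, v))"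
      using G(3)[OF x, of PL] G(4)[OF x, of PL] v(2) by (simp add: inner_add_right inner_diff_right)
    \<comment> \<open>Subtracting the interface equation from the AS G1 relation paired with the
      left gradient isolates the only term that involves the right patch.\<close>
    then have "poly (\<alpha> PL) v * (G PL y \<bullet> D_u (F PR) (0, v)) = poly (\<alpha> PL) v * D_u (\<phi> \<circ> F PR) (0, v)"
      using bspec[OF eq v(1)] unfolding AS_G1_eq[OF v(1)] inner_zero_right by linarith
    then have "G PL y \<bullet> D_u (F PR) (0, v) = D_u (\<phi> \<circ> F PR) (0, v)"
      using alpha_nonzero[OF v(1), of PL] by simp
    then have "(G PL y - G PR y) \<bullet> D_u (F PR) (0, v) = 0" "(G PL y - G PR y) \<bullet> D_v (F PR) (0, v) = 0"
      using G(3)[OF x, of PR] G(4)[OF x, of PR] G(4)[OF x, of PL] Dv v(2) y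
      by (simp_all add: inner_diff_left)
    from inner_eq_0_of_det[OF this det_F[OF x]] show ?thesis by simp
  qed
  define H where "H y = (if y \<in> patch F PL then G PL y else G PR y)" for y
  have HS: "H y = G S y" if "y \<in> patch F S" for y S
    using that agree by (cases S) (auto simp: H_def)
  have closed: "closed (patch F S)" for S
    unfolding patch_def
    by (intro compact_imp_closed compact_continuous_image compact_unit_square
        has_derivative_continuous_on[OF geometry_derivative(1)])
  show "C1_on (domain F) \<phi>" unfolding C1_on_def
  proof (intro exI[of _ H] conjI ballI)
    have "continuous_on (patch F S) H" for S
      using G(1)[of S] HS by (simp cong: continuous_on_cong)
    then show "continuous_on (domain F) H" unfolding domain_def by (intro continuous_on_closed_Un closed)
    fix y assume y: "y \<in> domain F"
    have "(\<phi> has_derivative (\<lambda>h. H y \<bullet> h)) (at y within patch F S)" for S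
    proof (cases "y \<in> patch F S")
      case True
      then obtain x where "x \<in> unit_square" "y = F S x" by (auto simp: patch_def)
      then show ?thesis using G(2)[of x S] HS[OF True] by simp
    next
      case False
      show ?thesis by (rule has_derivative_within_not_closure[OF closed False]) (rule bounded_linear_inner_right)
    qed
    then show "(\<phi> has_derivative (\<lambda>h. H y \<bullet> h)) (at y within domain F)"
      unfolding domain_def by (intro has_derivative_within_Un)
  qed
qed

end

section \<open>Traces and normal derivatives\<close>

lemma linear_power_dvd_Suc:
  assumes "[:- a, 1:] ^ d dvd P" "taylor_coeff a P d = 0"
  shows "[:- a, 1:] ^ Suc d dvd P"
proof -
  obtain Q where Q: "P = [:- a, 1:] ^ d * Q" using assms(1) by (rule dvdE)
  have "taylor_coeff a P d = coeff (monom 1 d * pcompose Q [:a, 1:]) d"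
    by (simp add: Q taylor_coeff_def pcompose_mult pcompose_power pcompose_pCons monom_altdef)
  also have "\<dots> = poly Q a"
    unfolding coeff_monom_mult by (simp add: pcompose_coeff_0)
  finally have "[:- a, 1:] dvd Q" using assms(2) by (simp add: poly_eq_0_iff_dvd)
  then have "[:- a, 1:] ^ d * [:- a, 1:] dvd P" unfolding Q by (intro mult_dvd_mono) simp_all
  then show ?thesis by (simp only: power_Suc2)
qed

lemma degree_sum_smult_le:
  assumes "finite A" "\<And>i. i \<in> A \<Longrightarrow> degree (f i) \<le> d"
  shows "degree (\<Sum>i\<in>A. smult (a i) (f i)) \<le> d"
proof (rule degree_sum_le[OF assms(1)])
  fix i assume "i \<in> A"
  then show "degree (smult (a i) (f i)) \<le> d" using degree_smult_le[of "a i" "f i"] assms(2)[of i] by simp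
qed

lemma taylor_coeff_nonzero:
  assumes "[:- a, 1:] ^ d dvd P" "\<not> [:- a, 1:] ^ Suc d dvd P"
  shows "taylor_coeff a P d \<noteq> 0"
  using linear_power_dvd_Suc[OF assms(1)] assms(2) by blast

lemma linear_power_dvd_mult_cancel:
  fixes P Q :: "real poly"
  assumes "[:- a, 1:] ^ d dvd P * Q" "poly P a \<noteq> 0"
  shows "[:- a, 1:] ^ d dvd Q"
proof (cases "Q = 0")
  case False
  have "P \<noteq> 0" using assms(2) by auto
  then have "order a (P * Q) = order a Q" using False assms(2) by (simp add: order_mult order_0I)
  moreover have "d \<le> order a (P * Q)" using assms(1) \<open>P \<noteq> 0\<close> False by (simp add: order_divides)
  ultimately show ?thesis by (simp add: order_divides)
qed simp

lemma linear_power_dvd_of_pderiv: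
  fixes P :: "real poly"
  assumes "[:- a, 1:] dvd P" "[:- a, 1:] ^ d dvd pderiv P"
  shows "[:- a, 1:] ^ Suc d dvd P"
proof (cases "P = 0")
  case False
  have root: "poly P a = 0" using assms(1) by (simp add: poly_eq_0_iff_dvd)
  have "pderiv P \<noteq> 0"
  proof
    assume "pderiv P = 0"
    then have "degree P = 0" by (simp add: pderiv_eq_0_iff)
    then obtain c where "P = [:c:]" by (rule degree_eq_zeroE)
    then show False using root False by simp
  qed
  then have "order a P = Suc (order a (pderiv P))" using root False by (intro order_pderiv)
  moreover have "d \<le> order a (pderiv P)" using assms(2) \<open>pderiv P \<noteq> 0\<close> by (simp add: order_divides)
  ultimately show ?thesis by (simp only: order_divides Suc_le_mono) simp
qed simp

text \<open>A constant A is a unit. A linear A is a multiple of some X - a, coprimality means B(a)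
  is nonzero, and so the zero at a passes to Q.\<close>

lemma dvd_of_coprime_degree_1:
  fixes A B Q :: "real poly"
  assumes A: "degree A \<le> 1" "A \<noteq> 0" and AB: "coprime A B" "A dvd B * Q"
  shows "A dvd Q"
proof (cases "degree A = 0")
  case True
  then have "is_unit A" using A(2) by (simp add: is_unit_iff_degree)
  then show ?thesis by (rule unit_imp_dvd)
next
  case False
  define a where "a = - coeff A 0 / coeff A 1"
  have c1: "coeff A 1 \<noteq> 0" using False A by (metis le_antisym leading_coeff_neq_0 less_one not_le)
  have A_eq: "A = smult (coeff A 1) [:- a, 1:]"
  proof (rule poly_eqI)
    fix i
    have "coeff A i = 0" if "1 < i" using A(1) that by (intro coeff_eq_0) simp
    then show "coeff A i = coeff (smult (coeff A 1) [:- a, 1:]) i"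
      using c1 by (cases i) (auto simp: a_def coeff_pCons split: nat.splits)
  qed
  have dvd_iff: "A dvd P \<longleftrightarrow> [:- a, 1:] dvd P" for P
    using smult_dvd_iff[of "coeff A 1" "[:- a, 1:]" P] unfolding A_eq[symmetric] if_not_P[OF c1] .
  have "poly B a \<noteq> 0"
  proof
    assume "poly B a = 0"
    then have "A dvd B" by (simp add: dvd_iff poly_eq_0_iff_dvd)
    then have "is_unit A" using AB(1) coprime_common_divisor[of A B A] by simp
    then show False using False A(2) by (simp add: is_unit_iff_degree)
  qed
  then show ?thesis using linear_power_dvd_mult_cancel[of a 1 B Q] AB(2) by (simp add: dvd_iff)
qed

context breakpoints
begin

lemma jump_spaceD:
  assumes "J \<in> jump_space q e" "i \<le> k"
  shows "degree (J i) \<le> q" "[:- break i, 1:] ^ e i dvd J i"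
  using assms by (auto simp: jump_space_def)

lemma jump_spaceI:
  assumes "\<And>i. i \<le> k \<Longrightarrow> degree (J i) \<le> q" "\<And>i. i \<in> {1..k} \<Longrightarrow> [:- break i, 1:] ^ e i dvd J i" "e 0 = 0"
  shows "J \<in> jump_space q e"
  unfolding jump_space_def
proof (intro CollectI allI impI conjI)
  fix i assume "i \<le> k"
  then show "degree (J i) \<le> q" by (rule assms(1))
  show "[:- break i, 1:] ^ e i dvd J i" using assms(2)[of i] assms(3) \<open>i \<le> k\<close> by (cases "i = 0") auto
qed

lemma contact_0 [simp]: "contact s E 0 = 0"
  by (simp add: contact_def)

lemma trunc_poly_mult: "trunc_poly (\<lambda>i. Q * J i) x = poly Q x * trunc_poly J x"
  by (auto simp: trunc_poly_def sum_distrib_left intro!: sum.cong)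

lemma trunc_poly_add: "trunc_poly (\<lambda>i. J i + J' i) x = trunc_poly J x + trunc_poly J' x"
  by (auto simp: trunc_poly_def sum.distrib[symmetric] intro!: sum.cong)

lemma trunc_poly_diff: "trunc_poly (\<lambda>i. J i - J' i) x = trunc_poly J x - trunc_poly J' x"
  by (auto simp: trunc_poly_def sum_subtractf[symmetric] intro!: sum.cong)

lemma trunc_poly_0: "trunc_poly (\<lambda>_. 0) x = 0"
  by (simp add: trunc_poly_def cong: if_cong)

text \<open>The spline with jumps \<open>X\<close> is a combination of B-splines, and uniqueness of
  jumps transfers its coefficients to the polynomials at each break point.\<close>

lemma bspline_jumps_span:
  assumes s: "1 \<le> s" "s \<le> q" and Jb: "\<And>i. i < spline_count q s E \<Longrightarrow> bspline (knots k \<tau> q s E) q i = trunc_poly (J i)"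
    and X: "X \<in> jump_space q (contact s E)"
  shows "\<exists>a. \<forall>l\<le>k. X l = (\<Sum>i<spline_count q s E. smult (a i) (J i l))"
proof -
  have "trunc_poly X \<in> spline_space q (knots k \<tau> q s E)"
    unfolding spline_space_eq[OF s] using X by (rule imageI)
  then have "\<exists>a. \<forall>x. trunc_poly X x = (\<Sum>i<spline_count q s E. a i * bspline (knots k \<tau> q s E) q i x)"
    by (simp only: spline_space_def num_bsplines_knots in_span_family_iff[OF finite_lessThan])
  then obtain a where a: "\<forall>x. trunc_poly X x = (\<Sum>i<spline_count q s E. a i * bspline (knots k \<tau> q s E) q i x)"
    by (rule exE)
  have "trunc_poly X x = trunc_poly (\<lambda>l. \<Sum>i<spline_count q s E. smult (a i) (J i l)) x" for x
    unfolding spec[OF a, of x] trunc_poly_sum[symmetric] by (intro sum.cong) (simp_all add: Jb)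
  then have "\<forall>l\<le>k. X l = (\<Sum>i<spline_count q s E. smult (a i) (J i l))"
    using trunc_poly_eq_imp[of X "\<lambda>l. \<Sum>i<spline_count q s E. smult (a i) (J i l)"] by simp
  then show ?thesis by (rule exI[of _ a])
qed

lemma bspline_jumps_indep:
  assumes s: "1 \<le> s" "s \<le> q" and Jb: "\<And>i. i < spline_count q s E \<Longrightarrow> bspline (knots k \<tau> q s E) q i = trunc_poly (J i)"
    and zero: "\<And>l. l \<le> k \<Longrightarrow> (\<Sum>i<spline_count q s E. smult (a i) (J i l)) = 0"
    and i: "i < spline_count q s E"
  shows "a i = 0"
proof (rule indep_famD[OF indep_bspline[OF s, of E], of a i])
  fix x
  have "(\<Sum>i<spline_count q s E. a i * bspline (knots k \<tau> q s E) q i x)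
      = (\<Sum>i<spline_count q s E. a i * trunc_poly (J i) x)"
    by (intro sum.cong) (simp_all add: Jb)
  also have "\<dots> = trunc_poly (\<lambda>l. \<Sum>i<spline_count q s E. smult (a i) (J i l)) x"
    by (rule trunc_poly_sum)
  also have "\<dots> = trunc_poly (\<lambda>_. 0) x"
    by (rule fun_cong[OF trunc_poly_cong]) (rule zero)
  finally show "(\<Sum>i<spline_count q s E. a i * bspline (knots k \<tau> q s E) q i x) = 0"
    by (simp only: trunc_poly_0)
qed (use i in simp)

text \<open>At every inner knot all members vanish to order s + 1, except that an extra member i has
  exact order s at its own knot \<open>m i\<close>. The Taylor coefficients of order s thus form a
  diagonal matrix with nonzero diagonal on the extra members. It determines their coefficients; what
  remains is an expansion in, or a relation among, the B-splines without additional knots.\<close>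

lemma extended_jumps:
  fixes m :: "nat \<Rightarrow> nat" and J :: "nat \<Rightarrow> nat \<Rightarrow> real poly"
  assumes s: "1 \<le> s" "s \<le> q" and n: "n = spline_count q s {}"
    and E: "E \<subseteq> {1..k}" "bij_betw m {n..<n'} E" "n \<le> n'"
    and base: "\<And>i. i < n \<Longrightarrow> bspline (knots k \<tau> q s {}) q i = trunc_poly (J i)"
      "\<And>i. i < n \<Longrightarrow> J i \<in> jump_space q (contact s {})"
    and extra: "\<And>i. i \<in> {n..<n'} \<Longrightarrow> J i \<in> jump_space q (contact s {m i})"
      "\<And>i. i \<in> {n..<n'} \<Longrightarrow> \<not> [:- break (m i), 1:] ^ Suc s dvd J i (m i)"
  shows extended_jumps_span: "X \<in> jump_space q (contact s E) \<Longrightarrow> \<exists>a. \<forall>l\<le>k. X l = (\<Sum>i<n'. smult (a i) (J i l))"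
    and extended_jumps_indep: "(\<And>l. l \<le> k \<Longrightarrow> (\<Sum>i<n'. smult (a i) (J i l)) = 0) \<Longrightarrow> i < n' \<Longrightarrow> a i = 0"
proof -
  define \<kappa> where "\<kappa> i l = taylor_coeff (break l) (J i l) s" for i l
  have mE: "m i \<in> {1..k}" if "i \<in> {n..<n'}" for i using bij_betwE[OF E(2)] E(1) that by blast
  have dvd: "[:- break l, 1:] ^ (if i \<in> {n..<n'} \<and> m i = l then s else Suc s) dvd J i l"
    if "i < n'" "l \<in> {1..k}" for i l
  proof (cases "i < n")
    case True
    then have "contact s {} l = (if i \<in> {n..<n'} \<and> m i = l then s else Suc s)" using that by (simp add: contact_def)
    then show ?thesis using jump_spaceD(2)[OF base(2)[OF True], of l] that(2) by (simp only:) simp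
  next
    case False
    then have i: "i \<in> {n..<n'}" using that by simp
    then have "contact s {m i} l = (if i \<in> {n..<n'} \<and> m i = l then s else Suc s)"
      using that by (auto simp: contact_def)
    then show ?thesis using jump_spaceD(2)[OF extra(1)[OF i], of l] that(2) by (simp only:) simp
  qed
  have \<kappa>0: "\<kappa> i l = 0" if "i < n'" "l \<in> {1..k}" "\<not> (i \<in> {n..<n'} \<and> m i = l)" for i l
    unfolding \<kappa>_def using dvd[OF that(1,2)] that(3) by (intro taylor_coeff_dvd_eq_0[of _ "Suc s"]) auto
  have \<kappa>1: "\<kappa> i (m i) \<noteq> 0" if "i \<in> {n..<n'}" for i
    unfolding \<kappa>_def using dvd[of i "m i"] mE[OF that] that extra(2)[OF that] by (intro taylor_coeff_nonzero) auto
  have sum_split: "(\<Sum>i<n'. f i) = (\<Sum>i<n. f i) + (\<Sum>i\<in>{n..<n'}. f i)" for f :: "nat \<Rightarrow> 'z::comm_monoid_add"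
    using E(3) by (simp add: sum.atLeastLessThan_concat[of 0 n n', symmetric] atLeast0LessThan[symmetric])
  have inj: "i = j" if "i \<in> {n..<n'}" "j \<in> {n..<n'}" "m i = m j" for i j
    using bij_betw_imp_inj_on[OF E(2)] that by (meson inj_onD)
  show "\<exists>a. \<forall>l\<le>k. X l = (\<Sum>i<n'. smult (a i) (J i l))" if X: "X \<in> jump_space q (contact s E)"
  proof -
    \<comment> \<open>Chosen to cancel the coefficient of order s of \<open>X\<close> at
      \<open>m i\<close>; no other member interferes there.\<close>
    define a where "a i = taylor_coeff (break (m i)) (X (m i)) s / \<kappa> i (m i)" for i
    define Y where "Y l = X l - (\<Sum>i\<in>{n..<n'}. smult (a i) (J i l))" for l
    have "Y \<in> jump_space q (contact s {})"
    proof (rule jump_spaceI)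
      fix l assume l: "l \<le> k"
      have "degree (\<Sum>i\<in>{n..<n'}. smult (a i) (J i l)) \<le> q"
        by (rule degree_sum_smult_le) (use jump_spaceD(1)[OF extra(1) l] in auto)
      then show "degree (Y l) \<le> q"
        unfolding Y_def using jump_spaceD(1)[OF X l] by (intro degree_diff_le)
    next
      fix l assume l: "l \<in> {1..k}"
      have c: "contact s {} l = Suc s" using l by (simp add: contact_def)
      show "[:- break l, 1:] ^ contact s {} l dvd Y l"
      proof (cases "l \<in> E")
        case False
        then have nm: "\<not> (i \<in> {n..<n'} \<and> m i = l)" for i using bij_betwE[OF E(2)] by blast
        have "[:- break l, 1:] ^ Suc s dvd X l"
          using jump_spaceD(2)[OF X, of l] l False by (simp add: contact_def)
        then show ?thesis unfolding c Y_def
        proof (intro dvd_diff dvd_sum dvd_smult)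
          fix i assume "i \<in> {n..<n'}"
          then show "[:- break l, 1:] ^ Suc s dvd J i l"
            using dvd[OF _ l, of i] nm[of i] by (simp only: if_False) simp
        qed
      next
        case True
        then obtain i where i: "i \<in> {n..<n'}" "m i = l" using E(2) unfolding bij_betw_def by blast
        have d: "[:- break l, 1:] ^ s dvd Y l"
        proof -
          have "[:- break l, 1:] ^ s dvd X l"
            using jump_spaceD(2)[OF X, of l] l True by (simp add: contact_def)
          moreover have "[:- break l, 1:] ^ s dvd J i l" if "i \<in> {n..<n'}" for i
            by (rule dvd_trans[OF le_imp_power_dvd dvd[OF _ l]]) (use that in auto)
          ultimately show ?thesis unfolding Y_def by (intro dvd_diff dvd_sum dvd_smult)
        qed
        have "taylor_coeff (break l) (Y l) s = taylor_coeff (break l) (X l) s - (\<Sum>j\<in>{n..<n'}. a j * \<kappa> j l)"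
          by (simp add: Y_def taylor_coeff_sum[symmetric] taylor_coeff_smult[symmetric] \<kappa>_def)
            (simp add: taylor_coeff_def pcompose_diff)
        also have "(\<Sum>j\<in>{n..<n'}. a j * \<kappa> j l) = (\<Sum>j\<in>{n..<n'}. if j = i then a i * \<kappa> i l else 0)"
          using \<kappa>0[OF _ l] inj i by (intro sum.cong) auto
        also have "\<dots> = taylor_coeff (break l) (X l) s"
          using i \<kappa>1[OF i(1)] by (simp add: a_def)
        finally have "taylor_coeff (break l) (Y l) s = 0" by simp
        then show ?thesis unfolding c by (rule linear_power_dvd_Suc[OF d])
      qed
    qed simp
    from bspline_jumps_span[OF s base(1)[unfolded n] this]
    obtain a' where a': "\<forall>l\<le>k. Y l = (\<Sum>i<n. smult (a' i) (J i l))"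
      unfolding n by (rule exE)
    have "X l = (\<Sum>i<n'. smult (if i < n then a' i else a i) (J i l))" if "l \<le> k" for l
      unfolding sum_split using a' that by (simp add: Y_def algebra_simps)
    then show ?thesis by (intro exI[of _ "\<lambda>i. if i < n then a' i else a i"]) blast
  qed
  show "a i = 0" if zero: "\<And>l. l \<le> k \<Longrightarrow> (\<Sum>i<n'. smult (a i) (J i l)) = 0" and i: "i < n'"
  proof -
    have ext: "a i = 0" if i: "i \<in> {n..<n'}" for i
    proof -
      have l: "m i \<in> {1..k}" by (rule mE[OF i])
      \<comment> \<open>At order s only the i-th member contributes at its own knot.\<close>
      have "0 = taylor_coeff (break (m i)) (\<Sum>j<n'. smult (a j) (J j (m i))) s"
        using zero[of "m i"] l by (simp add: taylor_coeff_def)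
      also have "\<dots> = (\<Sum>j<n'. a j * \<kappa> j (m i))" by (simp add: taylor_coeff_sum taylor_coeff_smult \<kappa>_def)
      also have "\<dots> = (\<Sum>j<n'. if j = i then a i * \<kappa> i (m i) else 0)"
        using \<kappa>0[OF _ l] inj i by (intro sum.cong) auto
      also have "\<dots> = a i * \<kappa> i (m i)" using i by simp
      finally show ?thesis using \<kappa>1[OF i] by simp
    qed
    show ?thesis
    proof (cases "i < n")
      case True
      have "(\<Sum>i<spline_count q s {}. smult (a i) (J i l)) = 0" if "l \<le> k" for l
        using zero[OF that] ext unfolding sum_split n[symmetric] by simp
      then show ?thesis using bspline_jumps_indep[OF s base(1)[unfolded n], of a i] True n by simp
    qed (use ext i in simp)
  qed
qed

end

text \<open>For the trace functions \<open>trunc_poly (J i)\<close>, the second summand of \<^const>\<open>phi_trace\<close> is the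
  product of \<open>smult (c i) (\<alpha> S) + b S\<close> and the derivative of the trace. This product is smooth
  enough since the first factor vanishes where the trace is less smooth.\<close>

locale trace_system = spline_geometry k \<tau> p r F \<alpha> \<beta> for k \<tau> p r F \<alpha> \<beta> +
  fixes b :: "side \<Rightarrow> real poly" and n m :: nat and e :: "nat \<Rightarrow> nat"
    and J Jb :: "nat \<Rightarrow> nat \<Rightarrow> real poly" and c :: "nat \<Rightarrow> real"
  assumes beta_split: "beta_split \<alpha> \<beta> b"
    and e: "e 0 = 0" "\<And>l. l \<in> {1..k} \<Longrightarrow> e l = r + 1 \<or> e l = r + 2 \<and> poly \<beta> (break l) \<noteq> 0"
    and J: "\<And>i. i < n \<Longrightarrow> J i \<in> jump_space p e"
    and J_span: "\<And>X. X \<in> jump_space p e \<Longrightarrow> \<exists>a. \<forall>l\<le>k. X l = (\<Sum>i<n. smult (a i) (J i l))"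
    and J_indep: "\<And>a i. (\<And>l. l \<le> k \<Longrightarrow> (\<Sum>i<n. smult (a i) (J i l)) = 0) \<Longrightarrow> i < n \<Longrightarrow> a i = 0"
    and J_normal: "\<And>i l S. i < n \<Longrightarrow> l \<in> {1..k} \<Longrightarrow>
        [:- break l, 1:] ^ (r + 1) dvd (smult (c i) (\<alpha> S) + b S) * pderiv (J i l)"
    and m: "m = spline_count (p - d_alpha \<alpha>) r {}"
    and Jb: "\<And>j. j < m \<Longrightarrow> Jb j \<in> jump_space (p - d_alpha \<alpha>) (contact r {})"
      "\<And>j. j < m \<Longrightarrow> bspline (knots k \<tau> (p - d_alpha \<alpha>) r {}) (p - d_alpha \<alpha>) j = trunc_poly (Jb j)"
begin

text \<open>The jumps of D_u g^S at u = 0 for the i-th trace function: the derivatives of the first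
  two B-splines at 0 cancel in the first summand, and the factor of the second is normalised.
  \<open>MN\<close> gives, up to a constant factor, the same for the normal functions.\<close>

definition MT :: "side \<Rightarrow> nat \<Rightarrow> nat \<Rightarrow> real poly" where
  "MT S i l = (smult (c i) (\<alpha> S) + b S) * pderiv (J i l)"

definition MN :: "side \<Rightarrow> nat \<Rightarrow> nat \<Rightarrow> real poly" where
  "MN S j l = \<alpha> S * Jb j l"

lemma degree_alpha: "degree (\<alpha> S) \<le> 1" "degree (\<alpha> S) \<le> d_alpha \<alpha>" "d_alpha \<alpha> \<le> 1"
  using AS_G1 unfolding AS_G1_def d_alpha_def by (cases S; simp)+

lemma degree_b: "degree (b S) \<le> 1"
  using beta_split by (simp add: beta_split_def)

lemma beta_eq: "\<beta> = \<alpha> PL * b PR - \<alpha> PR * b PL"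
  using beta_split by (simp add: beta_split_def)

lemma break_01: "l \<le> k \<Longrightarrow> break l \<in> {0..1}"
  using break_nonneg[of l] break_less_1[of l] by simp

lemma alpha_neq_0: "\<alpha> S \<noteq> 0"
  using alpha_nonzero[of 0 S] by auto

lemma e_ge: "l \<in> {1..k} \<Longrightarrow> r + 1 \<le> e l"
  using e(2)[of l] by auto

lemma J_smooth: "i < n \<Longrightarrow> J i \<in> jump_space p (contact r {})"
proof (rule jump_spaceI)
  fix l assume i: "i < n" and l: "l \<in> {1..k}"
  have le: "contact r {} l \<le> e l" using e_ge[OF l] l by (simp add: contact_def)
  have "[:- break l, 1:] ^ e l dvd J i l"
    by (rule jump_spaceD(2)[OF J[OF i]]) (use l in simp)
  then show "[:- break l, 1:] ^ contact r {} l dvd J i l"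
    by (rule dvd_trans[OF le_imp_power_dvd[OF le]])
qed (use jump_spaceD(1)[OF J] in auto)

lemma MT_smooth: "i < n \<Longrightarrow> MT S i \<in> jump_space p (contact r {})"
proof (rule jump_spaceI)
  fix l assume i: "i < n" and l: "l \<le> k"
  \<comment> \<open>The linear factor makes up for the degree lost by differentiation, so the
    product has degree at most p again.\<close>
  have "degree (smult (c i) (\<alpha> S) + b S) \<le> 1"
    using degree_smult_le[of "c i" "\<alpha> S"] degree_alpha(1)[of S] degree_b[of S] by (intro degree_add_le) linarith+
  moreover have "degree (pderiv (J i l)) \<le> p - 1"
    using jump_spaceD(1)[OF J[OF i] l] by (simp add: degree_pderiv)
  moreover have "degree (MT S i l) \<le> degree (smult (c i) (\<alpha> S) + b S) + degree (pderiv (J i l))"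
    unfolding MT_def by (rule degree_mult_le)
  ultimately show "degree (MT S i l) \<le> p" using r by linarith
next
  fix l assume i: "i < n" and l: "l \<in> {1..k}"
  have "contact r {} l = r + 1" using l by (simp add: contact_def)
  then show "[:- break l, 1:] ^ contact r {} l dvd MT S i l"
    unfolding MT_def using J_normal[OF i l, of S] by (simp only:)
qed simp

lemma MN_smooth: "j < m \<Longrightarrow> MN S j \<in> jump_space p (contact r {})"
proof (rule jump_spaceI)
  fix l assume j: "j < m" and l: "l \<le> k"
  have "degree (MN S j l) \<le> degree (\<alpha> S) + degree (Jb j l)" unfolding MN_def by (rule degree_mult_le)
  then show "degree (MN S j l) \<le> p"
    using degree_alpha(2)[of S] degree_alpha(3) jump_spaceD(1)[OF Jb(1)[OF j] l] r by linarith
next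
  fix l assume j: "j < m" and l: "l \<in> {1..k}"
  show "[:- break l, 1:] ^ contact r {} l dvd MN S j l"
    unfolding MN_def using jump_spaceD(2)[OF Jb(1)[OF j], of l] l by (intro dvd_mult) simp
qed simp

lemma MT_interface: "\<alpha> PR * MT PL i l - \<alpha> PL * MT PR i l + \<beta> * pderiv (J i l) = 0"
  unfolding MT_def beta_eq by (simp add: algebra_simps)

lemma MN_interface: "\<alpha> PR * MN PL j l - \<alpha> PL * MN PR j l = 0"
  unfolding MN_def by (simp add: algebra_simps)

text \<open>Inserting \<beta> = \<alpha>^L b^R - \<alpha>^R b^L gives \<alpha>^R (H^L - b^L G') =
  \<alpha>^L (H^R - b^R G'). By coprimality \<alpha>^L divides the left difference, and the quotient
  K serves both sides.\<close>

lemma normal_derivative_factor: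
  assumes eq: "\<alpha> PR * HL - \<alpha> PL * HR + \<beta> * G' = 0"
  obtains K where "HL = \<alpha> PL * K + b PL * G'" "HR = \<alpha> PR * K + b PR * G'"
proof -
  have *: "\<alpha> PR * (HL - b PL * G') = \<alpha> PL * (HR - b PR * G')"
    using eq unfolding beta_eq by (simp add: algebra_simps)
  then have dvd: "\<alpha> PL dvd \<alpha> PR * (HL - b PL * G')" by (rule dvdI)
  have coprime: "coprime (\<alpha> PL) (\<alpha> PR)" using AS_G1 by (simp add: AS_G1_def)
  have "\<alpha> PL dvd HL - b PL * G'"
    by (rule dvd_of_coprime_degree_1[OF degree_alpha(1) alpha_neq_0 coprime dvd])
  then obtain K where K: "HL - b PL * G' = \<alpha> PL * K" by (rule dvdE)
  have "\<alpha> PL * (\<alpha> PR * K) = \<alpha> PL * (HR - b PR * G')" using * unfolding K by (simp add: ac_simps)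
  then have "\<alpha> PR * K = HR - b PR * G'" using alpha_neq_0[of PL] by simp
  then show ?thesis using K by (intro that[of K]) (simp_all add: algebra_simps)
qed

lemma interface_decomposition:
  assumes G: "G \<in> jump_space p (contact r {})" and H: "\<And>S. H S \<in> jump_space p (contact r {})"
    and eq: "\<And>l. l \<le> k \<Longrightarrow> \<alpha> PR * H PL l - \<alpha> PL * H PR l + \<beta> * pderiv (G l) = 0"
  shows "\<exists>a a'. \<forall>l\<le>k. G l = (\<Sum>i<n. smult (a i) (J i l)) \<and>
    (\<forall>S. H S l = (\<Sum>i<n. smult (a i) (MT S i l)) + (\<Sum>j<m. smult (a' j) (MN S j l)))"
proof -
  have dvdG: "[:- break l, 1:] ^ (r + 1) dvd G l" if "l \<in> {1..k}" for l
    using jump_spaceD(2)[OF G, of l] that by (simp add: contact_def)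
  have dvdH: "[:- break l, 1:] ^ (r + 1) dvd H S l" if "l \<in> {1..k}" for l S
    using jump_spaceD(2)[OF H, of l] that by (simp add: contact_def)
  have "G \<in> jump_space p e"
  proof (rule jump_spaceI)
    fix l assume l: "l \<in> {1..k}"
    show "[:- break l, 1:] ^ e l dvd G l"
    proof (cases "e l = r + 1")
      case True
      then show ?thesis using dvdG[OF l] by (simp only:)
    next
      case False
      then have e2: "e l = Suc (r + 1)" "poly \<beta> (break l) \<noteq> 0" using e(2)[OF l] by auto
      \<comment> \<open>Solved for \<beta> G', the equation bounds the order of \<beta> G' from
        below; \<beta> can be cancelled as it is nonzero at the break point, and integrating the
        order of G' raises that of G by one.\<close>
      have "\<beta> * pderiv (G l) = \<alpha> PL * H PR l - \<alpha> PR * H PL l"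
        using eq[of l] l by (simp add: algebra_simps)
      also have "[:- break l, 1:] ^ (r + 1) dvd \<dots>"
        by (intro dvd_diff dvd_mult dvdH[OF l])
      finally have "[:- break l, 1:] ^ (r + 1) dvd pderiv (G l)"
        using e2(2) by (rule linear_power_dvd_mult_cancel)
      moreover have "[:- break l, 1:] dvd G l"
        by (rule dvd_trans[OF dvd_power dvdG[OF l]]) simp
      ultimately show ?thesis unfolding e2(1) by (intro linear_power_dvd_of_pderiv)
    qed
  qed (use jump_spaceD(1)[OF G] e(1) in auto)
  from J_span[OF this] obtain a where a: "\<forall>l\<le>k. G l = (\<Sum>i<n. smult (a i) (J i l))" by (rule exE)
  have G': "pderiv (G l) = (\<Sum>i<n. smult (a i) (pderiv (J i l)))" if "l \<le> k" for l
    using a that higher_pderiv_sum[of 1 "\<lambda>i. smult (a i) (J i l)"] by (simp add: pderiv_smult)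
  have "\<exists>K. \<forall>S. \<alpha> S * K = H S l - (\<Sum>i<n. smult (a i) (MT S i l))" if l: "l \<le> k" for l
  proof -
    obtain K where K: "H PL l = \<alpha> PL * K + b PL * pderiv (G l)" "H PR l = \<alpha> PR * K + b PR * pderiv (G l)"
      using normal_derivative_factor[OF eq[OF l]] by metis
    have HS: "H S l = \<alpha> S * K + b S * pderiv (G l)" for S using K by (cases S) auto
    \<comment> \<open>The part of the trace functions that is proportional to \<alpha>^S is absorbed
      into K, by the same amount on both sides.\<close>
    have "\<alpha> S * (K - (\<Sum>i<n. smult (a i * c i) (pderiv (J i l)))) = H S l - (\<Sum>i<n. smult (a i) (MT S i l))" for S
    proof -
      have "(\<Sum>i<n. smult (a i) (MT S i l))
        = \<alpha> S * (\<Sum>i<n. smult (a i * c i) (pderiv (J i l))) + b S * pderiv (G l)"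
        unfolding G'[OF l] MT_def sum_distrib_left sum.distrib[symmetric]
        by (intro sum.cong refl) (simp add: algebra_simps smult_add_right)
      then show ?thesis by (simp add: HS algebra_simps)
    qed
    then show ?thesis by (intro exI[of _ "K - (\<Sum>i<n. smult (a i * c i) (pderiv (J i l)))"]) blast
  qed
  then obtain K where K: "\<And>l S. l \<le> k \<Longrightarrow> \<alpha> S * K l = H S l - (\<Sum>i<n. smult (a i) (MT S i l))"
    by metis
  have KJ: "(\<lambda>l. \<alpha> S * K l) \<in> jump_space p (contact r {})" for S
  proof (rule jump_spaceI)
    fix l assume l: "l \<le> k"
    have "degree (\<Sum>i<n. smult (a i) (MT S i l)) \<le> p"
      by (rule degree_sum_smult_le) (use jump_spaceD(1)[OF MT_smooth l] in auto)
    then show "degree (\<alpha> S * K l) \<le> p"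
      unfolding K[OF l] using jump_spaceD(1)[OF H l] by (intro degree_diff_le)
  next
    fix l assume l: "l \<in> {1..k}"
    then have l': "l \<le> k" by simp
    show "[:- break l, 1:] ^ contact r {} l dvd \<alpha> S * K l"
      unfolding K[OF l']
      by (intro dvd_diff dvd_sum dvd_smult jump_spaceD(2)[OF H l'] jump_spaceD(2)[OF MT_smooth l']) simp
  qed simp
  have "K \<in> jump_space (p - d_alpha \<alpha>) (contact r {})"
  proof (rule jump_spaceI)
    fix l assume l: "l \<le> k"
    \<comment> \<open>The side with the larger degree of \<alpha> gives the bound p - d_\<alpha> for
      the degree of K.\<close>
    obtain S where S: "degree (\<alpha> S) = d_alpha \<alpha>"
      unfolding d_alpha_def max_def by (cases "degree (\<alpha> PL) \<le> degree (\<alpha> PR)") auto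
    show "degree (K l) \<le> p - d_alpha \<alpha>"
    proof (cases "K l = 0")
      case False
      then have "degree (\<alpha> S * K l) = d_alpha \<alpha> + degree (K l)"
        using S alpha_neq_0[of S] by (simp add: degree_mult_eq)
      moreover have "degree (\<alpha> S * K l) \<le> p" by (rule jump_spaceD(1)[OF KJ l])
      ultimately show ?thesis by linarith
    qed simp
  next
    fix l assume l: "l \<in> {1..k}"
    then have l': "l \<le> k" by simp
    have "[:- break l, 1:] ^ contact r {} l dvd \<alpha> PL * K l" by (rule jump_spaceD(2)[OF KJ l'])
    then show "[:- break l, 1:] ^ contact r {} l dvd K l"
      by (rule linear_power_dvd_mult_cancel) (rule alpha_nonzero[OF break_01[OF l']])
  qed simp
  note Kj = this
  have rd: "r \<le> p - d_alpha \<alpha>" using r degree_alpha(3) by linarith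
  from bspline_jumps_span[OF r(1) rd Jb(2)[unfolded m] Kj, folded m]
  obtain a' where a': "\<forall>l\<le>k. K l = (\<Sum>j<m. smult (a' j) (Jb j l))" by (rule exE)
  have "H S l = (\<Sum>i<n. smult (a i) (MT S i l)) + (\<Sum>j<m. smult (a' j) (MN S j l))" if l: "l \<le> k" for l S
  proof -
    have "(\<Sum>j<m. smult (a' j) (MN S j l)) = \<alpha> S * K l"
      using a' l by (simp add: MN_def sum_distrib_left)
    then show ?thesis using K[OF l, of S] by simp
  qed
  with a show ?thesis by (intro exI[of _ a] exI[of _ a']) simp
qed

lemma interface_independence:
  assumes G0: "\<And>l. l \<le> k \<Longrightarrow> (\<Sum>i<n. smult (a i) (J i l)) = 0"
    and H0: "\<And>l. l \<le> k \<Longrightarrow> (\<Sum>i<n. smult (a i) (MT PL i l)) + (\<Sum>j<m. smult (a' j) (MN PL j l)) = 0"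
  shows "\<And>i. i < n \<Longrightarrow> a i = 0" "\<And>j. j < m \<Longrightarrow> a' j = 0"
proof -
  show a: "a i = 0" if "i < n" for i using J_indep[OF G0 that] .
  have *: "(\<Sum>j<m. smult (a' j) (Jb j l)) = 0" if "l \<le> k" for l
  proof -
    have "\<alpha> PL * (\<Sum>j<m. smult (a' j) (Jb j l)) = (\<Sum>j<m. smult (a' j) (MN PL j l))"
      by (simp add: MN_def sum_distrib_left)
    also have "\<dots> = 0" using H0[OF that] a by simp
    finally show ?thesis using alpha_neq_0[of PL] by simp
  qed
  show "a' j = 0" if "j < m" for j
    by (rule bspline_jumps_indep[of r "p - d_alpha \<alpha>" "{}" Jb a' j])
      (use * that m r degree_alpha(3) Jb(2) in auto)
qed

end

section \<open>The spaces in terms of coefficients\<close>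

lemma C1_on_0: "C1_on X (\<lambda>_. 0)"
proof -
  have eq: "(\<bullet>) (0::'a) = (\<lambda>_. 0)" by (simp add: fun_eq_iff)
  show ?thesis unfolding C1_on_def
    by (intro exI[of _ "\<lambda>_. 0"] conjI ballI continuous_on_const) (simp only: eq has_derivative_const)
qed

lemma C1_on_add:
  assumes "C1_on X f" "C1_on X g"
  shows "C1_on X (\<lambda>x. f x + g x)"
proof -
  from assms(1)[unfolded C1_on_def] obtain Gf where f: "continuous_on X Gf \<and>
    (\<forall>x\<in>X. (f has_derivative (\<lambda>h. Gf x \<bullet> h)) (at x within X))" by (rule exE)
  from assms(2)[unfolded C1_on_def] obtain Gg where g: "continuous_on X Gg \<and>
    (\<forall>x\<in>X. (g has_derivative (\<lambda>h. Gg x \<bullet> h)) (at x within X))" by (rule exE)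
  have "((\<lambda>x. f x + g x) has_derivative (\<lambda>h. (Gf x + Gg x) \<bullet> h)) (at x within X)" if "x \<in> X" for x
    unfolding inner_add_left using f g that by (intro has_derivative_add) auto
  then show ?thesis unfolding C1_on_def
    using f g by (intro exI[of _ "\<lambda>x. Gf x + Gg x"]) (auto intro: continuous_on_add)
qed

lemma C1_on_scale:
  assumes "C1_on X f"
  shows "C1_on X (\<lambda>x. c * f x)"
proof -
  from assms[unfolded C1_on_def] obtain G where f: "continuous_on X G \<and>
    (\<forall>x\<in>X. (f has_derivative (\<lambda>h. G x \<bullet> h)) (at x within X))" by (rule exE)
  have "((\<lambda>x. c * f x) has_derivative (\<lambda>h. (c *\<^sub>R G x) \<bullet> h)) (at x within X)" if "x \<in> X" for x
    unfolding inner_scaleR_left using f that by (intro has_derivative_mult_right) auto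
  moreover have "continuous_on X (\<lambda>x. c *\<^sub>R G x)" using f by (intro continuous_intros) auto
  ultimately show ?thesis unfolding C1_on_def by (intro exI[of _ "\<lambda>x. c *\<^sub>R G x"] conjI ballI)
qed

context breakpoints
begin

lemma spline_count_uniform: "spline_count p r {} = p + 1 + k * (p - r)"
proof -
  have "spline_count p r {} = (\<Sum>i\<in>insert 0 {1..k}. knot_mult p r {} i)"
    unfolding spline_count_eq by (rule sum.cong) auto
  also have "\<dots> = p + 1 + (\<Sum>i\<in>{1..k}. p - r)"
    by (subst sum.insert) (auto simp: knot_mult_def intro!: sum.cong)
  finally show ?thesis by simp
qed

end

context spline_geometry
begin

abbreviation nb where "nb \<equiv> spline_count p r {}"
abbreviation B where "B \<equiv> bspline t p"

lemma nb_gt: "2 < nb"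
  by (rule spline_count_gt_2[OF r(1) r_less])

lemma bspline_indep_on:
  assumes "\<And>x. x \<in> {0..1} \<Longrightarrow> (\<Sum>i<nb. c i * B i x) = 0" "i < nb"
  shows "c i = 0"
proof (rule indep_famD[OF indep_bspline[of r p "{}"], of c i])
  show "(\<Sum>i<nb. c i * B i x) = 0" for x
  proof (cases "x \<in> {0..1}")
    case False
    then have "B i x = 0" if "i < nb" for i using knots.bspline_outside[OF False, of i p] that by simp
    then show ?thesis by simp
  qed (rule assms(1))
qed (use r assms(2) in auto)

lemma from_pair_pullback:
  assumes g: "\<And>v. v \<in> {0..1} \<Longrightarrow> g PL (0, v) = g PR (0, v)" and x: "x \<in> unit_square"
  shows "from_pair F g (F S x) = g S x"
proof (cases S)
  case PL
  then show ?thesis using x inj_F[of PL] by (simp add: from_pair_def patch_def)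
next
  case PR
  show ?thesis
  proof (cases "F PR x \<in> patch F PL")
    case True
    then have "F PR x \<in> patch F PL \<inter> patch F PR" using x by (simp add: patch_def)
    then have "F PR x \<in> (\<lambda>v. F PL (0, v)) ` {0..1}" unfolding patches_Int .
    then obtain v where v: "F PR x = F PL (0, v)" "v \<in> {0..1}" by (rule imageE)
    have v': "(0, v) \<in> unit_square" using v(2) by (simp add: unit_square_def)
    \<comment> \<open>A point of the right patch that also lies in the left one is on the interface.
      Injectivity of \<open>F PR\<close> makes its parameter (0, v), where the two pull-backs
      agree.\<close>
    have "F PR x = F PR (0, v)" using v F_interface by simp
    then have "x = (0, v)" using inj_onD[OF inj_F[of PR] _ x v'] by blast
    moreover have "inv_into unit_square (F PL) (F PR x) = (0, v)"
      unfolding v(1) by (rule inv_into_f_f[OF inj_F v'])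
    ultimately show ?thesis using True g[OF v(2)] PR by (simp add: from_pair_def)
  next
    case False
    moreover have "F PR x \<in> patch F PR" using x by (simp add: patch_def)
    ultimately show ?thesis using x inj_F[of PR] PR by (simp add: from_pair_def)
  qed
qed

lemma from_pair_outside: "x \<notin> domain F \<Longrightarrow> from_pair F g x = 0"
  by (simp add: from_pair_def domain_def)

lemma domain_pullback_eqI:
  assumes "\<And>x. x \<notin> domain F \<Longrightarrow> \<phi> x = \<psi> x" "\<And>S x. x \<in> unit_square \<Longrightarrow> \<phi> (F S x) = \<psi> (F S x)"
  shows "\<phi> x = \<psi> x"
  using assms by (cases "x \<in> domain F") (auto simp: domain_def patch_def)

definition tensor :: "(nat \<Rightarrow> nat \<Rightarrow> real) \<Rightarrow> real \<times> real \<Rightarrow> real" where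
  "tensor d x = (\<Sum>i<nb. \<Sum>j<nb. d i j * bspline2 t p i j x)"

text \<open>The coefficient of \<open>B i u\<close> when the tensor-product spline is read as a
  spline in u. Rows 0 and 1 carry all the data at the interface.\<close>

definition row :: "(nat \<Rightarrow> nat \<Rightarrow> real) \<Rightarrow> nat \<Rightarrow> real \<Rightarrow> real" where
  "row d i v = (\<Sum>j<nb. d i j * B j v)"

lemma tensor_eq_row: "tensor d (u, v) = (\<Sum>i<nb. row d i v * B i u)"
  unfolding tensor_def row_def sum_distrib_right by (intro sum.cong) (simp_all add: bspline2_def)

lemma tensor_outside: "x \<notin> unit_square \<Longrightarrow> tensor d x = 0"
proof -
  assume x: "x \<notin> unit_square"
  have "bspline2 t p i j x = 0" if "i < nb" "j < nb" for i j
  proof -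
    have "fst x \<notin> {0..1} \<or> snd x \<notin> {0..1}" using x by (cases x) (simp only: unit_square_def mem_Times_iff, blast)
    then have "B i (fst x) = 0 \<or> B j (snd x) = 0"
      using knots.bspline_outside[of "fst x" i p p r "{}"] knots.bspline_outside[of "snd x" j p p r "{}"] that
      by (elim disjE) simp_all
    then show ?thesis by (cases x) (auto simp: bspline2_def)
  qed
  then show ?thesis by (simp add: tensor_def)
qed

lemma sum_first_two:
  assumes "\<And>i. 2 \<le> i \<Longrightarrow> i < nb \<Longrightarrow> f i = (0::real)"
  shows "(\<Sum>i<nb. f i) = f 0 + f 1"
proof -
  have "(\<Sum>i<nb. f i) = (\<Sum>i\<in>{0, 1}. f i)"
    using assms nb_gt by (intro sum.mono_neutral_right) auto
  then show ?thesis by simp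
qed

lemma tensor_at_0: "tensor d (0, v) = row d 0 v"
proof -
  have "tensor d (0, v) = row d 0 v * B 0 0 + row d 1 v * B 1 0"
    unfolding tensor_eq_row using bspline_at_0[OF r(1) r_less] by (intro sum_first_two) simp
  then show ?thesis
    using bspline_at_0[OF r(1) r_less, of 1] first_bsplines_at_0(1)[OF r(1) r_less] nb_gt by simp
qed

text \<open>Only the first two B-splines have a derivative at 0, and theirs are opposite.\<close>

lemma D_u_tensor_at_0: "D_u (tensor d) (0, v) = p / first_span k \<tau> * (row d 1 v - row d 0 v)"
proof -
  have "((\<lambda>s. \<Sum>i<nb. row d i v * B i s) has_real_derivative (\<Sum>i<nb. row d i v * deriv01 (B i) 0)) (at 0 within {0..1})"
    by (intro DERIV_sum DERIV_cmult bspline_C1(1) r r_less) auto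
  then have "deriv01 (\<lambda>s. tensor d (s, v)) 0 = (\<Sum>i<nb. row d i v * deriv01 (B i) 0)"
    unfolding tensor_eq_row has_real_derivative_iff_has_vector_derivative by (rule deriv01_eqI) simp
  also have "\<dots> = row d 0 v * deriv01 (B 0) 0 + row d 1 v * deriv01 (B 1) 0"
    using deriv_bspline_at_0[OF r(1) r_less] by (intro sum_first_two) simp
  also have "\<dots> = p / first_span k \<tau> * (row d 1 v - row d 0 v)"
    unfolding first_bsplines_at_0[OF r(1) r_less] by (simp add: algebra_simps)
  finally show ?thesis by (simp add: D_u_def)
qed

lemma has_coeffs_iff: "has_coeffs p t F \<phi> d \<longleftrightarrow> (\<forall>S. \<forall>x\<in>unit_square. \<phi> (F S x) = tensor (d S) x)"
  by (simp add: has_coeffs_def tensor_def num_bsplines_knots)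

lemma space_V_iff:
  "\<phi> \<in> space_V p t F \<longleftrightarrow> (\<forall>x. x \<notin> domain F \<longrightarrow> \<phi> x = 0) \<and> (\<exists>d. has_coeffs p t F \<phi> d)"
proof -
  have "(\<forall>S. on_square (\<phi> \<circ> F S) \<in> spline_space2 p t) \<longleftrightarrow> (\<exists>d. has_coeffs p t F \<phi> d)"
  proof
    assume *: "\<forall>S. on_square (\<phi> \<circ> F S) \<in> spline_space2 p t"
    have "\<forall>S. \<exists>d. \<forall>x. on_square (\<phi> \<circ> F S) x = tensor d x"
    proof
      fix S
      obtain d where "\<forall>x. on_square (\<phi> \<circ> F S) x = (\<Sum>i<nb. \<Sum>j<nb. d i j * bspline2 t p i j x)"
        by (rule spline_space2E[OF spec[OF *, of S]]) (rule that)
      then show "\<exists>d. \<forall>x. on_square (\<phi> \<circ> F S) x = tensor d x" by (intro exI[of _ d]) (simp add: tensor_def)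
    qed
    from choice[OF this] obtain d where d: "\<forall>S x. on_square (\<phi> \<circ> F S) x = tensor (d S) x" by (rule exE)
    have "has_coeffs p t F \<phi> d"
      unfolding has_coeffs_iff
    proof (intro allI ballI)
      fix S x assume "x \<in> unit_square"
      then show "\<phi> (F S x) = tensor (d S) x" using spec[OF spec[OF d, of S], of x] by (simp add: on_square_def)
    qed
    then show "\<exists>d. has_coeffs p t F \<phi> d" by (rule exI[of _ d])
  next
    assume "\<exists>d. has_coeffs p t F \<phi> d"
    then obtain d where d: "has_coeffs p t F \<phi> d" by (rule exE)
    have "on_square (\<phi> \<circ> F S) = tensor (d S)" for S
    proof
      fix x show "on_square (\<phi> \<circ> F S) x = tensor (d S) x"
        using d tensor_outside[of x "d S"] by (simp add: has_coeffs_iff on_square_def)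
    qed
    moreover have "tensor d \<in> spline_space2 p t" for d
      unfolding tensor_def[abs_def] by (rule spline_space2I)
    ultimately show "\<forall>S. on_square (\<phi> \<circ> F S) \<in> spline_space2 p t" by simp
  qed
  then show ?thesis by (simp add: space_V_def)
qed

lemma space_V1_iff:
  assumes V: "\<phi> \<in> space_V p t F" and d: "has_coeffs p t F \<phi> d"
  shows "\<phi> \<in> space_V1 p t F \<longleftrightarrow> (\<forall>v\<in>{0..1}.
      poly (\<alpha> PR) v * (p / first_span k \<tau> * (row (d PL) 1 v - row (d PL) 0 v))
    - poly (\<alpha> PL) v * (p / first_span k \<tau> * (row (d PR) 1 v - row (d PR) 0 v))
    + poly \<beta> v * deriv01 (row (d PL) 0) v = 0)"
proof -
  have on: "on_square (\<phi> \<circ> F S) \<in> spline_space2 p t" for S using V by (simp add: space_V_def)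
  have Du: "D_u (\<phi> \<circ> F S) (0, v) = p / first_span k \<tau> * (row (d S) 1 v - row (d S) 0 v)"
    if "v \<in> {0..1}" for S v
  proof -
    have "D_u (\<phi> \<circ> F S) (0, v) = D_u (tensor (d S)) (0, v)"
      unfolding D_u_def prod.case
      by (rule deriv01_cong) (use d that in \<open>auto simp: has_coeffs_iff unit_square_def\<close>)
    then show ?thesis by (simp only: D_u_tensor_at_0)
  qed
  have Dv: "D_v (\<phi> \<circ> F PL) (0, v) = deriv01 (row (d PL) 0) v" if "v \<in> {0..1}" for v
    unfolding D_v_def prod.case
    by (rule deriv01_cong) (use d that in \<open>auto simp: has_coeffs_iff unit_square_def tensor_at_0\<close>)
  have "\<phi> \<in> space_V1 p t F \<longleftrightarrow> C1_on (domain F) \<phi>" using V by (simp add: space_V1_def)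
  also have "\<dots> \<longleftrightarrow> (\<forall>v\<in>{0..1}. poly (\<alpha> PR) v * D_u (\<phi> \<circ> F PL) (0, v)
    - poly (\<alpha> PL) v * D_u (\<phi> \<circ> F PR) (0, v) + poly \<beta> v * D_v (\<phi> \<circ> F PL) (0, v) = 0)"
    by (rule C1_on_domain_iff[OF on])
  finally show ?thesis using Du Dv by simp
qed

lemma row_continuity:
  assumes "has_coeffs p t F \<phi> d" "v \<in> {0..1}"
  shows "row (d PR) 0 v = row (d PL) 0 v"
proof -
  have "(0, v) \<in> unit_square" using assms(2) by (simp add: unit_square_def)
  then have "\<phi> (F S (0, v)) = row (d S) 0 v" for S
    using assms(1) by (simp add: has_coeffs_iff tensor_at_0)
  then show ?thesis using F_interface[OF assms(2)] by metis
qed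

text \<open>A common form for the three spaces: the first coefficient index is forced to vanish on
  \<open>A\<close>, which is {0, 1} for \<open>space_V11\<close>, all larger indices for
  \<open>space_V12\<close> and empty for \<open>space_V1\<close>.\<close>

definition coeff_subspace :: "nat set \<Rightarrow> (real \<times> real \<Rightarrow> real) set" where
  "coeff_subspace A = {\<phi> \<in> space_V1 p t F. \<exists>d. has_coeffs p t F \<phi> d \<and> (\<forall>S. \<forall>i\<in>A. \<forall>j<nb. d S i j = 0)}"

lemma space_V11_eq: "space_V11 p t F = coeff_subspace {0, 1}"
  by (simp add: space_V11_def coeff_subspace_def num_bsplines_knots)

lemma space_V12_eq: "space_V12 p t F = coeff_subspace {2..<nb}"
  by (simp add: space_V12_def coeff_subspace_def num_bsplines_knots)

lemma space_V1_eq: "space_V1 p t F = coeff_subspace {}"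
  unfolding coeff_subspace_def by (auto simp: space_V1_def space_V_iff)

lemma coeff_subspaceI:
  assumes "\<And>x. x \<notin> domain F \<Longrightarrow> \<phi> x = 0" "has_coeffs p t F \<phi> d" "C1_on (domain F) \<phi>"
    "\<And>S i j. i \<in> A \<Longrightarrow> j < nb \<Longrightarrow> d S i j = 0"
  shows "\<phi> \<in> coeff_subspace A"
  using assms unfolding coeff_subspace_def space_V1_def mem_Collect_eq space_V_iff by metis

lemma coeff_subspaceE:
  assumes "\<phi> \<in> coeff_subspace A"
  obtains d where "\<forall>x. x \<notin> domain F \<longrightarrow> \<phi> x = 0" "has_coeffs p t F \<phi> d" "C1_on (domain F) \<phi>"
    "\<forall>S. \<forall>i\<in>A. \<forall>j<nb. d S i j = 0"
  using assms unfolding coeff_subspace_def space_V1_def space_V_iff by blast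

lemma tensor_add: "tensor (\<lambda>i j. d i j + d' i j) x = tensor d x + tensor d' x"
  by (simp add: tensor_def distrib_right sum.distrib)

lemma tensor_scale: "tensor (\<lambda>i j. c * d i j) x = c * tensor d x"
  by (simp add: tensor_def sum_distrib_left mult.assoc)

lemma subspace_coeff_subspace: "fun_vs.subspace (coeff_subspace A)"
proof (rule fun_vs.subspaceI)
  show "0 \<in> coeff_subspace A"
  proof (rule coeff_subspaceI[where d = "\<lambda>_ _ _. 0"])
    have "C1_on (domain F) (\<lambda>_. 0)" by (rule C1_on_0)
    then show "C1_on (domain F) 0" by (simp add: zero_fun_def)
  qed (simp_all add: has_coeffs_iff tensor_def)
next
  fix \<phi> \<psi> assume \<phi>: "\<phi> \<in> coeff_subspace A" and \<psi>: "\<psi> \<in> coeff_subspace A"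
  obtain d where d: "\<forall>x. x \<notin> domain F \<longrightarrow> \<phi> x = 0" "has_coeffs p t F \<phi> d" "C1_on (domain F) \<phi>"
    "\<forall>S. \<forall>i\<in>A. \<forall>j<nb. d S i j = 0" by (rule coeff_subspaceE[OF \<phi>]) (rule that)
  obtain d' where d': "\<forall>x. x \<notin> domain F \<longrightarrow> \<psi> x = 0" "has_coeffs p t F \<psi> d'" "C1_on (domain F) \<psi>"
    "\<forall>S. \<forall>i\<in>A. \<forall>j<nb. d' S i j = 0" by (rule coeff_subspaceE[OF \<psi>]) (rule that)
  show "\<phi> + \<psi> \<in> coeff_subspace A"
  proof (rule coeff_subspaceI[where d = "\<lambda>S i j. d S i j + d' S i j"])
    show "C1_on (domain F) (\<phi> + \<psi>)" using C1_on_add[OF d(3) d'(3)] by (simp add: plus_fun_def)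
    show "(\<phi> + \<psi>) x = 0" if "x \<notin> domain F" for x
      using spec[OF d(1), of x] spec[OF d'(1), of x] that by simp
    show "has_coeffs p t F (\<phi> + \<psi>) (\<lambda>S i j. d S i j + d' S i j)"
      using d(2) d'(2) by (simp add: has_coeffs_iff tensor_add)
  qed (use d d' in simp)
next
  fix c \<phi> assume \<phi>: "\<phi> \<in> coeff_subspace A"
  obtain d where d: "\<forall>x. x \<notin> domain F \<longrightarrow> \<phi> x = 0" "has_coeffs p t F \<phi> d" "C1_on (domain F) \<phi>"
    "\<forall>S. \<forall>i\<in>A. \<forall>j<nb. d S i j = 0" by (rule coeff_subspaceE[OF \<phi>]) (rule that)
  show "fun_scale c \<phi> \<in> coeff_subspace A"
  proof (rule coeff_subspaceI[where d = "\<lambda>S i j. c * d S i j"])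
    show "C1_on (domain F) (fun_scale c \<phi>)" using C1_on_scale[OF d(3), of c] by (simp add: fun_scale_def)
    show "fun_scale c \<phi> x = 0" if "x \<notin> domain F" for x
      using spec[OF d(1), of x] that by (simp add: fun_scale_def)
    show "has_coeffs p t F (fun_scale c \<phi>) (\<lambda>S i j. c * d S i j)"
      using d(2) by (simp add: has_coeffs_iff tensor_scale fun_scale_def)
  qed (use d in simp)
qed

lemma trunc_poly_bspline_coeffs:
  assumes "J \<in> jump_space p (contact r {})"
  shows "\<exists>c. \<forall>x. trunc_poly J x = (\<Sum>j<nb. c j * B j x)"
proof -
  have "trunc_poly J \<in> spline_space p t"
    unfolding spline_space_eq[OF r(1) less_imp_le[OF r_less]] using assms by (rule imageI)
  then show ?thesis
    by (simp only: spline_space_def num_bsplines_knots in_span_family_iff[OF finite_lessThan])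
qed

lemma bspline_sum_trunc_poly: "\<exists>J\<in>jump_space p (contact r {}). \<forall>x. (\<Sum>j<nb. c j * B j x) = trunc_poly J x"
proof -
  have "\<exists>c'. \<forall>x. (\<Sum>j<nb. c j * B j x) = (\<Sum>j<nb. c' j * B j x)" by (rule exI[of _ c]) simp
  then have "(\<lambda>x. \<Sum>j<nb. c j * B j x) \<in> spline_space p t"
    by (simp only: spline_space_def num_bsplines_knots in_span_family_iff[OF finite_lessThan])
  then show ?thesis
    unfolding spline_space_eq[OF r(1) less_imp_le[OF r_less]] by (auto simp: fun_eq_iff)
qed

lemma contact_ge_2: "i \<in> {1..k} \<Longrightarrow> 2 \<le> contact r {} i"
  using r by (simp add: contact_def)

text \<open>The left side of the equation is itself a truncated polynomial, so it vanishes on [0,1]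
  exactly if each of its jumps does.\<close>

lemma interface_eq_iff:
  assumes G: "G \<in> jump_space p (contact r {})"
  shows "(\<forall>v\<in>{0..1}. poly (\<alpha> PR) v * trunc_poly (H PL) v - poly (\<alpha> PL) v * trunc_poly (H PR) v
      + poly \<beta> v * deriv01 (trunc_poly G) v = 0)
    \<longleftrightarrow> (\<forall>l\<le>k. \<alpha> PR * H PL l - \<alpha> PL * H PR l + \<beta> * pderiv (G l) = 0)"
proof -
  let ?J = "\<lambda>l. \<alpha> PR * H PL l - \<alpha> PL * H PR l + \<beta> * pderiv (G l)"
  have "poly (\<alpha> PR) v * trunc_poly (H PL) v - poly (\<alpha> PL) v * trunc_poly (H PR) v
      + poly \<beta> v * deriv01 (trunc_poly G) v = trunc_poly ?J v" if "v \<in> {0..1}" for v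
  proof -
    have "deriv01 (trunc_poly G) v = trunc_poly (\<lambda>i. pderiv (G i)) v"
      by (rule deriv01_trunc_poly[OF G contact_ge_2 that])
    then show ?thesis by (simp only: trunc_poly_add trunc_poly_diff trunc_poly_mult)
  qed
  moreover have "(\<forall>v\<in>{0..1}. trunc_poly ?J v = 0) \<longleftrightarrow> (\<forall>l\<le>k. ?J l = 0)"
  proof
    assume "\<forall>v\<in>{0..1}. trunc_poly ?J v = 0"
    then show "\<forall>l\<le>k. ?J l = 0" using trunc_poly_eq_0_imp[of ?J] by simp
  next
    assume "\<forall>l\<le>k. ?J l = 0"
    then have "trunc_poly ?J = trunc_poly (\<lambda>_. 0)" by (intro trunc_poly_cong) simp
    then show "\<forall>v\<in>{0..1}. trunc_poly ?J v = 0" by (simp add: trunc_poly_0)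
  qed
  ultimately show ?thesis by simp
qed

text \<open>Trace and normal functions share this form, with \<open>G\<close> as jumps of the trace
  and \<open>H S\<close> as jumps of D_u at u = 0; membership reduces to smoothness of the jumps and
  the equation between them.\<close>

lemma interface_function_in_V12:
  assumes out: "\<And>x. x \<notin> domain F \<Longrightarrow> \<phi> x = 0"
    and G: "G \<in> jump_space p (contact r {})" and H: "\<And>S. H S \<in> jump_space p (contact r {})"
    and eq: "\<And>l. l \<le> k \<Longrightarrow> \<alpha> PR * H PL l - \<alpha> PL * H PR l + \<beta> * pderiv (G l) = 0"
    and \<phi>: "\<And>S u v. u \<in> {0..1} \<Longrightarrow> v \<in> {0..1} \<Longrightarrow> \<phi> (F S (u, v)) =
      trunc_poly G v * (B 0 u + B 1 u) + first_span k \<tau> / p * trunc_poly (H S) v * B 1 u"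
  shows "\<phi> \<in> coeff_subspace {2..<nb}"
proof -
  from trunc_poly_bspline_coeffs[OF G] obtain x where x: "\<forall>v. trunc_poly G v = (\<Sum>j<nb. x j * B j v)" by (rule exE)
  have "\<forall>S. \<exists>y. \<forall>v. trunc_poly (H S) v = (\<Sum>j<nb. y j * B j v)" using trunc_poly_bspline_coeffs[OF H] by simp
  from choice[OF this] obtain y where y: "\<forall>S v. trunc_poly (H S) v = (\<Sum>j<nb. y S j * B j v)" by (rule exE)
  \<comment> \<open>Row 1 minus row 0 is \<open>first_span k \<tau> / p\<close> times the normal
    derivative, by the formula for D_u at 0.\<close>
  define d where "d S i j = (if i = 0 then x j else if i = 1 then x j + first_span k \<tau> / p * y S j else 0)" for S and i j :: nat
  have row0: "row (d S) 0 v = trunc_poly G v" for S v using x by (simp add: row_def d_def)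
  have row1: "row (d S) 1 v = trunc_poly G v + first_span k \<tau> / p * trunc_poly (H S) v" for S v
    using x y by (simp add: row_def d_def distrib_right sum.distrib sum_distrib_left mult.assoc)
  have row2: "row (d S) i v = 0" if "2 \<le> i" for S i v using that by (simp add: row_def d_def)
  have coeffs: "has_coeffs p t F \<phi> d"
    unfolding has_coeffs_iff
  proof (intro allI ballI)
    fix S and w :: "real \<times> real" assume "w \<in> unit_square"
    then obtain u v where w: "w = (u, v)" "u \<in> {0..1}" "v \<in> {0..1}" by (auto simp: unit_square_def)
    have "tensor (d S) w = row (d S) 0 v * B 0 u + row (d S) 1 v * B 1 u"
      unfolding w tensor_eq_row using row2 by (intro sum_first_two) simp
    then show "\<phi> (F S w) = tensor (d S) w" unfolding row0 row1 w(1) \<phi>[OF w(2,3)] by (simp add: algebra_simps)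
  qed
  have V: "\<phi> \<in> space_V p t F" unfolding space_V_iff using out coeffs by blast
  have HH: "p / first_span k \<tau> * (row (d S) 1 v - row (d S) 0 v) = trunc_poly (H S) v" for S v
    unfolding row0 row1 using first_span_pos r by simp
  have row0': "row (d PL) 0 = trunc_poly G" by (rule ext) (rule row0)
  have "\<phi> \<in> space_V1 p t F"
    unfolding space_V1_iff[OF V coeffs] HH unfolding row0'
    using iffD2[OF interface_eq_iff[OF G, of H]] eq by blast
  then show ?thesis
    using out coeffs by (intro coeff_subspaceI[of _ d]) (auto simp: space_V1_def d_def)
qed

end

section \<open>The basis\<close>

locale trace_basis = trace_system k \<tau> p r F \<alpha> \<beta> b n m e J Jb c
  for k \<tau> p r F \<alpha> \<beta> b n m e J Jb c +
  fixes N g :: "nat \<Rightarrow> real \<Rightarrow> real"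
  assumes N: "\<And>i v. i < n \<Longrightarrow> v \<in> {0..1} \<Longrightarrow> N i v = trunc_poly (J i) v"
    and g: "\<And>i v. i < n \<Longrightarrow> v \<in> {0..1} \<Longrightarrow> g i v = c i * trunc_poly (\<lambda>l. pderiv (J i l)) v"
begin

text \<open>The quotient of the factor $1/((k+1)p)$ in \<^const>\<open>phi_normal\<close> and the factor
  \<open>first_span k \<tau> / p\<close> in \<^const>\<open>phi_trace\<close>.\<close>

definition \<kappa> :: real where "\<kappa> = 1 / ((real k + 1) * first_span k \<tau>)"

lemma kappa_nonzero: "\<kappa> \<noteq> 0"
  using first_span_pos by (simp add: \<kappa>_def)

abbreviation \<Phi> where "\<Phi> \<equiv> phi k \<tau> p r F \<alpha> b N g"

lemma unit_squareE:
  assumes "x \<in> unit_square"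
  obtains u v where "x = (u, v)" "u \<in> {0..1}" "v \<in> {0..1}"
  using assms by (auto simp: unit_square_def)

lemma B_at_0: "1 \<le> i \<Longrightarrow> i < nb \<Longrightarrow> B i 0 = 0"
  by (rule bspline_at_0[OF r(1) r_less])

lemma B_1_at_0: "B 1 0 = 0"
  using B_at_0[of 1] nb_gt by simp

lemma phi_outside: "x \<notin> domain F \<Longrightarrow> \<Phi> \<iota> x = 0"
  by (cases \<iota>) (simp_all add: phi_patch_def phi_trace_def phi_normal_def from_pair_outside)

lemma phi_patch_pullback:
  assumes "2 \<le> i" "i < nb" "x \<in> unit_square"
  shows "\<Phi> (Patch S' i j) (F S x) = (if S = S' then bspline2 t p i j x else 0)"
  unfolding phi.simps phi_patch_def
  by (subst from_pair_pullback[OF _ assms(3)]) (use B_at_0[of i] assms in \<open>auto simp: bspline2_def\<close>)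

lemma phi_trace_pullback:
  assumes i: "i < n" and uv: "u \<in> {0..1}" "v \<in> {0..1}"
  shows "\<Phi> (Trace i) (F S (u, v)) =
    trunc_poly (J i) v * (B 0 u + B 1 u) + first_span k \<tau> / p * trunc_poly (MT S i) v * B 1 u"
proof -
  have "deriv01 (N i) v = deriv01 (trunc_poly (J i)) v"
    by (rule deriv01_cong) (use N[OF i] uv in auto)
  also have "\<dots> = trunc_poly (\<lambda>l. pderiv (J i l)) v"
    by (rule deriv01_trunc_poly[OF J_smooth[OF i] contact_ge_2 uv(2)])
  finally have d: "deriv01 (N i) v = trunc_poly (\<lambda>l. pderiv (J i l)) v" .
  have uv': "(u, v) \<in> unit_square" using uv by (simp add: unit_square_def)
  have "trunc_poly (MT S i) v = (poly (\<alpha> S) v * c i + poly (b S) v) * trunc_poly (\<lambda>l. pderiv (J i l)) v"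
    unfolding MT_def[abs_def] trunc_poly_mult by (simp add: mult.commute)
  then have M: "poly (\<alpha> S) v * g i v + poly (b S) v * deriv01 (N i) v = trunc_poly (MT S i) v"
    unfolding d g[OF i uv(2)] by (simp add: algebra_simps)
  have "\<Phi> (Trace i) (F S (u, v)) = N i v * (B 0 u + B 1 u)
      + (poly (\<alpha> S) v * g i v + poly (b S) v * deriv01 (N i) v) * (first_span k \<tau> / p) * B 1 u"
    unfolding phi.simps phi_trace_def
    by (subst from_pair_pullback[OF _ uv']) (use B_1_at_0 in auto)
  then show ?thesis unfolding M N[OF i uv(2)] by (simp add: algebra_simps)
qed

lemma phi_normal_pullback:
  assumes j: "j < m" and uv: "u \<in> {0..1}" "v \<in> {0..1}"
  shows "\<Phi> (Normal j) (F S (u, v)) = first_span k \<tau> / p * (\<kappa> * trunc_poly (MN S j) v) * B 1 u"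
proof -
  have uv': "(u, v) \<in> unit_square" using uv by (simp add: unit_square_def)
  have M: "trunc_poly (MN S j) v = poly (\<alpha> S) v * bspline (knots k \<tau> (p - d_alpha \<alpha>) r {}) (p - d_alpha \<alpha>) j v"
    unfolding MN_def[abs_def] trunc_poly_mult Jb(2)[OF j] ..
  have "\<Phi> (Normal j) (F S (u, v)) = 1 / ((real k + 1) * real p) * poly (\<alpha> S) v
      * bspline (knots k \<tau> (p - d_alpha \<alpha>) r {}) (p - d_alpha \<alpha>) j v * B 1 u"
    unfolding phi.simps phi_normal_def
    by (subst from_pair_pullback[OF _ uv']) (use B_1_at_0 in auto)
  also have "\<dots> = first_span k \<tau> / p * (\<kappa> * trunc_poly (MN S j) v) * B 1 u"
    unfolding M using first_span_pos r by (simp add: \<kappa>_def)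
  finally show ?thesis .
qed

lemma patch_indices_eq:
  "patch_indices k p r = (\<lambda>(S, i, j). Patch S i j) ` (UNIV \<times> {2..<nb} \<times> {..<nb})"
  unfolding patch_indices_def spline_count_uniform by force

lemma UNIV_side: "UNIV = {PL, PR}"
  using side.exhaust by auto

lemma finite_indices: "finite (patch_indices k p r)" "finite (interface_indices n m)"
  unfolding patch_indices_eq interface_indices_def by (auto simp: UNIV_side)

lemma indices_disjoint: "patch_indices k p r \<inter> interface_indices n m = {}"
  by (auto simp: patch_indices_def interface_indices_def)

lemma sum_patch_indices:
  assumes "x \<in> unit_square"
  shows "(\<Sum>\<iota>\<in>patch_indices k p r. cc \<iota> * \<Phi> \<iota> (F S x))
    = (\<Sum>i\<in>{2..<nb}. \<Sum>j<nb. cc (Patch S i j) * bspline2 t p i j x)"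
proof -
  have inj: "inj_on (\<lambda>(S, i, j). Patch S i j) (UNIV \<times> {2..<nb} \<times> {..<nb})" by (auto simp: inj_on_def)
  have "(\<Sum>\<iota>\<in>patch_indices k p r. cc \<iota> * \<Phi> \<iota> (F S x))
    = (\<Sum>(S', i, j)\<in>UNIV \<times> {2..<nb} \<times> {..<nb}. cc (Patch S' i j) * \<Phi> (Patch S' i j) (F S x))"
    unfolding patch_indices_eq by (subst sum.reindex[OF inj]) (simp add: case_prod_beta' o_def del: phi.simps)
  also have "\<dots> = (\<Sum>S'\<in>UNIV. \<Sum>i\<in>{2..<nb}. \<Sum>j<nb. cc (Patch S' i j) * \<Phi> (Patch S' i j) (F S x))"
    by (simp add: sum.cartesian_product del: phi.simps)
  also have "\<dots> = (\<Sum>S'\<in>UNIV. if S' = S then \<Sum>i\<in>{2..<nb}. \<Sum>j<nb. cc (Patch S i j) * bspline2 t p i j x else 0)"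
    using phi_patch_pullback[where S = S, OF _ _ assms] by (intro sum.cong) (auto simp del: phi.simps)
  also have "\<dots> = (\<Sum>i\<in>{2..<nb}. \<Sum>j<nb. cc (Patch S i j) * bspline2 t p i j x)"
    by (cases S) (simp_all add: UNIV_side)
  finally show ?thesis .
qed

definition trace_jumps :: "(basis_index \<Rightarrow> real) \<Rightarrow> nat \<Rightarrow> real poly" where
  "trace_jumps cc l = (\<Sum>i<n. smult (cc (Trace i)) (J i l))"

text \<open>Jumps of D_u at u = 0 on side \<open>S\<close> for the combination with coefficients
  \<open>cc\<close>; \<kappa> accounts for the other scaling of \<open>phi_normal\<close>.\<close>

definition normal_jumps :: "(basis_index \<Rightarrow> real) \<Rightarrow> side \<Rightarrow> nat \<Rightarrow> real poly" where
  "normal_jumps cc S l = (\<Sum>i<n. smult (cc (Trace i)) (MT S i l)) + (\<Sum>j<m. smult (\<kappa> * cc (Normal j)) (MN S j l))"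

lemma sum_interface_indices:
  assumes uv: "u \<in> {0..1}" "v \<in> {0..1}"
  shows "(\<Sum>\<iota>\<in>interface_indices n m. cc \<iota> * \<Phi> \<iota> (F S (u, v)))
    = trunc_poly (trace_jumps cc) v * (B 0 u + B 1 u) + first_span k \<tau> / p * trunc_poly (normal_jumps cc S) v * B 1 u"
proof -
  have disj: "Trace ` {..<n} \<inter> Normal ` {..<m} = {}" by auto
  have "(\<Sum>\<iota>\<in>interface_indices n m. cc \<iota> * \<Phi> \<iota> (F S (u, v)))
    = (\<Sum>i<n. cc (Trace i) * \<Phi> (Trace i) (F S (u, v))) + (\<Sum>j<m. cc (Normal j) * \<Phi> (Normal j) (F S (u, v)))"
    unfolding interface_indices_def
    by (simp add: sum.union_disjoint[OF _ _ disj] sum.reindex inj_on_def o_def del: phi.simps)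
  also have "(\<Sum>i<n. cc (Trace i) * \<Phi> (Trace i) (F S (u, v)))
    = (\<Sum>i<n. cc (Trace i) * trunc_poly (J i) v * (B 0 u + B 1 u)
        + cc (Trace i) * trunc_poly (MT S i) v * (first_span k \<tau> / p * B 1 u))"
    using phi_trace_pullback[OF _ uv] by (intro sum.cong) (simp_all add: algebra_simps del: phi.simps)
  also have "\<dots> = (\<Sum>i<n. cc (Trace i) * trunc_poly (J i) v) * (B 0 u + B 1 u)
      + (\<Sum>i<n. cc (Trace i) * trunc_poly (MT S i) v) * (first_span k \<tau> / p * B 1 u)"
    by (simp only: sum.distrib sum_distrib_right)
  also have "(\<Sum>j<m. cc (Normal j) * \<Phi> (Normal j) (F S (u, v)))
    = (\<Sum>j<m. \<kappa> * cc (Normal j) * trunc_poly (MN S j) v) * (first_span k \<tau> / p * B 1 u)"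
    using phi_normal_pullback[OF _ uv] unfolding sum_distrib_right
    by (intro sum.cong) (simp_all add: algebra_simps del: phi.simps)
  finally show ?thesis
    unfolding trunc_poly_sum trace_jumps_def[abs_def] normal_jumps_def[abs_def] trunc_poly_add
    by (simp add: algebra_simps)
qed

text \<open>Written as a spline in u with coefficients depending on v, so that independence of the
  B-splines in u applies for each fixed v.\<close>

lemma sum_all_indices:
  assumes uv: "u \<in> {0..1}" "v \<in> {0..1}"
  shows "(\<Sum>\<iota>\<in>patch_indices k p r \<union> interface_indices n m. cc \<iota> * \<Phi> \<iota> (F S (u, v)))
    = (\<Sum>i<nb. (if i = 0 then trunc_poly (trace_jumps cc) v
        else if i = 1 then trunc_poly (trace_jumps cc) v + first_span k \<tau> / p * trunc_poly (normal_jumps cc S) v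
        else \<Sum>j<nb. cc (Patch S i j) * B j v) * B i u)"
proof -
  let ?f = "\<lambda>i. (if i = 0 then trunc_poly (trace_jumps cc) v
        else if i = 1 then trunc_poly (trace_jumps cc) v + first_span k \<tau> / p * trunc_poly (normal_jumps cc S) v
        else \<Sum>j<nb. cc (Patch S i j) * B j v) * B i u"
  have uv': "(u, v) \<in> unit_square" using uv by (simp add: unit_square_def)
  have "{..<nb} = {0, 1} \<union> {2..<nb}" using nb_gt by auto
  then have "(\<Sum>i<nb. ?f i) = (\<Sum>i\<in>{0, 1} \<union> {2..<nb}. ?f i)" by (rule arg_cong)
  also have "\<dots> = (\<Sum>i\<in>{0, 1}. ?f i) + (\<Sum>i\<in>{2..<nb}. ?f i)"
    by (rule sum.union_disjoint) auto
  also have "(\<Sum>i\<in>{2..<nb}. ?f i) = (\<Sum>i\<in>{2..<nb}. \<Sum>j<nb. cc (Patch S i j) * bspline2 t p i j (u, v))"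
    by (intro sum.cong) (auto simp: bspline2_def sum_distrib_left mult_ac)
  also have "(\<Sum>i\<in>{0, 1}. ?f i) = trunc_poly (trace_jumps cc) v * (B 0 u + B 1 u)
      + first_span k \<tau> / p * trunc_poly (normal_jumps cc S) v * B 1 u"
    by (simp add: algebra_simps)
  finally show ?thesis
    unfolding sum.union_disjoint[OF finite_indices indices_disjoint] sum_patch_indices[OF uv'] sum_interface_indices[OF uv]
    by simp
qed

text \<open>For fixed v the B-splines in u isolate the rows. Rows from 2 on give the patch
  coefficients by independence in v; rows 0 and 1 give the trace and the normal derivative, where
  \<open>interface_independence\<close> applies.\<close>

lemma indep_phi: "indep_fam (patch_indices k p r \<union> interface_indices n m) \<Phi>"
  unfolding indep_fam_def
proof (intro allI impI ballI)
  fix cc \<iota> assume zero: "\<forall>x. (\<Sum>\<iota>\<in>patch_indices k p r \<union> interface_indices n m. cc \<iota> * \<Phi> \<iota> x) = 0"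
    and \<iota>: "\<iota> \<in> patch_indices k p r \<union> interface_indices n m"
  have coeff: "(if i = 0 then trunc_poly (trace_jumps cc) v
        else if i = 1 then trunc_poly (trace_jumps cc) v + first_span k \<tau> / p * trunc_poly (normal_jumps cc S) v
        else \<Sum>j<nb. cc (Patch S i j) * B j v) = 0" if v: "v \<in> {0..1}" and i: "i < nb" for v i S
  proof (rule bspline_indep_on[OF _ i])
    fix u :: real assume u: "u \<in> {0..1}"
    show "(\<Sum>i<nb. (if i = 0 then trunc_poly (trace_jumps cc) v
        else if i = 1 then trunc_poly (trace_jumps cc) v + first_span k \<tau> / p * trunc_poly (normal_jumps cc S) v
        else \<Sum>j<nb. cc (Patch S i j) * B j v) * B i u) = 0"
      using spec[OF zero, of "F S (u, v)"] unfolding sum_all_indices[OF u v] .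
  qed
  have tr: "trunc_poly (trace_jumps cc) v = 0" if "v \<in> {0..1}" for v
    using coeff[OF that, of 0] nb_gt by simp
  have no: "trunc_poly (normal_jumps cc S) v = 0" if "v \<in> {0..1}" for v S
    using coeff[OF that, of 1 S] tr[OF that] nb_gt first_span_pos r by simp
  have T0: "(\<Sum>i<n. smult (cc (Trace i)) (J i l)) = 0" if "l \<le> k" for l
    using trunc_poly_eq_0_imp[OF tr that] unfolding trace_jumps_def .
  have N0: "(\<Sum>i<n. smult (cc (Trace i)) (MT PL i l)) + (\<Sum>j<m. smult (\<kappa> * cc (Normal j)) (MN PL j l)) = 0"
    if "l \<le> k" for l
    using trunc_poly_eq_0_imp[OF no[of _ PL] that] unfolding normal_jumps_def .
  show "cc \<iota> = 0"
  proof (cases \<iota>)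
    case (Patch S i j)
    then have ij: "2 \<le> i" "i < nb" "j < nb" using \<iota> by (auto simp: patch_indices_eq interface_indices_def)
    have "(\<Sum>j<nb. cc (Patch S i j) * B j v) = 0" if "v \<in> {0..1}" for v
      using coeff[OF that ij(2), of S] ij(1) by simp
    from bspline_indep_on[OF this ij(3)] show ?thesis by (simp add: Patch)
  next
    case (Trace i)
    then have "i < n" using \<iota> by (auto simp: patch_indices_eq interface_indices_def)
    then show ?thesis using interface_independence(1)[of "\<lambda>i. cc (Trace i)" "\<lambda>j. \<kappa> * cc (Normal j)"] T0 N0 Trace by simp
  next
    case (Normal j)
    then have "j < m" using \<iota> by (auto simp: patch_indices_eq interface_indices_def)
    then have "\<kappa> * cc (Normal j) = 0"
      using interface_independence(2)[of "\<lambda>i. cc (Trace i)" "\<lambda>j. \<kappa> * cc (Normal j)"] T0 N0 by simp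
    then show ?thesis using kappa_nonzero Normal by simp
  qed
qed

lemma phi_patch_in_V11:
  assumes "\<iota> \<in> patch_indices k p r"
  shows "\<Phi> \<iota> \<in> coeff_subspace {0, 1}"
proof -
  obtain S i j where \<iota>: "\<iota> = Patch S i j" "2 \<le> i" "i < nb" "j < nb"
    using assms by (auto simp: patch_indices_eq)
  define d where "d S' i' j' = (if S' = S \<and> i' = i \<and> j' = j then 1 else 0 :: real)" for S' i' j'
  have coeffs: "has_coeffs p t F (\<Phi> \<iota>) d"
    unfolding has_coeffs_iff
  proof (intro allI ballI)
    fix S' x assume x: "x \<in> unit_square"
    have "tensor (d S') x = (\<Sum>i'<nb. if i' = i then (if S' = S then bspline2 t p i j x else 0) else 0)"
      unfolding tensor_def
    proof (rule sum.cong)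
      fix i'
      have "(\<Sum>j'<nb. d S' i' j' * bspline2 t p i' j' x)
        = (\<Sum>j'<nb. if j' = j then (if i' = i \<and> S' = S then bspline2 t p i j x else 0) else 0)"
        by (intro sum.cong) (auto simp: d_def)
      then show "(\<Sum>j'<nb. d S' i' j' * bspline2 t p i' j' x)
        = (if i' = i then (if S' = S then bspline2 t p i j x else 0) else 0)" using \<iota>(4) by simp
    qed simp
    then show "\<Phi> \<iota> (F S' x) = tensor (d S') x"
      unfolding \<iota>(1) phi_patch_pullback[OF \<iota>(2,3) x] using \<iota>(3) by simp
  qed
  have V: "\<Phi> \<iota> \<in> space_V p t F" unfolding space_V_iff using coeffs phi_outside by blast
  have rows: "row (d S') 0 = (\<lambda>_. 0)" "row (d S') 1 = (\<lambda>_. 0)" for S'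
    using \<iota>(2) by (auto simp: row_def d_def)
  have "deriv01 (\<lambda>_. 0 :: real) v = 0" if "v \<in> {0..1}" for v
    by (rule deriv01_eqI[OF has_vector_derivative_const that])
  then have "\<Phi> \<iota> \<in> space_V1 p t F"
    unfolding space_V1_iff[OF V coeffs] rows by simp
  then have C1: "C1_on (domain F) (\<Phi> \<iota>)" by (simp add: space_V1_def)
  show ?thesis
    by (rule coeff_subspaceI[OF phi_outside coeffs C1]) (use \<iota>(2) in \<open>auto simp: d_def\<close>)
qed

lemma phi_interface_in_V12:
  assumes "\<iota> \<in> interface_indices n m"
  shows "\<Phi> \<iota> \<in> coeff_subspace {2..<nb}"
proof -
  consider i where "\<iota> = Trace i" "i < n" | j where "\<iota> = Normal j" "j < m"
    using assms by (auto simp: interface_indices_def)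
  then show ?thesis
  proof cases
    case 1
    show ?thesis unfolding 1(1)
      by (rule interface_function_in_V12[OF phi_outside J_smooth[OF 1(2)] MT_smooth[OF 1(2)] MT_interface
          phi_trace_pullback[OF 1(2)]])
  next
    case 2
    \<comment> \<open>The scalar is written as a constant polynomial so that
      \<open>trunc_poly_mult\<close> applies.\<close>
    define H where "H S = (\<lambda>l. [:\<kappa>:] * MN S j l)" for S
    show ?thesis unfolding 2(1)
    proof (rule interface_function_in_V12[OF phi_outside, where G = "\<lambda>_. 0" and H = H])
      show "(\<lambda>_. 0) \<in> jump_space p (contact r {})" by (simp add: jump_space_def)
      show "H S \<in> jump_space p (contact r {})" for S
        using MN_smooth[OF 2(2), of S] kappa_nonzero by (auto simp: jump_space_def H_def intro: dvd_smult)
      show "\<alpha> PR * H PL l - \<alpha> PL * H PR l + \<beta> * pderiv 0 = 0" for l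
      proof -
        have "\<alpha> PR * H PL l - \<alpha> PL * H PR l = [:\<kappa>:] * (\<alpha> PR * MN PL j l - \<alpha> PL * MN PR j l)"
          unfolding H_def by (simp only: right_diff_distrib mult.left_commute)
        then show ?thesis unfolding MN_interface by simp
      qed
      show "\<Phi> (Normal j) (F S (u, v)) = trunc_poly (\<lambda>_. 0) v * (B 0 u + B 1 u)
          + first_span k \<tau> / p * trunc_poly (H S) v * B 1 u" if "u \<in> {0..1}" "v \<in> {0..1}" for S u v
        unfolding phi_normal_pullback[OF 2(2) that] H_def trunc_poly_mult trunc_poly_0 by simp
    qed
  qed
qed

text \<open>One expansion serves all three spaces. The patch coefficients are copied from those of
  \<phi>, so they vanish with them; and if rows 0 and 1 vanish, so do the jumps of trace and normal
  derivative, and with them the interface coefficients.\<close>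

lemma phi_span:
  assumes \<phi>: "\<phi> \<in> coeff_subspace A"
  obtains cc where
    "\<forall>x. \<phi> x = (\<Sum>\<iota>\<in>patch_indices k p r \<union> interface_indices n m. cc \<iota> * \<Phi> \<iota> x)"
    "\<And>S i j. i \<in> A \<Longrightarrow> i < nb \<Longrightarrow> j < nb \<Longrightarrow> cc (Patch S i j) = 0"
    "{0, 1} \<subseteq> A \<Longrightarrow> \<forall>\<iota>\<in>interface_indices n m. cc \<iota> = 0"
proof -
  obtain d where out: "\<forall>x. x \<notin> domain F \<longrightarrow> \<phi> x = 0" and coeffs: "has_coeffs p t F \<phi> d" and C1: "C1_on (domain F) \<phi>"
    and dA: "\<forall>S. \<forall>i\<in>A. \<forall>j<nb. d S i j = 0" by (rule coeff_subspaceE[OF \<phi>]) (rule that)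
  have V: "\<phi> \<in> space_V p t F" unfolding space_V_iff using out coeffs by blast
  have V1: "\<phi> \<in> space_V1 p t F" using V C1 by (simp add: space_V1_def)
  obtain G where G: "G \<in> jump_space p (contact r {})" "\<forall>v. row (d PL) 0 v = trunc_poly G v"
    using bspline_sum_trunc_poly[of "d PL 0"] unfolding row_def by (rule bexE)
  have "\<forall>S. \<exists>H. H \<in> jump_space p (contact r {}) \<and> (\<forall>v. p / first_span k \<tau> * (row (d S) 1 v - row (d S) 0 v) = trunc_poly H v)"
  proof
    fix S
    have "p / first_span k \<tau> * (row (d S) 1 v - row (d S) 0 v)
      = (\<Sum>j<nb. (p / first_span k \<tau> * (d S 1 j - d S 0 j)) * B j v)" for v
      unfolding row_def sum_subtractf[symmetric] sum_distrib_left by (intro sum.cong) (simp_all add: algebra_simps)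
    then show "\<exists>H. H \<in> jump_space p (contact r {}) \<and> (\<forall>v. p / first_span k \<tau> * (row (d S) 1 v - row (d S) 0 v) = trunc_poly H v)"
      using bspline_sum_trunc_poly[of "\<lambda>j. p / first_span k \<tau> * (d S 1 j - d S 0 j)"] by auto
  qed
  from choice[OF this] obtain H where H: "\<forall>S. H S \<in> jump_space p (contact r {}) \<and>
    (\<forall>v. p / first_span k \<tau> * (row (d S) 1 v - row (d S) 0 v) = trunc_poly (H S) v)" by (rule exE)
  have row0': "row (d PL) 0 = trunc_poly G" by (rule ext) (rule spec[OF G(2)])
  have H1: "H S \<in> jump_space p (contact r {})" for S using H by simp
  have H2: "p / first_span k \<tau> * (row (d S) 1 v - row (d S) 0 v) = trunc_poly (H S) v" for S v
    using spec[OF H, of S] by (elim conjE allE)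
  have eq: "\<alpha> PR * H PL l - \<alpha> PL * H PR l + \<beta> * pderiv (G l) = 0" if "l \<le> k" for l
    using V1 iffD1[OF interface_eq_iff[OF G(1), of H]] that
    unfolding space_V1_iff[OF V coeffs] H2 unfolding row0' by blast
  from interface_decomposition[of G H, OF G(1) H1 eq] obtain a where
    "\<exists>a'. \<forall>l\<le>k. G l = (\<Sum>i<n. smult (a i) (J i l)) \<and>
    (\<forall>S. H S l = (\<Sum>i<n. smult (a i) (MT S i l)) + (\<Sum>j<m. smult (a' j) (MN S j l)))" by (rule exE)
  then obtain a' where a: "\<forall>l\<le>k. G l = (\<Sum>i<n. smult (a i) (J i l)) \<and>
    (\<forall>S. H S l = (\<Sum>i<n. smult (a i) (MT S i l)) + (\<Sum>j<m. smult (a' j) (MN S j l)))" by (rule exE)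
  \<comment> \<open>The division by \<kappa> undoes the scaling of the normal functions.\<close>
  define cc where "cc \<iota> = (case \<iota> of Patch S i j \<Rightarrow> d S i j | Trace i \<Rightarrow> a i | Normal j \<Rightarrow> a' j / \<kappa>)" for \<iota>
  have TG: "trunc_poly (trace_jumps cc) = trunc_poly G"
    by (rule trunc_poly_cong) (use a in \<open>simp add: trace_jumps_def cc_def\<close>)
  have NH: "trunc_poly (normal_jumps cc S) = trunc_poly (H S)" for S
    by (rule trunc_poly_cong) (use a kappa_nonzero in \<open>simp add: normal_jumps_def cc_def\<close>)
  have all: "\<phi> x = (\<Sum>\<iota>\<in>patch_indices k p r \<union> interface_indices n m. cc \<iota> * \<Phi> \<iota> x)" for x
  proof (rule domain_pullback_eqI)
    show "\<phi> x = (\<Sum>\<iota>\<in>patch_indices k p r \<union> interface_indices n m. cc \<iota> * \<Phi> \<iota> x)" if "x \<notin> domain F" for x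
      using spec[OF out, of x] phi_outside[OF that] that by simp
    fix S x assume x: "x \<in> unit_square"
    then obtain u v where uv: "x = (u, v)" "u \<in> {0..1}" "v \<in> {0..1}" by (rule unit_squareE)
    have r0: "row (d S) 0 v = trunc_poly G v"
      using row_continuity[OF coeffs uv(3)] row0' by (cases S) simp_all
    have "row (d S) 1 v = row (d S) 0 v + first_span k \<tau> / p * (p / first_span k \<tau> * (row (d S) 1 v - row (d S) 0 v))"
      using first_span_pos r by simp
    then have r1: "row (d S) 1 v = trunc_poly G v + first_span k \<tau> / p * trunc_poly (H S) v"
      unfolding H2 unfolding r0 .
    have "\<phi> (F S x) = tensor (d S) x" using coeffs x by (simp add: has_coeffs_iff)
    also have "\<dots> = (\<Sum>i<nb. row (d S) i v * B i u)" unfolding uv(1) by (rule tensor_eq_row)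
    also have "\<dots> = (\<Sum>i<nb. (if i = 0 then trunc_poly (trace_jumps cc) v
        else if i = 1 then trunc_poly (trace_jumps cc) v + first_span k \<tau> / p * trunc_poly (normal_jumps cc S) v
        else \<Sum>j<nb. cc (Patch S i j) * B j v) * B i u)"
    proof (rule sum.cong)
      fix i
      show "row (d S) i v * B i u = (if i = 0 then trunc_poly (trace_jumps cc) v
        else if i = 1 then trunc_poly (trace_jumps cc) v + first_span k \<tau> / p * trunc_poly (normal_jumps cc S) v
        else \<Sum>j<nb. cc (Patch S i j) * B j v) * B i u"
      proof -
        consider "i = 0" | "i = 1" | "i \<noteq> 0" "i \<noteq> 1" by blast
        then show ?thesis
        proof cases
          case 1 then show ?thesis unfolding TG using r0 by simp
        next
          case 2 then show ?thesis unfolding TG NH using r1 by simp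
        next
          case 3 then show ?thesis by (simp add: cc_def row_def)
        qed
      qed
    qed simp
    also have "\<dots> = (\<Sum>\<iota>\<in>patch_indices k p r \<union> interface_indices n m. cc \<iota> * \<Phi> \<iota> (F S x))"
      unfolding uv(1) by (rule sum_all_indices[OF uv(2,3), symmetric])
    finally show "\<phi> (F S x) = (\<Sum>\<iota>\<in>patch_indices k p r \<union> interface_indices n m. cc \<iota> * \<Phi> \<iota> (F S x))" .
  qed
  show ?thesis
  proof (rule that[of cc])
    show "\<forall>x. \<phi> x = (\<Sum>\<iota>\<in>patch_indices k p r \<union> interface_indices n m. cc \<iota> * \<Phi> \<iota> x)" using all by (rule allI)
    show "cc (Patch S i j) = 0" if "i \<in> A" "i < nb" "j < nb" for S i j
      using dA that by (simp add: cc_def)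
    show "\<forall>\<iota>\<in>interface_indices n m. cc \<iota> = 0" if A: "{0, 1} \<subseteq> A"
    proof -
      have "d S 0 j = 0" "d S 1 j = 0" if "j < nb" for S j using dA A that by auto
      then have rows: "row (d S) 0 v = 0" "row (d S) 1 v = 0" for S v by (simp_all add: row_def)
      have "trunc_poly G v = 0" "trunc_poly (H S) v = 0" for S v
        using spec[OF G(2), of v] H2[of S v] rows by simp_all
      then have G0: "G l = 0" "H S l = 0" if "l \<le> k" for S l
        using trunc_poly_eq_0_imp[OF _ that] by auto
      have T0: "(\<Sum>i<n. smult (a i) (J i l)) = 0" if "l \<le> k" for l
        using a G0(1) that by simp
      have N0: "(\<Sum>i<n. smult (a i) (MT PL i l)) + (\<Sum>j<m. smult (a' j) (MN PL j l)) = 0" if "l \<le> k" for l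
        using a G0(2)[OF that, of PL] that by simp
      have "a i = 0" if "i < n" for i by (rule interface_independence(1)[OF T0 N0 that])
      moreover have "a' j = 0" if "j < m" for j by (rule interface_independence(2)[OF T0 N0 that])
      ultimately show ?thesis by (auto simp: cc_def interface_indices_def)
    qed
  qed
qed

theorem basis_families:
  "basis_family (patch_indices k p r) \<Phi> (space_V11 p t F)"
  "basis_family (interface_indices n m) \<Phi> (space_V12 p t F)"
  "basis_family (patch_indices k p r \<union> interface_indices n m) \<Phi> (space_V1 p t F)"
proof -
  have fin: "finite (patch_indices k p r \<union> interface_indices n m)" using finite_indices by simp
  note split = sum.union_disjoint[OF finite_indices indices_disjoint]
  have mono: "coeff_subspace A \<subseteq> coeff_subspace {}" for A
    unfolding coeff_subspace_def by blast
  show "basis_family (patch_indices k p r) \<Phi> (space_V11 p t F)"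
    unfolding space_V11_eq
  proof (rule basis_familyI[OF finite_indices(1) indep_fam_mono[OF indep_phi _ fin] subspace_coeff_subspace phi_patch_in_V11])
    fix h assume "h \<in> coeff_subspace {0, 1}"
    then obtain cc where cc: "\<forall>x. h x = (\<Sum>\<iota>\<in>patch_indices k p r \<union> interface_indices n m. cc \<iota> * \<Phi> \<iota> x)"
      "{0, 1} \<subseteq> {0, 1 :: nat} \<Longrightarrow> \<forall>\<iota>\<in>interface_indices n m. cc \<iota> = 0"
      by (rule phi_span) (rule that)
    have "h x = (\<Sum>\<iota>\<in>patch_indices k p r. cc \<iota> * \<Phi> \<iota> x)" for x
      unfolding spec[OF cc(1), of x] split using cc(2) by (simp del: phi.simps)
    then show "\<exists>cc. \<forall>x. h x = (\<Sum>\<iota>\<in>patch_indices k p r. cc \<iota> * \<Phi> \<iota> x)" by (intro exI[of _ cc] allI)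
  qed auto
  show "basis_family (interface_indices n m) \<Phi> (space_V12 p t F)"
    unfolding space_V12_eq
  proof (rule basis_familyI[OF finite_indices(2) indep_fam_mono[OF indep_phi _ fin] subspace_coeff_subspace phi_interface_in_V12])
    fix h assume "h \<in> coeff_subspace {2..<nb}"
    then obtain cc where cc: "\<forall>x. h x = (\<Sum>\<iota>\<in>patch_indices k p r \<union> interface_indices n m. cc \<iota> * \<Phi> \<iota> x)"
      "\<And>S i j. i \<in> {2..<nb} \<Longrightarrow> i < nb \<Longrightarrow> j < nb \<Longrightarrow> cc (Patch S i j) = 0"
      by (rule phi_span) (rule that)
    have "cc \<iota> = 0" if "\<iota> \<in> patch_indices k p r" for \<iota>
      using that cc(2) by (auto simp: patch_indices_eq)
    then have "h x = (\<Sum>\<iota>\<in>interface_indices n m. cc \<iota> * \<Phi> \<iota> x)" for x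
      unfolding spec[OF cc(1), of x] split by (simp del: phi.simps)
    then show "\<exists>cc. \<forall>x. h x = (\<Sum>\<iota>\<in>interface_indices n m. cc \<iota> * \<Phi> \<iota> x)" by (intro exI[of _ cc] allI)
  qed auto
  show "basis_family (patch_indices k p r \<union> interface_indices n m) \<Phi> (space_V1 p t F)"
    unfolding space_V1_eq
  proof (rule basis_familyI[OF fin indep_phi subspace_coeff_subspace])
    fix \<iota> assume "\<iota> \<in> patch_indices k p r \<union> interface_indices n m"
    then show "\<Phi> \<iota> \<in> coeff_subspace {}"
      using subsetD[OF mono phi_patch_in_V11] subsetD[OF mono phi_interface_in_V12] by (rule UnE)
  next
    fix h assume "h \<in> coeff_subspace {}"
    then obtain cc where cc: "\<forall>x. h x = (\<Sum>\<iota>\<in>patch_indices k p r \<union> interface_indices n m. cc \<iota> * \<Phi> \<iota> x)"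
      by (rule phi_span) (rule that)
    then show "\<exists>cc. \<forall>x. h x = (\<Sum>\<iota>\<in>patch_indices k p r \<union> interface_indices n m. cc \<iota> * \<Phi> \<iota> x)"
      by (rule exI[of _ cc])
  qed
qed

end

section \<open>Traces of the basis functions\<close>

lemma (in breakpoints) spline_count_insert_knots:
  assumes "E \<subseteq> {1..k}"
  shows "spline_count q s E = spline_count q s {} + card E"
proof -
  have "(\<Sum>i\<le>k. knot_mult q s E i) = (\<Sum>i\<le>k. knot_mult q s {} i + (if i \<in> E then 1 else 0))"
    using assms by (intro sum.cong) (auto simp: knot_mult_def)
  also have "\<dots> = (\<Sum>i\<le>k. knot_mult q s {} i) + card ({..k} \<inter> E)"
    by (simp add: sum.distrib sum.If_cases Int_def)
  also have "{..k} \<inter> E = E" using assms by auto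
  finally show ?thesis by (simp add: spline_count_eq)
qed

lemma (in breakpoints) jump_space_mono:
  assumes "\<And>i. i \<le> k \<Longrightarrow> e i \<le> e' i"
  shows "jump_space q e' \<subseteq> jump_space q e"
  using assms unfolding jump_space_def by (blast intro: dvd_trans[OF le_imp_power_dvd])

lemma poly_eq_0_of_integral_square:
  fixes P :: "real poly"
  assumes "integral {0..1} (\<lambda>v. (poly P v)\<^sup>2) \<le> 0"
  shows "P = 0"
proof -
  have cont: "continuous_on {0..1} (\<lambda>v. (poly P v)\<^sup>2)" by (intro continuous_intros)
  have int: "(\<lambda>v. (poly P v)\<^sup>2) integrable_on {0..1}" by (rule integrable_continuous_real[OF cont])
  have "integral {0..1} (\<lambda>v. (poly P v)\<^sup>2) \<ge> 0" by (rule integral_nonneg[OF int]) simp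
  then have "((\<lambda>v. (poly P v)\<^sup>2) has_integral 0) (cbox 0 1)"
    using integrable_integral[OF int] assms by simp
  then have "(poly P v)\<^sup>2 = 0" if "v \<in> {0..1}" for v
    by (intro has_integral_0_cbox_imp_0[of 0 1 "\<lambda>v. (poly P v)\<^sup>2" v]) (use cont that in auto)
  then have "{0..1} \<subseteq> {v. poly P v = 0}" by auto
  moreover have "infinite {0..1::real}" by simp
  ultimately show ?thesis using poly_roots_finite[of P] finite_subset by blast
qed

text \<open>The zero pair is an admissible competitor with value 0, so a minimiser has both norms 0.
  This makes the second summand of \<open>phi_trace\<close> harmless when \<beta> = 0 and the trace
  has no additional smoothness.\<close>

lemma minimal_beta_split_0:
  assumes "minimal_beta_split \<alpha> 0 b"
  shows "b S = 0"
proof -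
  let ?I = "\<lambda>S. integral {0..1} (\<lambda>v. (poly (b S) v)\<^sup>2)"
  have "beta_split \<alpha> 0 (\<lambda>_. 0)" by (simp add: beta_split_def)
  then have "\<not> 0 < ?I PL + ?I PR"
    using assms unfolding minimal_beta_split_def is_arg_min_def by fastforce
  moreover have "?I PL \<ge> 0" "?I PR \<ge> 0"
    by (intro integral_nonneg integrable_continuous_real continuous_intros; simp)+
  ultimately have "?I PL \<le> 0" "?I PR \<le> 0" by linarith+
  then have "?I S \<le> 0" by (cases S) simp_all
  then show ?thesis by (rule poly_eq_0_of_integral_square)
qed

context spline_geometry
begin

lemma break_eq: "l \<in> {1..k} \<Longrightarrow> break l = \<tau> l"
  by (simp add: break_def)

text \<open>\<beta> is a difference of products of two linear polynomials, hence has at most two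
  roots. The cases of \<open>trace_choice\<close> are therefore exhaustive.\<close>

lemma z_beta_le:
  assumes "beta_split \<alpha> \<beta> b" "\<beta> \<noteq> 0"
  shows "z_beta k \<tau> \<beta> \<le> 2"
proof -
  have "degree (\<alpha> S * b S') \<le> 2" for S S'
  proof -
    have "degree (\<alpha> S) \<le> 1" "degree (b S') \<le> 1"
      using AS_G1 assms(1) unfolding AS_G1_def beta_split_def by auto
    then show ?thesis using degree_mult_le[of "\<alpha> S" "b S'"] by linarith
  qed
  then have deg: "degree \<beta> \<le> 2" using assms(1) by (auto simp: beta_split_def intro: degree_diff_le)
  have "inj_on \<tau> (root_knots k \<tau> \<beta>)"
    using strict_mono_on_imp_inj_on[OF strict_mono_breaks] by (rule inj_on_subset) (auto simp: root_knots_def)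
  then have "z_beta k \<tau> \<beta> = card (\<tau> ` root_knots k \<tau> \<beta>)" by (simp add: z_beta_def card_image)
  also have "\<dots> \<le> card {x. poly \<beta> x = 0}"
    using poly_roots_finite[OF assms(2)] by (intro card_mono) (auto simp: root_knots_def)
  also have "\<dots> \<le> degree \<beta>" by (rule card_poly_roots_bound[OF assms(2)])
  finally show ?thesis using deg by simp
qed

text \<open>Merges the three cases of \<open>trace_choice\<close> into one pattern: B-splines of
  regularity \<open>s\<close>, followed by one extra B-spline for each knot of \<open>E\<close>,
  assigned by a bijection \<open>m\<close>.\<close>

lemma trace_choice_uniform:
  assumes b: "beta_split \<alpha> \<beta> b" and choice: "trace_choice k \<tau> p r \<alpha> \<beta> b N g"
  defines "s \<equiv> if \<beta> = 0 then r else r + 1" and "E \<equiv> if \<beta> = 0 then {} else root_knots k \<tau> \<beta>"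
  obtains m where "n_tilde k \<tau> p r \<beta> = spline_count p s {} + card E"
    "bij_betw m {spline_count p s {}..<n_tilde k \<tau> p r \<beta>} E"
    "\<And>i v. i < spline_count p s {} \<Longrightarrow> v \<in> {0..1} \<Longrightarrow>
       N i v = bspline (knots k \<tau> p s {}) p i v \<and> g i v = 0"
    "\<And>i. i \<in> {spline_count p s {}..<n_tilde k \<tau> p r \<beta>} \<Longrightarrow>
       extra_choice k \<tau> p r \<alpha> b (m i) (N i) (g i)"
proof -
  define n where "n = spline_count p s {}"
  define n' where "n' = n_tilde k \<tau> p r \<beta>"
  have s: "1 \<le> s" "s \<le> p" using r by (auto simp: s_def)
  have E: "E \<subseteq> {1..k}" by (auto simp: E_def root_knots_def)
  have tilde: "tilde_knots k \<tau> p r \<beta> = knots k \<tau> p s E" by (simp add: tilde_knots_def s_def E_def)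
  \<comment> \<open>The dimension count places the extra functions exactly behind the B-splines
    without additional knots.\<close>
  have n': "n' = n + card E"
    unfolding n'_def n_def n_tilde_def tilde dim_spline_space[OF s] by (rule spline_count_insert_knots[OF E])
  have finE: "finite E" using finite_subset[OF E] by simp
  consider "\<beta> = 0 \<or> z_beta k \<tau> \<beta> = 0" | "\<beta> \<noteq> 0" "z_beta k \<tau> \<beta> = 1" | "\<beta> \<noteq> 0" "z_beta k \<tau> \<beta> = 2"
    using z_beta_le[OF b] by linarith
  then have "\<exists>m. bij_betw m {n..<n'} E \<and>
      (\<forall>i<n. \<forall>v\<in>{0..1}. N i v = bspline (knots k \<tau> p s {}) p i v \<and> g i v = 0) \<and>
      (\<forall>i\<in>{n..<n'}. extra_choice k \<tau> p r \<alpha> b (m i) (N i) (g i))"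
  proof cases
    case 1
    then have "E = {}" using finE by (auto simp: E_def z_beta_def)
    then show ?thesis
      using choice 1 n' unfolding trace_choice_def Let_def tilde n'_def[symmetric]
      by (intro exI[of _ id]) auto
  next
    case 2
    then obtain l where l: "root_knots k \<tau> \<beta> = {l}" "extra_choice k \<tau> p r \<alpha> b l (N (n' - 1)) (g (n' - 1))"
      and base: "\<forall>i<n' - 1. \<forall>v\<in>{0..1}. N i v = bspline (knots k \<tau> p (r + 1) {}) p i v \<and> g i v = 0"
      using choice unfolding trace_choice_def Let_def n'_def[symmetric] by auto
    have nE: "n' = Suc n" "E = {l}" "s = r + 1" using n' l 2 by (auto simp: E_def s_def)
    then show ?thesis using l base
      by (intro exI[of _ "\<lambda>_. l"]) (simp add: bij_betw_def)
  next
    case 3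
    then obtain l l' where l: "l \<noteq> l'" "root_knots k \<tau> \<beta> = {l, l'}"
      "extra_choice k \<tau> p r \<alpha> b l (N (n' - 2)) (g (n' - 2))"
      "extra_choice k \<tau> p r \<alpha> b l' (N (n' - 1)) (g (n' - 1))"
      and base: "\<forall>i<n' - 2. \<forall>v\<in>{0..1}. N i v = bspline (knots k \<tau> p (r + 1) {}) p i v \<and> g i v = 0"
      using choice unfolding trace_choice_def Let_def n'_def[symmetric] by auto
    have nE: "n' = Suc (Suc n)" "E = {l, l'}" "s = r + 1" using n' l 3 by (auto simp: E_def s_def)
    have set: "{n..<n'} = {n, Suc n}" using nE by auto
    show ?thesis unfolding set using l base nE
      by (intro exI[of _ "\<lambda>i. if i = n then l else l'"]) (auto simp: bij_betw_def inj_on_def)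
  qed
  then show ?thesis using that n' unfolding n_def n'_def by blast
qed

lemma trace_basis_exists:
  assumes minimal: "minimal_beta_split \<alpha> \<beta> b" and choice: "trace_choice k \<tau> p r \<alpha> \<beta> b N g"
  obtains e J Jb c where
    "trace_basis k \<tau> p r F \<alpha> \<beta> b (n_tilde k \<tau> p r \<beta>) (n_bar k \<tau> p r \<alpha>) e J Jb c N g"
proof -
  have b: "beta_split \<alpha> \<beta> b" using minimal by (simp add: minimal_beta_split_def is_arg_min_def)
  define s where "s = (if \<beta> = 0 then r else r + 1)"
  define E where "E = (if \<beta> = 0 then {} else root_knots k \<tau> \<beta>)"
  define n where "n = spline_count p s {}"
  define n' where "n' = n_tilde k \<tau> p r \<beta>"
  from trace_choice_uniform[OF b choice, folded s_def E_def n_def n'_def]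
  obtain m where n': "n' = n + card E" and m: "bij_betw m {n..<n'} E"
    and base: "\<And>i v. i < n \<Longrightarrow> v \<in> {0..1} \<Longrightarrow> N i v = bspline (knots k \<tau> p s {}) p i v \<and> g i v = 0"
    and extra: "\<And>i. i \<in> {n..<n'} \<Longrightarrow> extra_choice k \<tau> p r \<alpha> b (m i) (N i) (g i)"
    by blast
  have s: "1 \<le> s" "s < p" "s \<le> p" using r by (auto simp: s_def)
  have E: "E \<subseteq> {1..k}" by (auto simp: E_def root_knots_def)
  have mE: "m i \<in> E" if "i \<in> {n..<n'}" for i using bij_betwE[OF m] that by blast
  have sE: "s = r + 1" "\<beta> \<noteq> 0" "l \<in> {1..k}" "poly \<beta> (break l) = 0" if "l \<in> E" for l
    using that by (auto simp: E_def s_def root_knots_def break_def split: if_splits)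
  \<comment> \<open>The constant in g_1 = c N': zero for the ordinary B-splines, and for an extra
    one the value at its knot that makes c \<alpha>^L + b^L vanish there.\<close>
  define c where "c i = (if i < n then 0 else - (poly (b PL) (break (m i)) / poly (\<alpha> PL) (break (m i))))" for i
  define e' where "e' i = (if i < n then contact s {} else contact s {m i})" for i
  have "\<exists>J. J \<in> jump_space p (e' i) \<and> (\<forall>v\<in>{0..1}. N i v = trunc_poly J v)
      \<and> (if i < n then bspline (knots k \<tau> p s {}) p i = trunc_poly J else \<not> [:- break (m i), 1:] ^ Suc s dvd J (m i))"
    if i: "i < n'" for i
  proof (cases "i < n")
    case True
    have "bspline (knots k \<tau> p s {}) p i \<in> trunc_poly ` jump_space p (contact s {})"
      using bspline_in_spline_space[of i p s "{}"] True spline_space_eq[of s p "{}"] s by (simp add: n_def)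
    then obtain J where "J \<in> jump_space p (contact s {})" "bspline (knots k \<tau> p s {}) p i = trunc_poly J"
      by (elim imageE)
    then show ?thesis using base[OF True] True unfolding e'_def by (intro exI[of _ J]) simp
  next
    case False
    then have i': "i \<in> {n..<n'}" using i by simp
    note l = sE[OF mE[OF i']]
    obtain j where j: "j < spline_count p s {m i}"
      "\<And>v. v \<in> {0..1} \<Longrightarrow> N i v = bspline (knots k \<tau> p s {m i}) p j v" and nz: "N i (break (m i)) \<noteq> 0"
      using extra[OF i'] unfolding extra_choice_def num_bsplines_knots l(1)[symmetric] break_eq[OF l(3)] by blast
    have "bspline (knots k \<tau> p s {m i}) p j \<in> trunc_poly ` jump_space p (contact s {m i})"
      using bspline_in_spline_space[OF j(1)] spline_space_eq[of s p "{m i}"] s by simp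
    then obtain J where J: "J \<in> jump_space p (contact s {m i})" "bspline (knots k \<tau> p s {m i}) p j = trunc_poly J"
      by (elim imageE)
    have "break (m i) \<in> {0..1}" using l(3) break_nonneg break_less_1[of "m i"] by simp
    then have "bspline (knots k \<tau> p s {m i}) p j (break (m i)) \<noteq> 0" using j(2) nz by auto
    then have "\<not> [:- break (m i), 1:] ^ Suc s dvd J (m i)"
      using bspline_not_smoother[OF l(3) s(1,2) j(1) _ J] by simp
    then show ?thesis using J j(2) False unfolding e'_def by (intro exI[of _ J]) simp
  qed
  then have "\<forall>i\<in>{..<n'}. \<exists>J. J \<in> jump_space p (e' i) \<and> (\<forall>v\<in>{0..1}. N i v = trunc_poly J v)
      \<and> (if i < n then bspline (knots k \<tau> p s {}) p i = trunc_poly J else \<not> [:- break (m i), 1:] ^ Suc s dvd J (m i))"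
    by simp
  from bchoice[OF this]
  obtain J where J: "\<And>i. i < n' \<Longrightarrow> J i \<in> jump_space p (e' i)"
    and NJ: "\<And>i v. i < n' \<Longrightarrow> v \<in> {0..1} \<Longrightarrow> N i v = trunc_poly (J i) v"
    and J': "\<And>i. i < n' \<Longrightarrow> if i < n then bspline (knots k \<tau> p s {}) p i = trunc_poly (J i)
        else \<not> [:- break (m i), 1:] ^ Suc s dvd J i (m i)"
    by (auto simp only: lessThan_iff)
  \<comment> \<open>An extra B-spline has contact s = r + 1 >= 2 at its own knot, so every trace
    function is differentiable.\<close>
  have e'_pos: "2 \<le> e' i l" if "i < n'" "l \<in> {1..k}" for i l
    using sE(1)[OF mE, of i] that r s by (auto simp: e'_def contact_def)
  define q where "q = p - d_alpha \<alpha>"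
  have "d_alpha \<alpha> \<le> 1" using AS_G1 by (simp add: d_alpha_def AS_G1_def)
  then have q: "r \<le> q" using r by (simp add: q_def)
  define nb' where "nb' = n_bar k \<tau> p r \<alpha>"
  have nb': "nb' = spline_count q r {}"
    unfolding nb'_def n_bar_def q_def[symmetric] by (rule dim_spline_space[OF r(1) q])
  have "\<exists>Jb. Jb \<in> jump_space q (contact r {}) \<and> bspline (knots k \<tau> q r {}) q j = trunc_poly Jb" if "j < nb'" for j
  proof -
    have "bspline (knots k \<tau> q r {}) q j \<in> trunc_poly ` jump_space q (contact r {})"
      using bspline_in_spline_space[of j q r "{}"] that spline_space_eq[of r q "{}"] r q by (simp add: nb')
    then show ?thesis by blast
  qed
  then obtain Jb where Jb: "\<And>j. j < nb' \<Longrightarrow> Jb j \<in> jump_space q (contact r {})"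
    "\<And>j. j < nb' \<Longrightarrow> bspline (knots k \<tau> q r {}) q j = trunc_poly (Jb j)"
    by metis
  have base1: "bspline (knots k \<tau> p s {}) p i = trunc_poly (J i)" if "i < n" for i using J'[of i] that n' by simp
  have base2: "J i \<in> jump_space p (contact s {})" if "i < n" for i using J[of i] that n' by (simp add: e'_def)
  have extra1: "J i \<in> jump_space p (contact s {m i})" if "i \<in> {n..<n'}" for i using J[of i] that by (simp add: e'_def)
  have extra2: "\<not> [:- break (m i), 1:] ^ Suc s dvd J i (m i)" if "i \<in> {n..<n'}" for i using J'[of i] that by simp
  have nn': "n \<le> n'" using n' by simp
  show ?thesis
  proof (rule that[of "contact s E" J Jb c], unfold n'_def[symmetric] nb'_def[symmetric], unfold_locales)
    show "beta_split \<alpha> \<beta> b" by (rule b)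
    show "contact s E 0 = 0" by simp
    show "contact s E l = r + 1 \<or> contact s E l = r + 2 \<and> poly \<beta> (break l) \<noteq> 0" if "l \<in> {1..k}" for l
      using that by (auto simp: contact_def s_def E_def root_knots_def break_eq)
    show "J i \<in> jump_space p (contact s E)" if "i < n'" for i
      by (rule subsetD[OF jump_space_mono J[OF that]]) (use mE[of i] that in \<open>auto simp: contact_def e'_def\<close>)
    show "\<exists>a. \<forall>l\<le>k. X l = (\<Sum>i<n'. smult (a i) (J i l))" if "X \<in> jump_space p (contact s E)" for X
      by (rule extended_jumps_span[OF s(1,3) n_def E m nn' base1 base2 extra1 extra2 that])
    show "a i = 0" if "\<And>l. l \<le> k \<Longrightarrow> (\<Sum>i<n'. smult (a i) (J i l)) = 0" "i < n'" for a i
      by (rule extended_jumps_indep[OF s(1,3) n_def E m nn' base1 base2 extra1 extra2 that])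
    show "[:- break l, 1:] ^ (r + 1) dvd (smult (c i) (\<alpha> S) + b S) * pderiv (J i l)"
      if i: "i < n'" and l: "l \<in> {1..k}" for i l S
    proof -
      have dvd: "[:- break l, 1:] ^ e' i l dvd J i l" by (rule jump_spaceD(2)[OF J[OF i]]) (use l in simp)
      \<comment> \<open>Three reasons for the same order r + 1: for \<beta> = 0 the first factor is
        zero; where the trace has contact r + 2, its derivative has order r + 1; at the own knot of
        an extra function the derivative has order r only, and the first factor supplies the missing
        zero.\<close>
      consider "\<beta> = 0" | "\<beta> \<noteq> 0" "i < n \<or> l \<noteq> m i" | "i \<in> {n..<n'}" "l = m i" using i by force
      then show ?thesis
      proof cases
        case 1
        then have "n' = n" using n' by (simp add: E_def)
        then have "smult (c i) (\<alpha> S) + b S = 0" using minimal_beta_split_0[of \<alpha> b S] minimal i 1 by (simp add: c_def)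
        then show ?thesis by (simp only: mult_zero_left dvd_0_right)
      next
        case 2
        then have "e' i l = Suc (r + 1)" using l by (auto simp: e'_def contact_def s_def)
        then show ?thesis using dvd linear_power_dvd_pderiv[of "break l" "r + 1" "J i l"] by (intro dvd_mult) simp
      next
        case 3
        note lE = sE[OF mE[OF 3(1)], folded 3(2)]
        have "e' i l = Suc r" using 3 lE(1,3) by (simp add: e'_def contact_def)
        then have d: "[:- break l, 1:] ^ r dvd pderiv (J i l)"
          using dvd linear_power_dvd_pderiv[of "break l" r "J i l"] by simp
        have bl: "break l \<in> {0..1}" using l break_nonneg break_less_1[of l] by simp
        have \<alpha>0: "poly (\<alpha> PL) (break l) \<noteq> 0" by (rule alpha_nonzero[OF bl])
        \<comment> \<open>This is \<beta> = 0 at the knot; it carries the zero of c \<alpha>^L + b^L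
          over to the right side.\<close>
        have "poly (\<alpha> PL) (break l) * poly (b PR) (break l) = poly (\<alpha> PR) (break l) * poly (b PL) (break l)"
          using lE(4) b by (simp add: beta_split_def)
        then have "poly (smult (c i) (\<alpha> S) + b S) (break l) = 0"
          using 3 \<alpha>0 by (cases S) (simp_all add: c_def field_simps)
        then have "[:- break l, 1:] dvd smult (c i) (\<alpha> S) + b S" by (simp only: poly_eq_0_iff_dvd)
        then show ?thesis using mult_dvd_mono[OF _ d] by (simp only: power_Suc Suc_eq_plus1[symmetric])
      qed
    qed
    show "nb' = spline_count (p - d_alpha \<alpha>) r {}" using nb' by (simp add: q_def)
    show "Jb j \<in> jump_space (p - d_alpha \<alpha>) (contact r {})" if "j < nb'" for j
      using Jb(1)[OF that] by (simp add: q_def)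
    show "bspline (knots k \<tau> (p - d_alpha \<alpha>) r {}) (p - d_alpha \<alpha>) j = trunc_poly (Jb j)" if "j < nb'" for j
      using Jb(2)[OF that] by (simp add: q_def)
    show "N i v = trunc_poly (J i) v" if "i < n'" "v \<in> {0..1}" for i v by (rule NJ[OF that])
    show "g i v = c i * trunc_poly (\<lambda>l. pderiv (J i l)) v" if i: "i < n'" and v: "v \<in> {0..1}" for i v
    proof (cases "i < n")
      case True
      then show ?thesis using base[OF True v] by (simp add: c_def)
    next
      case False
      then have i': "i \<in> {n..<n'}" using i by simp
      have "deriv01 (N i) v = deriv01 (trunc_poly (J i)) v"
        by (rule deriv01_cong) (use NJ[OF i] v in auto)
      also have "\<dots> = trunc_poly (\<lambda>l. pderiv (J i l)) v"
        by (rule deriv01_trunc_poly[OF J[OF i] e'_pos[OF i] v])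
      finally show ?thesis
        using extra[OF i'] v False break_eq[OF sE(3)[OF mE[OF i']]] by (simp add: extra_choice_def c_def)
    qed
  qed
qed

end

theorem mainTheorem2:
  fixes p r k :: nat
    and \<tau> :: "nat \<Rightarrow> real"
    and F :: "side \<Rightarrow> real \<times> real \<Rightarrow> real \<times> real"
    and \<alpha> b :: "side \<Rightarrow> real poly"
    and \<beta> :: "real poly"
    and N g :: "nat \<Rightarrow> real \<Rightarrow> real"
  assumes "p \<ge> 3" and "1 \<le> r" and "r \<le> p - 2"
    and "strict_mono_on {1..k} \<tau>" and "\<forall>i\<in>{1..k}. 0 < \<tau> i \<and> \<tau> i < 1"
    and "two_patch_geometry p (knots k \<tau> p r {}) F"
    and "AS_G1 F \<alpha> \<beta>"
    and "minimal_beta_split \<alpha> \<beta> b"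
    and "trace_choice k \<tau> p r \<alpha> \<beta> b N g"
  shows "basis_family (patch_indices k p r) (phi k \<tau> p r F \<alpha> b N g)
           (space_V11 p (knots k \<tau> p r {}) F)
       \<and> basis_family (interface_indices (n_tilde k \<tau> p r \<beta>) (n_bar k \<tau> p r \<alpha>))
           (phi k \<tau> p r F \<alpha> b N g) (space_V12 p (knots k \<tau> p r {}) F)
       \<and> basis_family
           (patch_indices k p r \<union> interface_indices (n_tilde k \<tau> p r \<beta>) (n_bar k \<tau> p r \<alpha>))
           (phi k \<tau> p r F \<alpha> b N g) (space_V1 p (knots k \<tau> p r {}) F)"
proof -
  interpret spline_geometry k \<tau> p r F \<alpha> \<beta>
    using assms by unfold_locales auto
  obtain e J Jb c where
    "trace_basis k \<tau> p r F \<alpha> \<beta> b (n_tilde k \<tau> p r \<beta>) (n_bar k \<tau> p r \<alpha>) e J Jb c N g"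
    by (rule trace_basis_exists[OF assms(8,9)])
  then interpret trace_basis k \<tau> p r F \<alpha> \<beta> b "n_tilde k \<tau> p r \<beta>" "n_bar k \<tau> p r \<alpha>" e J Jb c N g .
  show ?thesis using basis_families by blast
qed

end
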